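(* For each $n\ge4$, the first resonance variety $\mathcal R_1(P\Sigma_n^+)$ of the upper McCool group, with the scheme structure defined by the annihilator ideal of the infinitesimal Alexander invariant $\mathfrak B(P\Sigma_n^+)$, is not weakly reduced as a scheme.
   Context: Let $F_n=\langle x_1,\dots,x_n\rangle$ be the free group; for $i\neq j$ let $\alpha_{ij}\in\mathrm{Aut}(F_n)$ send $x_i\mapsto x_jx_ix_j^{-1}$ and fix the other generators. The upper McCool group $P\Sigma_n^+$ is the subgroup of $\mathrm{Aut}(F_n)$ generated by the $\alpha_{ij}$ with $i>j$. For a finitely presented group $G$, the holonomy Lie algebra is $\mathfrak h(G)=\mathfrak{lie}(H_1(G;\mathbb C))/\langle\mathrm{im}\,\partial_G\rangle$, the free Lie algebra on $H_1(G;\mathbb C)$ modulo the Lie ideal generated by the image of $\partial_G\colon H^2(G;\mathbb C)^*\to H_1(G;\mathbb C)\wedge H_1(G;\mathbb C)$, the dual of the cup product. The infinitesimal Alexander invariant is $\mathfrak B(G)=\mathfrak h(G)'/\mathfrak h(G)''$, a module over $S=\mathrm{Sym}(H_1(G;\mathbb C))$ (the coordinate ring of $H^1(G;\mathbb C)$) via the adjoint action. For $G=P\Sigma_n^+$, the first resonance variety $\mathcal R_1(G)=\{a\in H^1(G;\mathbb C)\mid\exists b\in H^1(G;\mathbb C),\ b\notin\mathbb C a,\ ab=0\}$ is viewed as the set of closed points of the scheme $\mathrm{Spec}(S/\mathrm{Ann}(\mathfrak B(G)))$. For a finitely generated $S$-module $M$, let $\mathrm{Ann}(M)=\bigcap_{i}Q_i$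 be a minimal primary decomposition, with associated primes $\mathfrak q_i=\sqrt{Q_i}$. The variety $\mathbf V(\mathrm{Ann}(M))$ is weakly reduced as a scheme if $Q_i$ is radical for every isolated component (minimal $\mathfrak q_i$), and every remaining (embedded) $\mathfrak q_i$ equals $\mathfrak m$, the maximal ideal of $S$ at $0$; i.e., the only possible embedded component is the point $0$. *)

theory Defs
  imports "HOL-Algebra.Algebra" "HOL-Library.Poly_Mapping"
    "HOL-Algebra.Algebraic_Closure_Type"
begin

text \<open>The letter \<open>(i, False)\<close> stands for the generator \<open>x\<^sub>i\<close>, and \<open>(i, True)\<close> for its inverse.
  Elements of the free group are reduced words.\<close>

type_synonym letter = "nat \<times> bool"

definition inv_letter :: "letter \<Rightarrow> letter" where
  "inv_letter a = (fst a, \<not> snd a)"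

definition reduced_word :: "letter list \<Rightarrow> bool" where
  "reduced_word w \<longleftrightarrow> successively (\<lambda>a b. b \<noteq> inv_letter a) w"

fun push_letter :: "letter \<Rightarrow> letter list \<Rightarrow> letter list" where
  "push_letter a [] = [a]"
| "push_letter a (b # w) = (if b = inv_letter a then w else a # b # w)"

definition free_group :: "nat \<Rightarrow> letter list monoid" where
  "free_group n =
    \<lparr>carrier = {w. reduced_word w \<and> fst ` set w \<subseteq> {1..n}},
     monoid.mult = (\<lambda>u v. foldr push_letter u v),
     one = []\<rparr>"

definition free_gen :: "nat \<Rightarrow> letter list" where
  "free_gen i = [(i, False)]"

text \<open>The value at a word \<open>w\<close> of the homomorphism that sends \<open>x\<^sub>k\<close> to \<open>f k\<close>.\<close>

definition free_subst :: "('a, 'm) monoid_scheme \<Rightarrow> (nat \<Rightarrow> 'a) \<Rightarrow> letter list \<Rightarrow> 'a" where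
  "free_subst G f w =
    foldr (\<lambda>(k, e) y. (if e then inv\<^bsub>G\<^esub> (f k) else f k) \<otimes>\<^bsub>G\<^esub> y) w \<one>\<^bsub>G\<^esub>"

definition mccool_gen :: "nat \<Rightarrow> nat \<Rightarrow> nat \<Rightarrow> letter list \<Rightarrow> letter list" where
  "mccool_gen n i j =
    (let F = free_group n in
     restrict (free_subst F (\<lambda>k. if k = i
         then free_gen j \<otimes>\<^bsub>F\<^esub> free_gen i \<otimes>\<^bsub>F\<^esub> inv\<^bsub>F\<^esub> (free_gen j)
         else free_gen k)) (carrier F))"

definition upper_mccool_group :: "nat \<Rightarrow> (letter list \<Rightarrow> letter list) monoid" where
  "upper_mccool_group n =
    subgroup_generated (AutoGroup (free_group n))
      {mccool_gen n i j | i j. 1 \<le> j \<and> j < i \<and> i \<le> n}"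

text \<open>Complex vector spaces are \<open>module\<close> records over the ring of complex numbers; the fields
  \<open>mult\<close> and \<open>one\<close> of such a record are not used. For a Lie algebra, the field \<open>mult\<close> is the Lie
  bracket.\<close>

type_synonym 'v cspace = "(complex, 'v) module"

abbreviation complex_ring :: "complex ring" where
  "complex_ring \<equiv> ring_of_type_algebra"

definition quot_space :: "'v cspace \<Rightarrow> 'v set \<Rightarrow> 'v set cspace" where
  "quot_space V N =
    \<lparr>carrier = a_rcosets\<^bsub>V\<^esub> N,
     monoid.mult = rcoset_mult V N,
     one = undefined,
     ring.zero = N,
     ring.add = set_add V,
     module.smult = (\<lambda>c A. \<Union>x\<in>A. N +>\<^bsub>V\<^esub> (c \<odot>\<^bsub>V\<^esub> x))\<rparr>"

definition lin_span :: "'v cspace \<Rightarrow> 'v set \<Rightarrow> 'v set" where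
  "lin_span V A = \<Inter>{N. submodule N complex_ring V \<and> A \<subseteq> N}"

definition linear_forms :: "'v cspace \<Rightarrow> ('v \<Rightarrow> complex) set" where
  "linear_forms V =
    {\<phi>. (\<forall>x\<in>carrier V. \<forall>y\<in>carrier V. \<phi> (x \<oplus>\<^bsub>V\<^esub> y) = \<phi> x + \<phi> y) \<and>
        (\<forall>c. \<forall>x\<in>carrier V. \<phi> (c \<odot>\<^bsub>V\<^esub> x) = c * \<phi> x)}"

definition lie_ideal :: "'v cspace \<Rightarrow> 'v set \<Rightarrow> bool" where
  "lie_ideal L I \<longleftrightarrow> submodule I complex_ring L \<and>
    (\<forall>x\<in>carrier L. \<forall>y\<in>I. x \<otimes>\<^bsub>L\<^esub> y \<in> I)"

definition lie_ideal_gen :: "'v cspace \<Rightarrow> 'v set \<Rightarrow> 'v set" where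
  "lie_ideal_gen L A = \<Inter>{I. lie_ideal L I \<and> A \<subseteq> I}"

definition lie_derived :: "'v cspace \<Rightarrow> 'v set \<Rightarrow> 'v set" where
  "lie_derived L A = lin_span L {x \<otimes>\<^bsub>L\<^esub> y | x y. x \<in> A \<and> y \<in> A}"

text \<open>The free Lie algebra on a vector space \<open>V\<close> is the Lie algebra generated by symbols
  \<open>LGen v\<close> that depend linearly on \<open>v \<in> V\<close>: bracket expressions modulo the smallest congruence
  that contains the axioms of complex Lie algebras and this linearity. Since \<open>V\<close> is only a part
  of the type \<open>'v\<close>, the symbols of the remaining elements of the type are set to zero.\<close>

datatype 'v lie_term =
    LGen 'v
  | LZero
  | LAdd "'v lie_term" "'v lie_term"
  | LScale complex "'v lie_term"
  | LBracket "'v lie_term" "'v lie_term"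

inductive lie_eq :: "'v cspace \<Rightarrow> 'v lie_term \<Rightarrow> 'v lie_term \<Rightarrow> bool" for V :: "'v cspace" where
  refl: "lie_eq V s s"
| sym: "lie_eq V s t \<Longrightarrow> lie_eq V t s"
| trans: "lie_eq V s t \<Longrightarrow> lie_eq V t u \<Longrightarrow> lie_eq V s u"
| cong_add: "lie_eq V s s' \<Longrightarrow> lie_eq V t t' \<Longrightarrow> lie_eq V (LAdd s t) (LAdd s' t')"
| cong_scale: "lie_eq V s s' \<Longrightarrow> lie_eq V (LScale c s) (LScale c s')"
| cong_bracket: "lie_eq V s s' \<Longrightarrow> lie_eq V t t' \<Longrightarrow> lie_eq V (LBracket s t) (LBracket s' t')"
| add_assoc: "lie_eq V (LAdd (LAdd s t) u) (LAdd s (LAdd t u))"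
| add_commute: "lie_eq V (LAdd s t) (LAdd t s)"
| add_zero: "lie_eq V (LAdd s LZero) s"
| add_neg: "lie_eq V (LAdd s (LScale (-1) s)) LZero"
| scale_add: "lie_eq V (LScale c (LAdd s t)) (LAdd (LScale c s) (LScale c t))"
| add_scale: "lie_eq V (LScale (c + d) s) (LAdd (LScale c s) (LScale d s))"
| scale_scale: "lie_eq V (LScale c (LScale d s)) (LScale (c * d) s)"
| scale_one: "lie_eq V (LScale 1 s) s"
| bracket_add_left: "lie_eq V (LBracket (LAdd s t) u) (LAdd (LBracket s u) (LBracket t u))"
| bracket_add_right: "lie_eq V (LBracket u (LAdd s t)) (LAdd (LBracket u s) (LBracket u t))"
| bracket_scale_left: "lie_eq V (LBracket (LScale c s) t) (LScale c (LBracket s t))"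
| bracket_scale_right: "lie_eq V (LBracket s (LScale c t)) (LScale c (LBracket s t))"
| bracket_self: "lie_eq V (LBracket s s) LZero"
| jacobi: "lie_eq V (LAdd (LBracket s (LBracket t u))
             (LAdd (LBracket t (LBracket u s)) (LBracket u (LBracket s t)))) LZero"
| gen_add: "v \<in> carrier V \<Longrightarrow> w \<in> carrier V \<Longrightarrow>
    lie_eq V (LGen (v \<oplus>\<^bsub>V\<^esub> w)) (LAdd (LGen v) (LGen w))"
| gen_scale: "v \<in> carrier V \<Longrightarrow> lie_eq V (LGen (c \<odot>\<^bsub>V\<^esub> v)) (LScale c (LGen v))"
| gen_outside: "v \<notin> carrier V \<Longrightarrow> lie_eq V (LGen v) LZero"

definition lie_class :: "'v cspace \<Rightarrow> 'v lie_term \<Rightarrow> 'v lie_term set" where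
  "lie_class V t = {s. lie_eq V s t}"

definition free_lie :: "'v cspace \<Rightarrow> 'v lie_term set cspace" where
  "free_lie V =
    \<lparr>carrier = range (lie_class V),
     monoid.mult = (\<lambda>A B. \<Union>x\<in>A. \<Union>y\<in>B. lie_class V (LBracket x y)),
     one = undefined,
     ring.zero = lie_class V LZero,
     ring.add = (\<lambda>A B. \<Union>x\<in>A. \<Union>y\<in>B. lie_class V (LAdd x y)),
     module.smult = (\<lambda>c A. \<Union>x\<in>A. lie_class V (LScale c x))\<rparr>"

text \<open>The symmetric algebra on \<open>V\<close> is built in the same way, from the axioms of commutative
  complex algebras.\<close>

datatype 'v sym_term =
    SGen 'v
  | SConst complex
  | SAdd "'v sym_term" "'v sym_term"
  | SMult "'v sym_term" "'v sym_term"

inductive sym_eq :: "'v cspace \<Rightarrow> 'v sym_term \<Rightarrow> 'v sym_term \<Rightarrow> bool" for V :: "'v cspace" where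
  refl: "sym_eq V s s"
| sym: "sym_eq V s t \<Longrightarrow> sym_eq V t s"
| trans: "sym_eq V s t \<Longrightarrow> sym_eq V t u \<Longrightarrow> sym_eq V s u"
| cong_add: "sym_eq V s s' \<Longrightarrow> sym_eq V t t' \<Longrightarrow> sym_eq V (SAdd s t) (SAdd s' t')"
| cong_mult: "sym_eq V s s' \<Longrightarrow> sym_eq V t t' \<Longrightarrow> sym_eq V (SMult s t) (SMult s' t')"
| add_assoc: "sym_eq V (SAdd (SAdd s t) u) (SAdd s (SAdd t u))"
| add_commute: "sym_eq V (SAdd s t) (SAdd t s)"
| add_zero: "sym_eq V (SAdd s (SConst 0)) s"
| add_neg: "sym_eq V (SAdd s (SMult (SConst (-1)) s)) (SConst 0)"
| mult_assoc: "sym_eq V (SMult (SMult s t) u) (SMult s (SMult t u))"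
| mult_commute: "sym_eq V (SMult s t) (SMult t s)"
| mult_one: "sym_eq V (SMult (SConst 1) s) s"
| distrib: "sym_eq V (SMult s (SAdd t u)) (SAdd (SMult s t) (SMult s u))"
| const_add: "sym_eq V (SConst (c + d)) (SAdd (SConst c) (SConst d))"
| const_mult: "sym_eq V (SConst (c * d)) (SMult (SConst c) (SConst d))"
| gen_add: "v \<in> carrier V \<Longrightarrow> w \<in> carrier V \<Longrightarrow>
    sym_eq V (SGen (v \<oplus>\<^bsub>V\<^esub> w)) (SAdd (SGen v) (SGen w))"
| gen_scale: "v \<in> carrier V \<Longrightarrow> sym_eq V (SGen (c \<odot>\<^bsub>V\<^esub> v)) (SMult (SConst c) (SGen v))"
| gen_outside: "v \<notin> carrier V \<Longrightarrow> sym_eq V (SGen v) (SConst 0)"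

definition sym_class :: "'v cspace \<Rightarrow> 'v sym_term \<Rightarrow> 'v sym_term set" where
  "sym_class V t = {s. sym_eq V s t}"

definition sym_alg :: "'v cspace \<Rightarrow> 'v sym_term set ring" where
  "sym_alg V =
    \<lparr>carrier = range (sym_class V),
     monoid.mult = (\<lambda>A B. \<Union>x\<in>A. \<Union>y\<in>B. sym_class V (SMult x y)),
     one = sym_class V (SConst 1),
     ring.zero = sym_class V (SConst 0),
     ring.add = (\<lambda>A B. \<Union>x\<in>A. \<Union>y\<in>B. sym_class V (SAdd x y))\<rparr>"

text \<open>The maximal ideal of the symmetric algebra at the point \<open>0\<close> of the dual space.\<close>

definition sym_max_ideal :: "'v cspace \<Rightarrow> 'v sym_term set set" where
  "sym_max_ideal V = genideal (sym_alg V) {sym_class V (SGen v) | v. v \<in> carrier V}"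

text \<open>Everything is computed from the bar complex. A cochain is a function that vanishes outside
  the tuples of group elements. The differentials of the bar complex with trivial coefficients
  vanish between degrees 0 and 1, so that \<open>H\<^sup>1\<close> is the space of 1-cocycles and every 1-chain is
  a cycle.\<close>

definition H1_cohom :: "('g, 'm) monoid_scheme \<Rightarrow> ('g \<Rightarrow> complex) set" where
  "H1_cohom G =
    {a. (\<forall>g\<in>carrier G. \<forall>h\<in>carrier G. a (g \<otimes>\<^bsub>G\<^esub> h) = a g + a h) \<and>
        (\<forall>g. g \<notin> carrier G \<longrightarrow> a g = 0)}"

definition coboundary1 ::
    "('g, 'm) monoid_scheme \<Rightarrow> ('g \<Rightarrow> complex) \<Rightarrow> 'g \<times> 'g \<Rightarrow> complex" where
  "coboundary1 G c = (\<lambda>(g, h). if g \<in> carrier G \<and> h \<in> carrier G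
      then c h - c (g \<otimes>\<^bsub>G\<^esub> h) + c g else 0)"

definition cocycles2 :: "('g, 'm) monoid_scheme \<Rightarrow> ('g \<times> 'g \<Rightarrow> complex) cspace" where
  "cocycles2 G =
    \<lparr>carrier = {f. (\<forall>g\<in>carrier G. \<forall>h\<in>carrier G. \<forall>k\<in>carrier G.
          f (h, k) - f (g \<otimes>\<^bsub>G\<^esub> h, k) + f (g, h \<otimes>\<^bsub>G\<^esub> k) - f (g, h) = 0) \<and>
        (\<forall>p. p \<notin> carrier G \<times> carrier G \<longrightarrow> f p = 0)},
     monoid.mult = undefined,
     one = undefined,
     ring.zero = (\<lambda>_. 0),
     ring.add = (\<lambda>f f' p. f p + f' p),
     module.smult = (\<lambda>c f p. c * f p)\<rparr>"

definition H2_cohom :: "('g, 'm) monoid_scheme \<Rightarrow> ('g \<times> 'g \<Rightarrow> complex) set cspace" where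
  "H2_cohom G = quot_space (cocycles2 G) (range (coboundary1 G))"

definition cup_product ::
    "('g, 'm) monoid_scheme \<Rightarrow> ('g \<Rightarrow> complex) \<Rightarrow> ('g \<Rightarrow> complex) \<Rightarrow> ('g \<times> 'g \<Rightarrow> complex) set" where
  "cup_product G a b = range (coboundary1 G) +>\<^bsub>cocycles2 G\<^esub> (\<lambda>(g, h). a g * b h)"

definition chains1 :: "('g, 'm) monoid_scheme \<Rightarrow> ('g \<Rightarrow>\<^sub>0 complex) cspace" where
  "chains1 G =
    \<lparr>carrier = {c. Poly_Mapping.keys c \<subseteq> carrier G},
     monoid.mult = undefined,
     one = undefined,
     ring.zero = 0,
     ring.add = (+),
     module.smult = (\<lambda>z. Poly_Mapping.map ((*) z))\<rparr>"

definition boundaries1 :: "('g, 'm) monoid_scheme \<Rightarrow> ('g \<Rightarrow>\<^sub>0 complex) set" where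
  "boundaries1 G = lin_span (chains1 G)
    {Poly_Mapping.single h 1 - Poly_Mapping.single (g \<otimes>\<^bsub>G\<^esub> h) 1 + Poly_Mapping.single g 1 | g h.
      g \<in> carrier G \<and> h \<in> carrier G}"

definition H1_hom :: "('g, 'm) monoid_scheme \<Rightarrow> ('g \<Rightarrow>\<^sub>0 complex) set cspace" where
  "H1_hom G = quot_space (chains1 G) (boundaries1 G)"

text \<open>The Kronecker pairing of \<open>H\<^sup>1\<close> with \<open>H\<^sub>1\<close>, computed on a representing chain.\<close>

definition pairing1 :: "('g \<Rightarrow> complex) \<Rightarrow> ('g \<Rightarrow>\<^sub>0 complex) set \<Rightarrow> complex" where
  "pairing1 a v = (let c = (SOME c. c \<in> v) in
    \<Sum>g\<in>Poly_Mapping.keys c. Poly_Mapping.lookup c g * a g)"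

text \<open>A list \<open>[(v\<^sub>1, w\<^sub>1), (v\<^sub>2, w\<^sub>2), \<dots>]\<close> of pairs represents the element
  \<open>v\<^sub>1 \<and> w\<^sub>1 + v\<^sub>2 \<and> w\<^sub>2 + \<dots>\<close> of the exterior square of \<open>H\<^sub>1\<close>. As \<open>H\<^sub>1\<close> is
  finite-dimensional for a finitely generated group, the exterior square is identified with the
  dual of the exterior square of \<open>H\<^sup>1\<close>, by the pairing \<open>wedge_pairing\<close>, and with the degree 2
  part of the free Lie algebra, by \<open>wedge_bracket\<close>.\<close>

definition wedge_pairing ::
    "('g \<Rightarrow> complex) \<Rightarrow> ('g \<Rightarrow> complex) \<Rightarrow>
     (('g \<Rightarrow>\<^sub>0 complex) set \<times> ('g \<Rightarrow>\<^sub>0 complex) set) list \<Rightarrow> complex" where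
  "wedge_pairing a b ps =
    (\<Sum>(v, w)\<leftarrow>ps. pairing1 a v * pairing1 b w - pairing1 a w * pairing1 b v)"

definition wedge_bracket :: "'v cspace \<Rightarrow> ('v \<times> 'v) list \<Rightarrow> 'v lie_term set" where
  "wedge_bracket V ps =
    foldr (\<lambda>(v, w) y. (lie_class V (LGen v) \<otimes>\<^bsub>free_lie V\<^esub> lie_class V (LGen w)) \<oplus>\<^bsub>free_lie V\<^esub> y)
      ps \<zero>\<^bsub>free_lie V\<^esub>"

text \<open>The image of the dual of the cup product: \<open>ps\<close> represents the value of this dual at a linear
  form \<open>\<phi>\<close> on \<open>H\<^sup>2\<close> iff \<open>a \<and> b\<close> pairs with it to \<open>\<phi> (a \<union> b)\<close>, for all \<open>a, b \<in> H\<^sup>1\<close>.\<close>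

definition holonomy_relations ::
    "('g, 'm) monoid_scheme \<Rightarrow> ('g \<Rightarrow>\<^sub>0 complex) set lie_term set set" where
  "holonomy_relations G =
    {wedge_bracket (H1_hom G) ps | ps.
      set ps \<subseteq> carrier (H1_hom G) \<times> carrier (H1_hom G) \<and>
      (\<exists>\<phi>\<in>linear_forms (H2_cohom G). \<forall>a\<in>H1_cohom G. \<forall>b\<in>H1_cohom G.
        wedge_pairing a b ps = \<phi> (cup_product G a b))}"

definition holonomy_ideal ::
    "('g, 'm) monoid_scheme \<Rightarrow> ('g \<Rightarrow>\<^sub>0 complex) set lie_term set set" where
  "holonomy_ideal G = lie_ideal_gen (free_lie (H1_hom G)) (holonomy_relations G)"

definition holonomy_lie ::
    "('g, 'm) monoid_scheme \<Rightarrow> ('g \<Rightarrow>\<^sub>0 complex) set lie_term set set cspace" where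
  "holonomy_lie G = quot_space (free_lie (H1_hom G)) (holonomy_ideal G)"

definition holonomy_gen ::
    "('g, 'm) monoid_scheme \<Rightarrow> ('g \<Rightarrow>\<^sub>0 complex) set \<Rightarrow>
     ('g \<Rightarrow>\<^sub>0 complex) set lie_term set set" where
  "holonomy_gen G v = holonomy_ideal G +>\<^bsub>free_lie (H1_hom G)\<^esub> lie_class (H1_hom G) (LGen v)"

definition holonomy_derived where
  "holonomy_derived G = lie_derived (holonomy_lie G) (carrier (holonomy_lie G))"

definition holonomy_derived2 where
  "holonomy_derived2 G = lie_derived (holonomy_lie G) (holonomy_derived G)"

text \<open>The effect of a symmetric algebra expression on a Lie algebra \<open>L\<close> if a generator \<open>v\<close> acts as
  the bracket with \<open>\<iota> v\<close>. This only depends on the class of the expression when \<open>L\<close> is metabelian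
  and the expression acts on elements of the derived algebra of \<open>L\<close>.\<close>

fun sym_act :: "'w cspace \<Rightarrow> ('v \<Rightarrow> 'w) \<Rightarrow> 'v sym_term \<Rightarrow> 'w \<Rightarrow> 'w" where
  "sym_act L \<iota> (SGen v) x = \<iota> v \<otimes>\<^bsub>L\<^esub> x"
| "sym_act L \<iota> (SConst c) x = c \<odot>\<^bsub>L\<^esub> x"
| "sym_act L \<iota> (SAdd s t) x = sym_act L \<iota> s x \<oplus>\<^bsub>L\<^esub> sym_act L \<iota> t x"
| "sym_act L \<iota> (SMult s t) x = sym_act L \<iota> s (sym_act L \<iota> t x)"

text \<open>\<open>\<hh>'/\<hh>''\<close>, as the derived algebra of the metabelian quotient \<open>\<hh>/\<hh>''\<close> of the holonomy Lie
  algebra \<open>\<hh>\<close>, and as a module over the symmetric algebra on \<open>H\<^sub>1\<close>.\<close>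

definition inf_alexander_invariant ::
    "('g, 'm) monoid_scheme \<Rightarrow>
     (('g \<Rightarrow>\<^sub>0 complex) set sym_term set,
      ('g \<Rightarrow>\<^sub>0 complex) set lie_term set set set) module" where
  "inf_alexander_invariant G =
    (let L = quot_space (holonomy_lie G) (holonomy_derived2 G);
         coset = (\<lambda>x. holonomy_derived2 G +>\<^bsub>holonomy_lie G\<^esub> x)
     in \<lparr>carrier = coset ` holonomy_derived G,
         monoid.mult = undefined,
         one = undefined,
         ring.zero = \<zero>\<^bsub>L\<^esub>,
         ring.add = (\<oplus>\<^bsub>L\<^esub>),
         module.smult = (\<lambda>P. sym_act L (\<lambda>v. coset (holonomy_gen G v)) (SOME t. t \<in> P))\<rparr>)"

definition annihilator :: "('a, 'r) ring_scheme \<Rightarrow> ('a, 'b) module \<Rightarrow> 'a set" where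
  "annihilator R M = {r \<in> carrier R. \<forall>x\<in>carrier M. r \<odot>\<^bsub>M\<^esub> x = \<zero>\<^bsub>M\<^esub>}"

definition ideal_radical :: "('a, 'r) ring_scheme \<Rightarrow> 'a set \<Rightarrow> 'a set" where
  "ideal_radical R I = {x \<in> carrier R. \<exists>k::nat. x [^]\<^bsub>R\<^esub> k \<in> I}"

definition primary_ideal :: "('a, 'r) ring_scheme \<Rightarrow> 'a set \<Rightarrow> bool" where
  "primary_ideal R Q \<longleftrightarrow> ideal Q R \<and> Q \<noteq> carrier R \<and>
    (\<forall>x\<in>carrier R. \<forall>y\<in>carrier R. x \<otimes>\<^bsub>R\<^esub> y \<in> Q \<longrightarrow> x \<in> Q \<or> y \<in> ideal_radical R Q)"

definition minimal_primary_decomposition ::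
    "('a, 'r) ring_scheme \<Rightarrow> 'a set \<Rightarrow> 'a set set \<Rightarrow> bool" where
  "minimal_primary_decomposition R I \<Q> \<longleftrightarrow>
    finite \<Q> \<and> (\<forall>Q\<in>\<Q>. primary_ideal R Q) \<and> I = carrier R \<inter> \<Inter>\<Q> \<and>
    inj_on (ideal_radical R) \<Q> \<and>
    (\<forall>Q\<in>\<Q>. \<not> carrier R \<inter> \<Inter>(\<Q> - {Q}) \<subseteq> Q)"

definition isolated_component :: "('a, 'r) ring_scheme \<Rightarrow> 'a set set \<Rightarrow> 'a set \<Rightarrow> bool" where
  "isolated_component R \<Q> Q \<longleftrightarrow>
    Q \<in> \<Q> \<and> \<not> (\<exists>Q'\<in>\<Q>. ideal_radical R Q' \<subset> ideal_radical R Q)"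

text \<open>The variety of an ideal \<open>I\<close> of \<open>R\<close>, where \<open>\<mm>\<close> is the ideal of the point \<open>0\<close>. The isolated
  components and the set of associated primes do not depend on the minimal primary decomposition,
  and neither does the condition below; ideals of a Noetherian ring do have such a decomposition.\<close>

definition weakly_reduced :: "('a, 'r) ring_scheme \<Rightarrow> 'a set \<Rightarrow> 'a set \<Rightarrow> bool" where
  "weakly_reduced R \<mm> I \<longleftrightarrow>
    (\<exists>\<Q>. minimal_primary_decomposition R I \<Q> \<and>
      (\<forall>Q\<in>\<Q>. if isolated_component R \<Q> Q then ideal_radical R Q = Q
              else ideal_radical R Q = \<mm>))"

end

theory Submission
  imports Defs
begin

text \<open>Let \<open>x\<^sub>i\<^sub>j\<close> be the class of the generator \<open>\<alpha>\<^sub>i\<^sub>j\<close>, and let \<open>u\<close> be the product of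
  \<open>x\<^sub>2\<^sub>1\<close> and \<open>x\<^sub>4\<^sub>3\<close> in the symmetric algebra. If the annihilator \<open>I\<close> defined a weakly reduced
  scheme, then \<open>u\<^sup>2 \<in> I\<close> would imply that \<open>I\<close> contains a product of \<open>u\<close> and a power of \<open>x\<^sub>4\<^sub>3\<close>.
  Commuting elements of the group give commuting elements of the holonomy Lie algebra, and the
  McCool relations between the generators suffice to prove \<open>u\<^sup>2 \<in> I\<close> with Jacobi identities. On the
  other hand, \<open>u\<close> times a power of \<open>x\<^sub>4\<^sub>3\<close> does not kill \<open>[x\<^sub>4\<^sub>3, x\<^sub>3\<^sub>2]\<close>, as one sees in a
  six-dimensional metabelian quotient of the holonomy Lie algebra. That this is a quotient amounts to
  the vanishing of some cup products, for which Magnus coefficients of degree 3 provide the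
  bounding cochains.\<close>

subsection \<open>Complex vector spaces and Lie algebras\<close>

text \<open>Neither a presentation of the group nor its second cohomology is computed; the space of
  holonomy relations is only bounded from two sides. From below, a commuting pair spans a torus in
  the bar complex, whose class puts the bracket of the pair into the holonomy ideal. From above,
  every cup product relation restricts what the dual of the cup product can reach, so a quotient
  needs only these restrictions. The six-dimensional quotient has a geometric meaning. On its
  derived algebra, spanned by \<open>b\<close>, \<open>c\<close>, \<open>e\<close>, the generator
  \<open>x 4 3\<close> acts as the identity and every other generator nilpotently, with
  \<open>x 2 1\<close> acting nontrivially. The module is thus supported at the point of the first
  cohomology with coordinate 1 at \<open>x 4 3\<close> and 0 elsewhere. As this point is not 0, an
  embedded component at 0 cannot account for the nilpotent operator, and no power of
  \<open>x 4 3\<close> removes it. Conversely, the factor \<open>x 4 3\<close> of \<open>u\<close>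
  disposes of elements such as \<open>[x i 2, x 2 1]\<close> with \<open>i \<ge> 5\<close>.\<close>

lemma complex_ring_simps [simp]:
  "carrier complex_ring = UNIV"
  "x \<oplus>\<^bsub>complex_ring\<^esub> y = x + y"
  "x \<otimes>\<^bsub>complex_ring\<^esub> y = x * y"
  "\<zero>\<^bsub>complex_ring\<^esub> = 0"
  "\<one>\<^bsub>complex_ring\<^esub> = 1"
  by (simp_all add: ring_of_type_algebra_def)

text \<open>Only equations are demanded: the additive inverse of \<open>x\<close>, whose existence
  belongs to the axioms of a group, is supplied by \<open>(- 1) \<odot> x\<close>.\<close>

lemma complex_moduleI:
  fixes V :: "'v cspace" (structure)
  assumes "\<zero> \<in> carrier V"
    and "\<And>x y. x \<in> carrier V \<Longrightarrow> y \<in> carrier V \<Longrightarrow> x \<oplus> y \<in> carrier V"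
    and "\<And>c x. x \<in> carrier V \<Longrightarrow> c \<odot> x \<in> carrier V"
    and "\<And>x y z. x \<in> carrier V \<Longrightarrow> y \<in> carrier V \<Longrightarrow> z \<in> carrier V \<Longrightarrow> x \<oplus> y \<oplus> z = x \<oplus> (y \<oplus> z)"
    and "\<And>x y. x \<in> carrier V \<Longrightarrow> y \<in> carrier V \<Longrightarrow> x \<oplus> y = y \<oplus> x"
    and "\<And>x. x \<in> carrier V \<Longrightarrow> \<zero> \<oplus> x = x"
    and "\<And>x. x \<in> carrier V \<Longrightarrow> (- 1) \<odot> x \<oplus> x = \<zero>"
    and "\<And>c d x. x \<in> carrier V \<Longrightarrow> (c + d) \<odot> x = c \<odot> x \<oplus> d \<odot> x"
    and "\<And>c x y. x \<in> carrier V \<Longrightarrow> y \<in> carrier V \<Longrightarrow> c \<odot> (x \<oplus> y) = c \<odot> x \<oplus> c \<odot> y"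
    and "\<And>c d x. x \<in> carrier V \<Longrightarrow> (c * d) \<odot> x = c \<odot> (d \<odot> x)"
    and "\<And>x. x \<in> carrier V \<Longrightarrow> 1 \<odot> x = x"
  shows "module complex_ring V"
proof (rule moduleI)
  show "abelian_group V"
  proof (rule abelian_groupI)
    show "\<exists>y\<in>carrier V. y \<oplus> x = \<zero>" if "x \<in> carrier V" for x
      using assms(3,7) that by blast
  qed (use assms in blast)+
qed (use assms cring_from_type_algebra in auto)

locale complex_space = module complex_ring V for V :: "'v cspace" (structure)
begin

lemma smult_in [simp]: "x \<in> carrier V \<Longrightarrow> c \<odot> x \<in> carrier V"
  by simp

lemma smult_zero_left [simp]: "x \<in> carrier V \<Longrightarrow> 0 \<odot> x = \<zero>"
  using smult_l_null by simp

lemma smult_zero_right [simp]: "c \<odot> \<zero> = \<zero>"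
  by (rule smult_r_null) simp

lemma smult_1 [simp]: "x \<in> carrier V \<Longrightarrow> 1 \<odot> x = x"
  using smult_one by simp

lemma add_smult: "x \<in> carrier V \<Longrightarrow> (c + d) \<odot> x = c \<odot> x \<oplus> d \<odot> x"
  using smult_l_distr by simp

lemma smult_add: "x \<in> carrier V \<Longrightarrow> y \<in> carrier V \<Longrightarrow> c \<odot> (x \<oplus> y) = c \<odot> x \<oplus> c \<odot> y"
  using smult_r_distr by simp

lemma smult_smult: "x \<in> carrier V \<Longrightarrow> c \<odot> (d \<odot> x) = (c * d) \<odot> x"
  using smult_assoc1 by simp

lemma minus_eq_smult: "x \<in> carrier V \<Longrightarrow> \<ominus> x = (- 1) \<odot> x"
  using add_smult[of x "- 1" 1] by (simp add: M.minus_equality)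

lemma submoduleI':
  assumes "N \<subseteq> carrier V" "\<zero> \<in> N" "\<And>x y. x \<in> N \<Longrightarrow> y \<in> N \<Longrightarrow> x \<oplus> y \<in> N"
    "\<And>c x. x \<in> N \<Longrightarrow> c \<odot> x \<in> N"
  shows "submodule N complex_ring V"
proof (rule submoduleI)
  show "\<ominus> a \<in> N" if "a \<in> N" for a
    using assms that minus_eq_smult by auto
qed (use assms in auto)

lemma submodule_zero:
  assumes "submodule N complex_ring V"
  shows "\<zero> \<in> N"
  using subgroup.one_closed[OF submodule.axioms(1)[OF assms]] by simp

lemma submodule_add:
  assumes "submodule N complex_ring V" "x \<in> N" "y \<in> N"
  shows "x \<oplus> y \<in> N"
  using submoduleE(5)[OF assms(1)] assms(2,3) by blast

lemma submodule_smult: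
  assumes "submodule N complex_ring V" "x \<in> N"
  shows "c \<odot> x \<in> N"
  using submoduleE(4)[OF assms(1)] assms(2) by simp

lemma submodule_subset:
  assumes "submodule N complex_ring V"
  shows "N \<subseteq> carrier V"
  using submoduleE(1)[OF assms] .

lemma submodule_Inter:
  assumes "\<NN> \<noteq> {}" "\<And>N. N \<in> \<NN> \<Longrightarrow> submodule N complex_ring V"
  shows "submodule (\<Inter>\<NN>) complex_ring V"
proof (rule submoduleI')
  show "\<Inter>\<NN> \<subseteq> carrier V"
    using assms submodule_subset by blast
qed (use assms submodule_zero submodule_add submodule_smult in blast)+

lemma lin_span_submodule:
  assumes "A \<subseteq> carrier V"
  shows "submodule (lin_span V A) complex_ring V"
  unfolding lin_span_def
  by (rule submodule_Inter) (use assms carrier_is_submodule in auto)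

lemma lin_span_minimal: "submodule N complex_ring V \<Longrightarrow> A \<subseteq> N \<Longrightarrow> lin_span V A \<subseteq> N"
  by (auto simp: lin_span_def)

lemma lin_span_incl: "A \<subseteq> lin_span V A"
  by (auto simp: lin_span_def)

end

section \<open>Quotients of complex vector spaces\<close>

locale complex_subspace = complex_space +
  fixes N
  assumes sub: "submodule N complex_ring V"
begin

lemma is_abelian_subgroup: "abelian_subgroup N V"
proof (rule abelian_subgroupI3)
  show "additive_subgroup N V"
    using submodule.axioms(1)[OF sub] by (simp add: additive_subgroup_def)
  show "abelian_group V" ..
qed

sublocale A: abelian_subgroup N V
  by (rule is_abelian_subgroup)

abbreviation coset where "coset x \<equiv> N +> x"
abbreviation Q where "Q \<equiv> quot_space V N"

lemma coset_eq_iff: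
  assumes "x \<in> carrier V" "y \<in> carrier V"
  shows "coset x = coset y \<longleftrightarrow> x \<oplus> (- 1) \<odot> y \<in> N"
proof -
  have "coset x = coset y \<longleftrightarrow> x \<in> coset y"
    using assms A.a_repr_independence' A.a_rcos_self by metis
  also have "\<dots> \<longleftrightarrow> x \<oplus> \<ominus> y \<in> N"
    using A.a_rcos_module[OF assms(2,1)] .
  finally show ?thesis
    by (simp add: minus_eq_smult assms)
qed

lemma coset_eq_N_iff: "x \<in> carrier V \<Longrightarrow> coset x = N \<longleftrightarrow> x \<in> N"
  using A.a_rcos_const A.a_rcos_self by metis

lemma coset_cong:
  assumes "h \<in> N" "x \<in> carrier V"
  shows "coset (h \<oplus> x) = coset x"
proof -
  have "h \<oplus> x \<in> coset x"
    using assms by (auto simp: a_r_coset_def')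
  then show ?thesis
    using A.a_repr_independence' assms(2) by metis
qed

lemma quot_carrier: "carrier Q = coset ` carrier V"
  by (auto simp: quot_space_def A_RCOSETS_def')

lemma quot_zero: "\<zero>\<^bsub>Q\<^esub> = N"
  by (simp add: quot_space_def)

lemma quot_zero': "\<zero>\<^bsub>Q\<^esub> = coset \<zero>"
  using coset_eq_N_iff[of \<zero>] by (simp add: quot_zero)

lemma quot_add: "x \<in> carrier V \<Longrightarrow> y \<in> carrier V \<Longrightarrow> coset x \<oplus>\<^bsub>Q\<^esub> coset y = coset (x \<oplus> y)"
  using A.a_rcos_sum by (simp add: quot_space_def)

text \<open>\<open>quot_space\<close> multiplies a coset by a scalar through a union over its
  elements. All elements contribute the same coset, and a coset is nonempty, so the union is that
  coset.\<close>

lemma quot_smult: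
  assumes "x \<in> carrier V"
  shows "c \<odot>\<^bsub>Q\<^esub> coset x = coset (c \<odot> x)"
proof -
  have "coset (c \<odot> y) = coset (c \<odot> x)" if "y \<in> coset x" for y
  proof -
    obtain h where h: "h \<in> N" "y = h \<oplus> x"
      using \<open>y \<in> coset x\<close> by (auto simp: a_r_coset_def')
    then have "c \<odot> y = c \<odot> h \<oplus> c \<odot> x"
      using assms A.a_Hcarr by (simp add: smult_add)
    then show ?thesis
      using coset_cong submodule_smult[OF sub] h assms by simp
  qed
  then have "(\<Union>y\<in>coset x. coset (c \<odot> y)) = (\<Union>y\<in>coset x. coset (c \<odot> x))"
    by (intro SUP_cong) auto
  moreover have "coset x \<noteq> {}"
    using assms A.a_rcos_self by blast
  ultimately show ?thesis
    by (simp add: quot_space_def)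
qed

lemma quot_module: "module complex_ring Q"
proof (rule complex_moduleI)
  show "(- 1) \<odot>\<^bsub>Q\<^esub> x \<oplus>\<^bsub>Q\<^esub> x = \<zero>\<^bsub>Q\<^esub>" if "x \<in> carrier Q" for x
    using that add_smult[of _ "- 1" 1] by (auto simp: quot_carrier quot_add quot_smult quot_zero')
qed (auto simp: quot_carrier quot_add quot_smult quot_zero' M.a_ac
       add_smult smult_add smult_smult)

end

section \<open>Lie algebras, ideals and quotients\<close>

locale lie_algebra = complex_space L for L :: "'v cspace" (structure) +
  assumes bracket_closed [simp, intro]:
      "x \<in> carrier L \<Longrightarrow> y \<in> carrier L \<Longrightarrow> x \<otimes> y \<in> carrier L"
    and bracket_add_left:
      "x \<in> carrier L \<Longrightarrow> y \<in> carrier L \<Longrightarrow> z \<in> carrier L \<Longrightarrow> (x \<oplus> y) \<otimes> z = x \<otimes> z \<oplus> y \<otimes> z"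
    and bracket_add_right:
      "x \<in> carrier L \<Longrightarrow> y \<in> carrier L \<Longrightarrow> z \<in> carrier L \<Longrightarrow> z \<otimes> (x \<oplus> y) = z \<otimes> x \<oplus> z \<otimes> y"
    and bracket_smult_left:
      "x \<in> carrier L \<Longrightarrow> y \<in> carrier L \<Longrightarrow> (c \<odot> x) \<otimes> y = c \<odot> (x \<otimes> y)"
    and bracket_smult_right:
      "x \<in> carrier L \<Longrightarrow> y \<in> carrier L \<Longrightarrow> x \<otimes> (c \<odot> y) = c \<odot> (x \<otimes> y)"
    and bracket_self: "x \<in> carrier L \<Longrightarrow> x \<otimes> x = \<zero>"
    and jacobi: "x \<in> carrier L \<Longrightarrow> y \<in> carrier L \<Longrightarrow> z \<in> carrier L \<Longrightarrow>
      x \<otimes> (y \<otimes> z) \<oplus> (y \<otimes> (z \<otimes> x) \<oplus> z \<otimes> (x \<otimes> y)) = \<zero>"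
begin

lemma bracket_zero_left [simp]: "x \<in> carrier L \<Longrightarrow> \<zero> \<otimes> x = \<zero>"
  using bracket_smult_left[of \<zero> x 0] by simp

lemma bracket_zero_right [simp]: "x \<in> carrier L \<Longrightarrow> x \<otimes> \<zero> = \<zero>"
  using bracket_smult_right[of x \<zero> 0] by simp

lemma bracket_minus_right: "x \<in> carrier L \<Longrightarrow> y \<in> carrier L \<Longrightarrow> x \<otimes> (\<ominus> y) = \<ominus> (x \<otimes> y)"
  by (simp add: minus_eq_smult bracket_smult_right)

lemma bracket_anti:
  assumes "x \<in> carrier L" "y \<in> carrier L"
  shows "x \<otimes> y = \<ominus> (y \<otimes> x)"
proof -
  have "\<zero> = (x \<oplus> y) \<otimes> (x \<oplus> y)"
    using assms by (simp add: bracket_self)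
  also have "\<dots> = x \<otimes> y \<oplus> y \<otimes> x"
    using assms by (simp add: bracket_add_left bracket_add_right bracket_self[of x] bracket_self[of y] M.a_comm)
  finally show ?thesis
    using assms by (metis M.minus_equality bracket_closed)
qed

text \<open>The Jacobi identity in the form that bracketing with \<open>x\<close> is a derivation,
  which is how later computations use it.\<close>

lemma leibniz:
  assumes "x \<in> carrier L" "y \<in> carrier L" "z \<in> carrier L"
  shows "x \<otimes> (y \<otimes> z) = (x \<otimes> y) \<otimes> z \<oplus> y \<otimes> (x \<otimes> z)"
proof -
  have "y \<otimes> (z \<otimes> x) = \<ominus> (y \<otimes> (x \<otimes> z))"
    using bracket_anti[of z x] assms by (simp add: bracket_minus_right)
  moreover have "z \<otimes> (x \<otimes> y) = \<ominus> ((x \<otimes> y) \<otimes> z)"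
    using bracket_anti[of z "x \<otimes> y"] assms by simp
  ultimately have "x \<otimes> (y \<otimes> z) \<oplus> \<ominus> (y \<otimes> (x \<otimes> z) \<oplus> (x \<otimes> y) \<otimes> z) = \<zero>"
    using jacobi[OF assms] assms by (simp add: M.minus_add)
  then have "x \<otimes> (y \<otimes> z) = y \<otimes> (x \<otimes> z) \<oplus> (x \<otimes> y) \<otimes> z"
    using assms M.minus_equality[of "x \<otimes> (y \<otimes> z)" "\<ominus> (y \<otimes> (x \<otimes> z) \<oplus> (x \<otimes> y) \<otimes> z)"] by simp
  then show ?thesis
    using assms by (simp add: M.a_comm)
qed

lemma lie_derived_submodule:
  assumes "A \<subseteq> carrier L"
  shows "submodule (lie_derived L A) complex_ring L"
  unfolding lie_derived_def by (rule lin_span_submodule) (use assms in auto)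

lemma bracket_in_lie_derived: "x \<in> A \<Longrightarrow> y \<in> A \<Longrightarrow> x \<otimes> y \<in> lie_derived L A"
  unfolding lie_derived_def by (rule subsetD[OF lin_span_incl]) blast

lemma lie_derived_induct:
  assumes "submodule N complex_ring L" "\<And>x y. x \<in> A \<Longrightarrow> y \<in> A \<Longrightarrow> x \<otimes> y \<in> N"
  shows "lie_derived L A \<subseteq> N"
  unfolding lie_derived_def by (rule lin_span_minimal) (use assms in auto)

lemma submodule_bracket_vimage:
  assumes "submodule N complex_ring L" "z \<in> carrier L"
  shows "submodule {x \<in> carrier L. z \<otimes> x \<in> N} complex_ring L"
  by (rule submoduleI')
    (use assms submodule_zero submodule_add submodule_smult in
      \<open>auto simp: bracket_add_right bracket_smult_right\<close>)

text \<open>Bracketing with \<open>z\<close> is a derivation that maps \<open>D\<close> into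
  \<open>D\<close>, so it sends a bracket of two elements of \<open>D\<close> to a sum of such
  brackets. This makes the quotient by the second derived algebra a Lie algebra.\<close>

lemma lie_derived2_ideal:
  defines "D \<equiv> lie_derived L (carrier L)"
  shows "lie_ideal L (lie_derived L D)"
proof -
  have D: "submodule D complex_ring L"
    unfolding D_def by (rule lie_derived_submodule) simp
  have DL: "D \<subseteq> carrier L"
    using D submodule_subset by blast
  have S: "submodule (lie_derived L D) complex_ring L"
    using DL by (rule lie_derived_submodule)
  have "lie_derived L D \<subseteq> {w \<in> carrier L. z \<otimes> w \<in> lie_derived L D}" if z: "z \<in> carrier L" for z
  proof (rule lie_derived_induct)
    show "submodule {w \<in> carrier L. z \<otimes> w \<in> lie_derived L D} complex_ring L"
      using S z by (rule submodule_bracket_vimage)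
  next
    fix x y assume xy: "x \<in> D" "y \<in> D"
    then have c: "x \<in> carrier L" "y \<in> carrier L"
      using DL by auto
    have "z \<otimes> x \<in> D" "z \<otimes> y \<in> D"
      using z c by (auto simp: D_def intro: bracket_in_lie_derived)
    then have "(z \<otimes> x) \<otimes> y \<oplus> x \<otimes> (z \<otimes> y) \<in> lie_derived L D"
      using xy by (intro submodule_add[OF S] bracket_in_lie_derived)
    then show "x \<otimes> y \<in> {w \<in> carrier L. z \<otimes> w \<in> lie_derived L D}"
      using leibniz[of z x y] z c by auto
  qed
  then show ?thesis
    using S by (auto simp: lie_ideal_def)
qed

lemma lie_ideal_gen_ideal:
  assumes "A \<subseteq> carrier L"
  shows "lie_ideal L (lie_ideal_gen L A)"
proof -
  have c: "lie_ideal L (carrier L)"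
    using carrier_is_submodule by (auto simp: lie_ideal_def)
  have "submodule (lie_ideal_gen L A) complex_ring L"
    unfolding lie_ideal_gen_def
    by (rule submodule_Inter) (use assms c in \<open>auto simp: lie_ideal_def\<close>)
  then show ?thesis
    by (auto simp: lie_ideal_def lie_ideal_gen_def)
qed

lemma lie_ideal_gen_minimal: "lie_ideal L I \<Longrightarrow> A \<subseteq> I \<Longrightarrow> lie_ideal_gen L A \<subseteq> I"
  by (auto simp: lie_ideal_gen_def)

lemma lie_ideal_gen_incl: "A \<subseteq> lie_ideal_gen L A"
  by (auto simp: lie_ideal_gen_def)

end

locale lie_ideal_quotient = lie_algebra L for L :: "'v cspace" (structure) +
  fixes N
  assumes ideal: "lie_ideal L N"
begin

sublocale complex_subspace L N
  by (intro complex_subspace.intro complex_subspace_axioms.intro complex_space_axioms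
      conjunct1[OF ideal[unfolded lie_ideal_def]])

text \<open>For representatives \<open>a = h \<oplus> x\<close> and \<open>b = k \<oplus> y\<close>
  the error term is \<open>h \<otimes> b \<oplus> x \<otimes> k\<close>. It requires absorption on
  both sides; \<open>lie_ideal\<close> gives one side and antisymmetry the other.\<close>

lemma quot_bracket:
  assumes "x \<in> carrier L" "y \<in> carrier L"
  shows "coset x \<otimes>\<^bsub>Q\<^esub> coset y = coset (x \<otimes> y)"
proof -
  have left: "x \<otimes> h \<in> N" if "x \<in> carrier L" "h \<in> N" for x h
    using ideal that by (auto simp: lie_ideal_def)
  have right: "h \<otimes> x \<in> N" if "x \<in> carrier L" "h \<in> N" for x h
    using left[OF that] bracket_anti[of h x] that A.a_Hcarr minus_eq_smult
      submodule_smult[OF sub] by auto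
  have "coset (a \<otimes> b) = coset (x \<otimes> y)" if ab: "a \<in> coset x" "b \<in> coset y" for a b
  proof -
    obtain h k where hk: "h \<in> N" "a = h \<oplus> x" "k \<in> N" "b = k \<oplus> y"
      using ab by (auto simp: a_r_coset_def')
    note c = assms A.a_Hcarr[OF hk(1)] A.a_Hcarr[OF hk(3)]
    have "a \<otimes> b = (h \<otimes> b \<oplus> x \<otimes> k) \<oplus> x \<otimes> y"
      using c hk by (simp add: bracket_add_left bracket_add_right M.a_ac)
    moreover have "h \<otimes> b \<oplus> x \<otimes> k \<in> N"
      using c hk by (intro submodule_add[OF sub] left right) auto
    ultimately show ?thesis
      using coset_cong c by simp
  qed
  then have "(\<Union>a\<in>coset x. \<Union>b\<in>coset y. coset (a \<otimes> b)) = (\<Union>a\<in>coset x. \<Union>b\<in>coset y. coset (x \<otimes> y))"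
    by (intro SUP_cong) auto
  moreover have "x \<in> coset x" "y \<in> coset y"
    using assms A.a_rcos_self by blast+
  then have "coset x \<noteq> {}" "coset y \<noteq> {}"
    by blast+
  ultimately show ?thesis
    by (simp add: quot_space_def rcoset_mult_def)
qed

lemma quot_lie_algebra: "lie_algebra Q"
proof (intro lie_algebra.intro complex_space.intro quot_module lie_algebra_axioms.intro)
  fix x y z c assume "x \<in> carrier Q" "y \<in> carrier Q"
  then obtain a b where ab: "a \<in> carrier L" "x = coset a" "b \<in> carrier L" "y = coset b"
    unfolding quot_carrier by blast
  show "x \<otimes>\<^bsub>Q\<^esub> y \<in> carrier Q"
    using ab by (simp add: quot_bracket quot_carrier)
  show "(c \<odot>\<^bsub>Q\<^esub> x) \<otimes>\<^bsub>Q\<^esub> y = c \<odot>\<^bsub>Q\<^esub> (x \<otimes>\<^bsub>Q\<^esub> y)"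
    "x \<otimes>\<^bsub>Q\<^esub> (c \<odot>\<^bsub>Q\<^esub> y) = c \<odot>\<^bsub>Q\<^esub> (x \<otimes>\<^bsub>Q\<^esub> y)"
    using ab by (simp_all add: quot_bracket quot_smult bracket_smult_left bracket_smult_right)
  show "x \<otimes>\<^bsub>Q\<^esub> x = \<zero>\<^bsub>Q\<^esub>"
    using ab by (simp add: quot_bracket bracket_self quot_zero')
  assume "z \<in> carrier Q"
  then obtain d where d: "d \<in> carrier L" "z = coset d"
    unfolding quot_carrier by blast
  show "(x \<oplus>\<^bsub>Q\<^esub> y) \<otimes>\<^bsub>Q\<^esub> z = x \<otimes>\<^bsub>Q\<^esub> z \<oplus>\<^bsub>Q\<^esub> y \<otimes>\<^bsub>Q\<^esub> z"
    "z \<otimes>\<^bsub>Q\<^esub> (x \<oplus>\<^bsub>Q\<^esub> y) = z \<otimes>\<^bsub>Q\<^esub> x \<oplus>\<^bsub>Q\<^esub> z \<otimes>\<^bsub>Q\<^esub> y"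
    using ab d by (simp_all add: quot_bracket quot_add bracket_add_left bracket_add_right)
  show "x \<otimes>\<^bsub>Q\<^esub> (y \<otimes>\<^bsub>Q\<^esub> z) \<oplus>\<^bsub>Q\<^esub> (y \<otimes>\<^bsub>Q\<^esub> (z \<otimes>\<^bsub>Q\<^esub> x) \<oplus>\<^bsub>Q\<^esub> z \<otimes>\<^bsub>Q\<^esub> (x \<otimes>\<^bsub>Q\<^esub> y)) = \<zero>\<^bsub>Q\<^esub>"
    using ab d jacobi[of a b d] by (simp add: quot_bracket quot_add) (simp add: quot_zero')
qed

end

section \<open>Homomorphisms of Lie algebras\<close>

definition lie_hom :: "'v cspace \<Rightarrow> 'w cspace \<Rightarrow> ('v \<Rightarrow> 'w) \<Rightarrow> bool" where
  "lie_hom L M f \<longleftrightarrow> f \<in> carrier L \<rightarrow> carrier M \<and>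
    (\<forall>x\<in>carrier L. \<forall>y\<in>carrier L. f (x \<oplus>\<^bsub>L\<^esub> y) = f x \<oplus>\<^bsub>M\<^esub> f y) \<and>
    (\<forall>c. \<forall>x\<in>carrier L. f (c \<odot>\<^bsub>L\<^esub> x) = c \<odot>\<^bsub>M\<^esub> f x) \<and>
    (\<forall>x\<in>carrier L. \<forall>y\<in>carrier L. f (x \<otimes>\<^bsub>L\<^esub> y) = f x \<otimes>\<^bsub>M\<^esub> f y)"

lemma lie_homD:
  assumes "lie_hom L M f" "x \<in> carrier L"
  shows lie_hom_closed: "f x \<in> carrier M"
    and lie_hom_smult: "f (c \<odot>\<^bsub>L\<^esub> x) = c \<odot>\<^bsub>M\<^esub> f x"
    and lie_hom_add: "y \<in> carrier L \<Longrightarrow> f (x \<oplus>\<^bsub>L\<^esub> y) = f x \<oplus>\<^bsub>M\<^esub> f y"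
    and lie_hom_bracket: "y \<in> carrier L \<Longrightarrow> f (x \<otimes>\<^bsub>L\<^esub> y) = f x \<otimes>\<^bsub>M\<^esub> f y"
  using assms by (auto simp: lie_hom_def)

lemma lie_hom_zero:
  assumes "lie_algebra L" "lie_algebra M" "lie_hom L M f"
  shows "f \<zero>\<^bsub>L\<^esub> = \<zero>\<^bsub>M\<^esub>"
proof -
  interpret L: lie_algebra L by fact
  interpret M: lie_algebra M by fact
  have "f \<zero>\<^bsub>L\<^esub> = 0 \<odot>\<^bsub>M\<^esub> f \<zero>\<^bsub>L\<^esub>"
    using lie_hom_smult[OF assms(3), of "\<zero>\<^bsub>L\<^esub>" 0] by simp
  then show ?thesis
    using lie_hom_closed[OF assms(3), of "\<zero>\<^bsub>L\<^esub>"] by simp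
qed

lemma lie_hom_vimage:
  assumes "lie_algebra L" "lie_algebra M" "lie_hom L M f" "submodule N complex_ring M"
  shows "submodule {x \<in> carrier L. f x \<in> N} complex_ring L"
proof -
  interpret L: lie_algebra L by fact
  interpret M: lie_algebra M by fact
  show ?thesis
    by (rule L.submoduleI')
      (use assms(4) lie_hom_zero[OF assms(1-3)] lie_homD[OF assms(3)]
        M.submodule_zero M.submodule_add M.submodule_smult in auto)
qed

lemma (in complex_space) submodule_trivial: "submodule {\<zero>} complex_ring V"
  by (rule submoduleI') auto

lemma lie_hom_kernel:
  assumes "lie_algebra L" "lie_algebra M" "lie_hom L M f"
  shows "lie_ideal L {x \<in> carrier L. f x = \<zero>\<^bsub>M\<^esub>}"
proof -
  interpret L: lie_algebra L by fact
  interpret M: lie_algebra M by fact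
  show ?thesis
    using lie_hom_vimage[OF assms M.submodule_trivial] lie_homD[OF assms(3)]
    by (auto simp: lie_ideal_def)
qed

lemma lie_hom_derived:
  assumes "lie_algebra L" "lie_algebra M" "lie_hom L M f" "A \<subseteq> carrier L" "B \<subseteq> carrier M"
    and "x \<in> lie_derived L A" "\<And>a. a \<in> A \<Longrightarrow> f a \<in> B"
  shows "f x \<in> lie_derived M B"
proof -
  interpret L: lie_algebra L by fact
  interpret M: lie_algebra M by fact
  have "lie_derived L A \<subseteq> {x \<in> carrier L. f x \<in> lie_derived M B}"
  proof (rule L.lie_derived_induct)
    show "submodule {x \<in> carrier L. f x \<in> lie_derived M B} complex_ring L"
      by (rule lie_hom_vimage[OF assms(1-3) M.lie_derived_submodule[OF assms(5)]])
    show "x \<otimes>\<^bsub>L\<^esub> y \<in> {x \<in> carrier L. f x \<in> lie_derived M B}" if "x \<in> A" "y \<in> A" for x y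
      using that assms(4,7) lie_hom_bracket[OF assms(3), of x y] M.bracket_in_lie_derived[of "f x" B "f y"]
      by (auto simp: subset_iff)
  qed
  then show ?thesis
    using assms(6) by blast
qed

context lie_ideal_quotient
begin

lemma coset_lie_hom: "lie_hom L Q coset"
  by (simp add: lie_hom_def quot_carrier quot_add quot_smult quot_bracket)

lemma lie_hom_lift:
  assumes "lie_algebra M" "lie_hom L M f" "\<And>x. x \<in> N \<Longrightarrow> f x = \<zero>\<^bsub>M\<^esub>"
  obtains g where "lie_hom Q M g" "\<And>x. x \<in> carrier L \<Longrightarrow> g (coset x) = f x"
proof
  interpret M: lie_algebra M by fact
  \<comment> \<open>\<open>f\<close> is constant on the cosets of \<open>N\<close>, so the image of
    a coset is a singleton, and \<open>the_elem\<close> reads off its value without choosing a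
    representative.\<close>
  let ?g = "\<lambda>S. the_elem (f ` S)"
  have "f ` coset x = {f x}" if x: "x \<in> carrier L" for x
  proof -
    have "f y = f x" if y: "y \<in> coset x" for y
    proof -
      obtain h where "h \<in> N" "y = h \<oplus> x"
        using y by (auto simp: a_r_coset_def')
      then show ?thesis
        using assms(3) lie_homD[OF assms(2)] A.a_Hcarr x by simp
    qed
    moreover have "x \<in> coset x"
      using x A.a_rcos_self by blast
    ultimately show ?thesis
      by blast
  qed
  then show g: "?g (coset x) = f x" if "x \<in> carrier L" for x
    using that by simp
  show "lie_hom Q M ?g"
    using lie_homD[OF assms(2)]
    by (auto simp: lie_hom_def quot_carrier quot_add quot_smult quot_bracket g)
qed

end

section \<open>Generators of a Lie algebra\<close>

definition lie_subalgebra :: "'v cspace \<Rightarrow> 'v set \<Rightarrow> bool" where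
  "lie_subalgebra L I \<longleftrightarrow> submodule I complex_ring L \<and> (\<forall>x\<in>I. \<forall>y\<in>I. x \<otimes>\<^bsub>L\<^esub> y \<in> I)"

definition lie_generated_by :: "'v cspace \<Rightarrow> 'v set \<Rightarrow> bool" where
  "lie_generated_by L S \<longleftrightarrow> (\<forall>I. lie_subalgebra L I \<longrightarrow> S \<subseteq> I \<longrightarrow> carrier L \<subseteq> I)"

lemma (in lie_ideal_quotient) quot_generated_by:
  assumes "lie_generated_by L S" "S \<subseteq> carrier L"
  shows "lie_generated_by Q (coset ` S)"
  unfolding lie_generated_by_def lie_subalgebra_def
proof (intro allI impI, elim conjE)
  fix I assume I: "submodule I complex_ring Q" "\<forall>x\<in>I. \<forall>y\<in>I. x \<otimes>\<^bsub>Q\<^esub> y \<in> I" "coset ` S \<subseteq> I"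
  let ?J = "{x \<in> carrier L. coset x \<in> I}"
  have "submodule ?J complex_ring L"
    by (rule lie_hom_vimage[OF lie_algebra_axioms quot_lie_algebra coset_lie_hom I(1)])
  moreover have "\<forall>x\<in>?J. \<forall>y\<in>?J. x \<otimes> y \<in> ?J"
    using I(2) by (auto simp flip: quot_bracket)
  moreover have "S \<subseteq> ?J"
    using I(3) assms(2) by auto
  ultimately have "carrier L \<subseteq> ?J"
    using assms(1) unfolding lie_generated_by_def lie_subalgebra_def by auto
  then show "carrier Q \<subseteq> I"
    by (auto simp: quot_carrier)
qed

text \<open>For an ideal \<open>W\<close>, the elements whose brackets with a fixed set lie in
  \<open>W\<close> form a subalgebra, by the Leibniz rule. Hence a claim about the derived algebra
  can be checked on brackets of generators.\<close>

lemma (in lie_algebra) brackets_in_ideal: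
  assumes W: "submodule W complex_ring L" "\<And>x w. x \<in> carrier L \<Longrightarrow> w \<in> W \<Longrightarrow> x \<otimes> w \<in> W"
    and S: "lie_generated_by L S" "S \<subseteq> carrier L" "\<And>p q. p \<in> S \<Longrightarrow> q \<in> S \<Longrightarrow> p \<otimes> q \<in> W"
    and xy: "x \<in> carrier L" "y \<in> carrier L"
  shows "x \<otimes> y \<in> W"
proof -
  have WL: "w \<in> carrier L" if "w \<in> W" for w
    using submodule_subset[OF W(1)] that by blast
  have W': "w \<otimes> x \<in> W" if "x \<in> carrier L" "w \<in> W" for x w
    using W(2)[OF that] bracket_anti[of w x] WL[OF that(2)] that(1) submodule_smult[OF W(1)]
    by (simp add: minus_eq_smult)
  have closed: "carrier L \<subseteq> {y \<in> carrier L. \<forall>a\<in>A. a \<otimes> y \<in> W}"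
    if A: "A \<subseteq> carrier L" "\<And>a q. a \<in> A \<Longrightarrow> q \<in> S \<Longrightarrow> a \<otimes> q \<in> W" for A
  proof -
    let ?I = "{y \<in> carrier L. \<forall>a\<in>A. a \<otimes> y \<in> W}"
    have "submodule ?I complex_ring L"
      by (rule submoduleI')
        (use A(1) submodule_zero[OF W(1)] submodule_add[OF W(1)] submodule_smult[OF W(1)] in
          \<open>auto simp: bracket_add_right bracket_smult_right subset_iff\<close>)
    moreover have "y \<otimes> z \<in> ?I" if yz: "y \<in> ?I" "z \<in> ?I" for y z
    proof -
      have "a \<otimes> (y \<otimes> z) \<in> W" if "a \<in> A" for a
      proof -
        have "a \<in> carrier L"
          using A(1) that by blast
        then have "a \<otimes> (y \<otimes> z) = (a \<otimes> y) \<otimes> z \<oplus> y \<otimes> (a \<otimes> z)"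
          using leibniz[of a y z] yz by simp
        also have "\<dots> \<in> W"
          using yz that by (intro submodule_add[OF W(1)] W'[of z "a \<otimes> y"] W(2)[of y]) auto
        finally show ?thesis .
      qed
      then show ?thesis
        using yz by auto
    qed
    moreover have "S \<subseteq> ?I"
      using A(2) S(2) by auto
    ultimately show ?thesis
      using S(1) unfolding lie_generated_by_def lie_subalgebra_def by auto
  qed
  \<comment> \<open>The two arguments are extended from generators to all elements one at a time:
    here with \<open>A = S\<close>, and at the end with \<open>A = carrier L\<close>, after
    antisymmetry has exchanged the arguments.\<close>
  have gen: "q \<otimes> y \<in> W" if "q \<in> S" "y \<in> carrier L" for q y
    using closed[OF S(2) S(3)] that by blast
  have "y \<otimes> q \<in> W" if "q \<in> S" "y \<in> carrier L" for q y
    using gen[OF that] bracket_anti[of y q] S(2) that submodule_smult[OF W(1)]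
    by (auto simp: minus_eq_smult subset_iff)
  then show ?thesis
    using closed[of "carrier L"] xy by blast
qed

section \<open>The free Lie algebra\<close>

lemma lie_class_eq_iff: "lie_class V s = lie_class V t \<longleftrightarrow> lie_eq V s t"
  unfolding lie_class_def using lie_eq.refl lie_eq.sym lie_eq.trans by blast

lemma in_lie_class_iff: "s \<in> lie_class V t \<longleftrightarrow> lie_eq V s t"
  by (simp add: lie_class_def)

lemma lie_class_nonempty [simp]: "lie_class V t \<noteq> {}"
  using in_lie_class_iff lie_eq.refl by blast

lemma carrier_free_lie: "carrier (free_lie V) = range (lie_class V)"
  by (simp add: free_lie_def)

lemma lie_class_in [simp]: "lie_class V t \<in> carrier (free_lie V)"
  by (simp add: free_lie_def)

lemma free_lie_zero: "\<zero>\<^bsub>free_lie V\<^esub> = lie_class V LZero"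
  by (simp add: free_lie_def)

lemma free_lie_add: "lie_class V s \<oplus>\<^bsub>free_lie V\<^esub> lie_class V t = lie_class V (LAdd s t)"
proof -
  have "(\<Union>x\<in>lie_class V s. \<Union>y\<in>lie_class V t. lie_class V (LAdd x y)) =
      (\<Union>x\<in>lie_class V s. \<Union>y\<in>lie_class V t. lie_class V (LAdd s t))"
    by (intro SUP_cong refl) (simp_all add: in_lie_class_iff lie_class_eq_iff lie_eq.cong_add)
  also have "\<dots> = lie_class V (LAdd s t)"
    by simp
  finally show ?thesis
    by (simp add: free_lie_def)
qed

lemma free_lie_bracket: "lie_class V s \<otimes>\<^bsub>free_lie V\<^esub> lie_class V t = lie_class V (LBracket s t)"
proof -
  have "(\<Union>x\<in>lie_class V s. \<Union>y\<in>lie_class V t. lie_class V (LBracket x y)) =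
      (\<Union>x\<in>lie_class V s. \<Union>y\<in>lie_class V t. lie_class V (LBracket s t))"
    by (intro SUP_cong refl) (simp_all add: in_lie_class_iff lie_class_eq_iff lie_eq.cong_bracket)
  also have "\<dots> = lie_class V (LBracket s t)"
    by simp
  finally show ?thesis
    by (simp add: free_lie_def)
qed

lemma free_lie_smult: "c \<odot>\<^bsub>free_lie V\<^esub> lie_class V t = lie_class V (LScale c t)"
proof -
  have "(\<Union>x\<in>lie_class V t. lie_class V (LScale c x)) = (\<Union>x\<in>lie_class V t. lie_class V (LScale c t))"
    by (intro SUP_cong refl) (simp_all add: in_lie_class_iff lie_class_eq_iff lie_eq.cong_scale)
  also have "\<dots> = lie_class V (LScale c t)"
    by simp
  finally show ?thesis
    by (simp add: free_lie_def)
qed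

lemmas free_lie_simps = free_lie_zero free_lie_add free_lie_bracket free_lie_smult

lemma free_lie_module: "module complex_ring (free_lie V)"
proof (rule complex_moduleI)
  have zero: "lie_eq V (LAdd LZero s) s" for s
    using lie_eq.add_commute lie_eq.add_zero lie_eq.trans by metis
  have neg: "lie_eq V (LAdd (LScale (- 1) s) s) LZero" for s
    using lie_eq.add_commute lie_eq.add_neg lie_eq.trans by metis
  have scale: "lie_eq V (LScale (c * d) s) (LScale c (LScale d s))" for c d s
    using lie_eq.scale_scale lie_eq.sym by metis
  show "\<zero>\<^bsub>free_lie V\<^esub> \<oplus>\<^bsub>free_lie V\<^esub> x = x" if "x \<in> carrier (free_lie V)" for x
    using that zero by (auto simp: carrier_free_lie free_lie_simps lie_class_eq_iff del: equalityI)
  show "(- 1) \<odot>\<^bsub>free_lie V\<^esub> x \<oplus>\<^bsub>free_lie V\<^esub> x = \<zero>\<^bsub>free_lie V\<^esub>" if "x \<in> carrier (free_lie V)" for x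
    using that neg by (auto simp: carrier_free_lie free_lie_simps lie_class_eq_iff del: equalityI)
  show "(c * d) \<odot>\<^bsub>free_lie V\<^esub> x = c \<odot>\<^bsub>free_lie V\<^esub> (d \<odot>\<^bsub>free_lie V\<^esub> x)" if "x \<in> carrier (free_lie V)" for x c d
    using that scale by (auto simp: carrier_free_lie free_lie_simps lie_class_eq_iff del: equalityI)
qed (auto simp: carrier_free_lie free_lie_simps lie_class_eq_iff del: equalityI intro: lie_eq.intros rangeI)

lemma free_lie_algebra: "lie_algebra (free_lie V)"
  by (intro lie_algebra.intro complex_space.intro free_lie_module lie_algebra_axioms.intro)
    (auto simp: carrier_free_lie free_lie_simps lie_class_eq_iff del: equalityI intro: lie_eq.intros rangeI)

lemma free_lie_generated: "lie_generated_by (free_lie V) (range (\<lambda>v. lie_class V (LGen v)))"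
  unfolding lie_generated_by_def lie_subalgebra_def
proof (intro allI impI, elim conjE)
  interpret F: lie_algebra "free_lie V"
    by (rule free_lie_algebra)
  fix I assume I: "submodule I complex_ring (free_lie V)"
    "\<forall>x\<in>I. \<forall>y\<in>I. x \<otimes>\<^bsub>free_lie V\<^esub> y \<in> I" "range (\<lambda>v. lie_class V (LGen v)) \<subseteq> I"
  have "lie_class V t \<in> I" for t
    using I(2,3) F.submodule_zero[OF I(1)] F.submodule_add[OF I(1)] F.submodule_smult[OF I(1)]
    by (induction t) (auto simp flip: free_lie_simps)
  then show "carrier (free_lie V) \<subseteq> I"
    by (auto simp: carrier_free_lie)
qed

primrec lie_eval :: "'w cspace \<Rightarrow> ('v \<Rightarrow> 'w) \<Rightarrow> 'v lie_term \<Rightarrow> 'w" where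
  "lie_eval M \<rho> (LGen v) = \<rho> v"
| "lie_eval M \<rho> LZero = \<zero>\<^bsub>M\<^esub>"
| "lie_eval M \<rho> (LAdd s t) = lie_eval M \<rho> s \<oplus>\<^bsub>M\<^esub> lie_eval M \<rho> t"
| "lie_eval M \<rho> (LScale c s) = c \<odot>\<^bsub>M\<^esub> lie_eval M \<rho> s"
| "lie_eval M \<rho> (LBracket s t) = lie_eval M \<rho> s \<otimes>\<^bsub>M\<^esub> lie_eval M \<rho> t"

text \<open>Extension by zero, as for the symbols of a free Lie algebra.\<close>

definition linear_from :: "'v cspace \<Rightarrow> 'w cspace \<Rightarrow> ('v \<Rightarrow> 'w) \<Rightarrow> bool" where
  "linear_from V M \<rho> \<longleftrightarrow> (\<forall>v. \<rho> v \<in> carrier M) \<and>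
    (\<forall>v\<in>carrier V. \<forall>w\<in>carrier V. \<rho> (v \<oplus>\<^bsub>V\<^esub> w) = \<rho> v \<oplus>\<^bsub>M\<^esub> \<rho> w) \<and>
    (\<forall>c. \<forall>v\<in>carrier V. \<rho> (c \<odot>\<^bsub>V\<^esub> v) = c \<odot>\<^bsub>M\<^esub> \<rho> v) \<and>
    (\<forall>v. v \<notin> carrier V \<longrightarrow> \<rho> v = \<zero>\<^bsub>M\<^esub>)"

lemma (in lie_algebra) lie_eval_closed: "linear_from V L \<rho> \<Longrightarrow> lie_eval L \<rho> t \<in> carrier L"
  by (induction t) (auto simp: linear_from_def)

lemma (in lie_algebra) lie_eval_cong:
  assumes "linear_from V L \<rho>" "lie_eq V s t"
  shows "lie_eval L \<rho> s = lie_eval L \<rho> t"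
  using assms(2)
proof (induction rule: lie_eq.induct)
  case (add_neg s)
  then show ?case
    using lie_eval_closed[OF assms(1), of s]
    by (simp add: M.r_neg flip: minus_eq_smult)
qed (use lie_eval_closed[OF assms(1)] assms(1) in \<open>simp_all add: M.a_ac add_smult
  smult_add smult_smult bracket_add_left bracket_add_right bracket_smult_left bracket_smult_right
  bracket_self jacobi linear_from_def\<close>)

text \<open>The universal property of the free Lie algebra. \<open>f\<close> takes the common value
  of \<open>lie_eval\<close> on a class of expressions, so it can be computed on any
  representative.\<close>

lemma (in lie_algebra) free_lie_hom:
  assumes "linear_from V L \<rho>"
  obtains f where "lie_hom (free_lie V) L f" "\<And>t. f (lie_class V t) = lie_eval L \<rho> t"
proof
  define f where "f = (\<lambda>S. the_elem (lie_eval L \<rho> ` S))"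
  have "lie_eval L \<rho> ` lie_class V t = {lie_eval L \<rho> t}" for t
    using lie_eval_cong[OF assms] lie_eq.refl
    by (auto simp: in_lie_class_iff intro!: image_eqI[of _ _ t])
  then show f: "f (lie_class V t) = lie_eval L \<rho> t" for t
    by (simp add: f_def)
  show "lie_hom (free_lie V) L f"
    using lie_eval_closed[OF assms]
    by (auto simp: lie_hom_def carrier_free_lie free_lie_simps f)
qed

subsection \<open>Metabelian Lie algebras and symmetric algebras\<close>

locale metabelian_lie_algebra = lie_algebra +
  assumes metabelian: "w \<in> carrier L \<Longrightarrow> x \<in> carrier L \<Longrightarrow> y \<in> carrier L \<Longrightarrow> z \<in> carrier L \<Longrightarrow>
    (w \<otimes> x) \<otimes> (y \<otimes> z) = \<zero>"
begin

abbreviation D where "D \<equiv> lie_derived L (carrier L)"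

lemma D_submodule: "submodule D complex_ring L"
  by (rule lie_derived_submodule) simp

lemma D_carrier [simp]: "x \<in> D \<Longrightarrow> x \<in> carrier L"
  using submodule_subset[OF D_submodule] by blast

lemma bracket_in_D: "x \<in> carrier L \<Longrightarrow> y \<in> carrier L \<Longrightarrow> x \<otimes> y \<in> D"
  by (rule bracket_in_lie_derived)

lemma bracket_D:
  assumes "x \<in> carrier L" "y \<in> carrier L" "z \<in> D"
  shows "(x \<otimes> y) \<otimes> z = \<zero>"
proof -
  have "D \<subseteq> {z \<in> carrier L. (x \<otimes> y) \<otimes> z \<in> {\<zero>}}"
    by (rule lie_derived_induct[OF submodule_bracket_vimage[OF submodule_trivial]])
      (use assms metabelian in auto)
  then show ?thesis
    using assms(3) by blast
qed

text \<open>The commutator of the operators \<open>ad x\<close> and \<open>ad y\<close> is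
  \<open>ad [x, y]\<close>, which vanishes on \<open>D\<close> in a metabelian algebra. This is why
  a commutative ring acts on \<open>D\<close>.\<close>

lemma ad_commute:
  assumes "x \<in> carrier L" "y \<in> carrier L" "z \<in> D"
  shows "x \<otimes> (y \<otimes> z) = y \<otimes> (x \<otimes> z)"
  using leibniz[of x y z] bracket_D[OF assms] assms by simp

context
  fixes \<iota> :: "'v \<Rightarrow> 'a"
  assumes \<iota>_closed: "\<And>v. \<iota> v \<in> carrier L"
begin

lemma sym_act_closed: "x \<in> D \<Longrightarrow> sym_act L \<iota> s x \<in> D"
  by (induction s arbitrary: x)
    (simp_all add: \<iota>_closed bracket_in_D submodule_smult[OF D_submodule] submodule_add[OF D_submodule])

lemma sym_act_carrier: "x \<in> D \<Longrightarrow> sym_act L \<iota> s x \<in> carrier L"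
  using sym_act_closed by simp

lemma sym_act_add:
  "x \<in> D \<Longrightarrow> y \<in> D \<Longrightarrow> sym_act L \<iota> s (x \<oplus> y) = sym_act L \<iota> s x \<oplus> sym_act L \<iota> s y"
proof (induction s arbitrary: x y)
  case (SAdd s t)
  then show ?case
    using sym_act_carrier by (simp add: M.a_ac)
qed (simp_all add: \<iota>_closed bracket_add_right smult_add sym_act_closed)

lemma sym_act_smult: "x \<in> D \<Longrightarrow> sym_act L \<iota> s (c \<odot> x) = c \<odot> sym_act L \<iota> s x"
proof (induction s arbitrary: x)
  case (SAdd s t)
  then show ?case
    using sym_act_carrier by (simp add: smult_add)
qed (simp_all add: \<iota>_closed bracket_smult_right smult_smult sym_act_closed mult.commute)

lemma sym_act_bracket:
  "y \<in> carrier L \<Longrightarrow> x \<in> D \<Longrightarrow> sym_act L \<iota> s (y \<otimes> x) = y \<otimes> sym_act L \<iota> s x"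
proof (induction s arbitrary: x)
  case (SGen v)
  then show ?case
    using ad_commute[of y "\<iota> v" x] by (simp add: \<iota>_closed)
next
  case (SConst c)
  then show ?case
    by (simp add: bracket_smult_right)
next
  case (SAdd s t)
  then show ?case
    using sym_act_carrier by (simp add: bracket_add_right)
qed (simp add: sym_act_closed)

lemma sym_act_commute: "x \<in> D \<Longrightarrow> sym_act L \<iota> s (sym_act L \<iota> t x) = sym_act L \<iota> t (sym_act L \<iota> s x)"
proof (induction s arbitrary: x)
  case (SAdd s s')
  then show ?case
    by (simp add: sym_act_add sym_act_closed)
qed (simp_all add: \<iota>_closed sym_act_bracket sym_act_smult sym_act_closed)

text \<open>Each axiom of the symmetric algebra becomes an identity of operators on
  \<open>D\<close>: commutativity is \<open>sym_act_commute\<close>, distributivity is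
  \<open>sym_act_add\<close>, and the relations between generators hold because
  \<open>\<iota>\<close> is linear. Hence the action descends to classes of expressions.\<close>

lemma sym_act_cong:
  assumes "linear_from V L \<iota>" "sym_eq V s t" "x \<in> D"
  shows "sym_act L \<iota> s x = sym_act L \<iota> t x"
  using assms(2,3)
proof (induction arbitrary: x rule: sym_eq.induct)
  case (add_neg s)
  then show ?case
    using sym_act_carrier[of x s] by (simp add: M.r_neg flip: minus_eq_smult)
next
  case (mult_commute s t)
  then show ?case
    by (simp add: sym_act_commute)
qed (use assms(1) in \<open>simp_all add: sym_act_closed sym_act_carrier sym_act_add M.a_ac
  add_smult smult_smult linear_from_def bracket_add_left bracket_smult_left\<close>)

end

text \<open>The operators \<open>x\<^sub>2\<^sub>1\<close> and \<open>x\<^sub>4\<^sub>3\<close> commute on \<open>D\<close>, so that it suffices to find, for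
  each of the elements \<open>[x\<^sub>i\<^sub>j, x\<^sub>j\<^sub>k]\<close> with \<open>i > j > k\<close>, some factors of the product that
  kill it.\<close>

lemma mccool_relations_kill:
  fixes x :: "nat \<Rightarrow> nat \<Rightarrow> 'a" and n :: nat
  assumes n: "4 \<le> n"
    and xL: "\<And>i j. x i j \<in> carrier L"
    and disj: "\<And>i j k l. 1 \<le> j \<Longrightarrow> j < i \<Longrightarrow> i \<le> n \<Longrightarrow> 1 \<le> l \<Longrightarrow> l < k \<Longrightarrow> k \<le> n \<Longrightarrow>
      {i, j} \<inter> {k, l} = {} \<Longrightarrow> x i j \<otimes> x k l = \<zero>"
    and same: "\<And>i j k. 1 \<le> k \<Longrightarrow> k < j \<Longrightarrow> j < i \<Longrightarrow> i \<le> n \<Longrightarrow> x i k \<otimes> x j k = \<zero>"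
    and sum: "\<And>i j k. 1 \<le> k \<Longrightarrow> k < j \<Longrightarrow> j < i \<Longrightarrow> i \<le> n \<Longrightarrow> x i j \<otimes> (x i k \<oplus> x j k) = \<zero>"
    and ij: "1 \<le> j" "j < i" "i \<le> n" and kl: "1 \<le> l" "l < k" "k \<le> n"
  shows "x 2 1 \<otimes> (x 4 3 \<otimes> (x 2 1 \<otimes> (x 4 3 \<otimes> (x i j \<otimes> x k l)))) = \<zero>"
proof -
  define T where "T z = x 2 1 \<otimes> (x 4 3 \<otimes> (x 2 1 \<otimes> (x 4 3 \<otimes> z)))" for z
  \<comment> \<open>For \<open>i > j > k\<close> the relations leave a single bracket, up to sign,
    among \<open>x i j\<close>, \<open>x i k\<close>, \<open>x j k\<close>: the last two commute,
    and \<open>x i j\<close> has opposite brackets with them.\<close>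
  define e where "e i j k = x i j \<otimes> x j k" for i j k
  note [simp] = xL and [simp del] = One_nat_def
  have [simp]: "e i j k \<in> carrier L" "e i j k \<in> D" for i j k
    by (simp_all add: e_def bracket_in_D)
  have kill: "y \<otimes> (u \<otimes> v) = \<zero>"
    if "y \<in> carrier L" "u \<in> carrier L" "v \<in> carrier L" "y \<otimes> u = \<zero>" "y \<otimes> v = \<zero>" for y u v
    using leibniz[of y u v] that by simp
  have same': "x j k \<otimes> x i k = \<zero>" if "1 \<le> k" "k < j" "j < i" "i \<le> n" for i j k
    using same[OF that] bracket_anti[of "x j k" "x i k"] by simp
  have e_alt: "x i j \<otimes> x i k = \<ominus> e i j k" if "1 \<le> k" "k < j" "j < i" "i \<le> n" for i j k
    using sum[OF that] unfolding e_def
    by (simp add: bracket_add_right M.minus_equality)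
  have e_alt': "e i j k = \<ominus> (x i j \<otimes> x i k)" if "1 \<le> k" "k < j" "j < i" "i \<le> n" for i j k
    using e_alt[OF that] by simp
  have anti: "x j k \<otimes> x i j = \<ominus> e i j k" for i j k
    unfolding e_def using bracket_anti[of "x j k" "x i j"] by simp
  \<comment> \<open>Since \<open>x 2 1\<close> and \<open>x 4 3\<close> commute on \<open>D\<close>,
    \<open>T\<close> kills \<open>z\<close> as soon as a subproduct of its four factors does. In the
    names of the next facts, the digits 1 and 4 stand for a factor \<open>x 2 1\<close> and
    \<open>x 4 3\<close>.\<close>
  have T1: "T z = \<zero>" if "z \<in> D" "x 2 1 \<otimes> z = \<zero>" for z
    using that ad_commute[of "x 2 1" "x 4 3" z] by (simp add: T_def)
  have T4: "T z = \<zero>" if "z \<in> D" "x 4 3 \<otimes> z = \<zero>" for z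
    using that by (simp add: T_def)
  have T14: "T z = \<zero>" if "z \<in> D" "x 4 3 \<otimes> (x 2 1 \<otimes> z) = \<zero>" for z
    using that ad_commute[of "x 2 1" "x 4 3" z] by (simp add: T_def)
  have T11: "T z = \<zero>" if z: "z \<in> D" "x 2 1 \<otimes> (x 2 1 \<otimes> z) = \<zero>" for z
  proof -
    have "T z = x 2 1 \<otimes> (x 4 3 \<otimes> (x 4 3 \<otimes> (x 2 1 \<otimes> z)))"
      using ad_commute[of "x 2 1" "x 4 3" z] z by (simp add: T_def)
    also have "\<dots> = x 4 3 \<otimes> (x 2 1 \<otimes> (x 4 3 \<otimes> (x 2 1 \<otimes> z)))"
      using z by (intro ad_commute) (simp_all add: bracket_in_D)
    also have "x 2 1 \<otimes> (x 4 3 \<otimes> (x 2 1 \<otimes> z)) = x 4 3 \<otimes> (x 2 1 \<otimes> (x 2 1 \<otimes> z))"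
      using z by (intro ad_commute) (simp_all add: bracket_in_D)
    finally show ?thesis
      using z by simp
  qed
  \<comment> \<open>Written with \<open>x i j\<close> and \<open>x i 1\<close>, the bracket has
    entries that both commute with \<open>x 2 1\<close>: the first by disjointness, the second by
    the common second index.\<close>
  have j3k1: "x 2 1 \<otimes> e i j 1 = \<zero>" if "3 \<le> j" "j < i" "i \<le> n" for i j
    using that disj[of 1 2 j i] same'[of 1 2 i]
    by (simp add: e_alt' bracket_minus_right kill)
  \<comment> \<open>\<open>x 2 1\<close> passes \<open>x i j\<close> and acts on
    \<open>x i 2\<close> alone, which moves the problem to \<open>e i 2 1\<close>.\<close>
  have j3k2: "x 2 1 \<otimes> e i j 2 = x i j \<otimes> e i 2 1" if "3 \<le> j" "j < i" "i \<le> n" for i j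
    using that disj[of 1 2 j i] leibniz[of "x 2 1" "x i j" "x i 2"]
    by (simp add: e_alt' bracket_minus_right anti)
  \<comment> \<open>The element \<open>x 2 1 \<otimes> (x 4 3 \<otimes> x 3 2)\<close> is evaluated
    in two ways: with \<open>x 4 2\<close> in place of \<open>x 3 2\<close>, at the price of a sign,
    and directly.\<close>
  have x43e321: "x 4 3 \<otimes> e 4 2 1 = \<ominus> (x 4 3 \<otimes> e 3 2 1)"
  proof -
    have "x 4 3 \<otimes> e 4 2 1 = x 2 1 \<otimes> (x 4 3 \<otimes> x 3 2)"
      using j3k2[of 3 4] n by (simp add: e_def)
    also have "\<dots> = x 4 3 \<otimes> (x 2 1 \<otimes> x 3 2)"
      using leibniz[of "x 2 1" "x 4 3" "x 3 2"] disj[of 1 2 3 4] n by simp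
    also have "\<dots> = \<ominus> (x 4 3 \<otimes> e 3 2 1)"
      by (simp add: anti bracket_minus_right)
    finally show ?thesis .
  qed
  have x31e421: "x 3 1 \<otimes> e 4 2 1 = \<zero>"
    unfolding e_def using disj[of 1 3 2 4] same[of 1 2 3] n by (intro kill) auto
  \<comment> \<open>\<open>x 3 1 \<oplus> x 2 1\<close> commutes with \<open>x 3 2\<close> and with
    \<open>x 2 1\<close>, hence kills their bracket.\<close>
  have x21e321: "x 2 1 \<otimes> e 3 2 1 = \<ominus> (x 3 1 \<otimes> e 3 2 1)"
  proof -
    let ?s = "x 3 1 \<oplus> x 2 1"
    have "x 3 2 \<otimes> ?s = \<zero>" "x 3 1 \<otimes> x 2 1 = \<zero>"
      using sum[of 1 2 3] same[of 1 2 3] n by auto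
    then have "?s \<otimes> (x 3 2 \<otimes> x 2 1) = \<zero>"
      using bracket_anti[of ?s "x 3 2"]
      by (intro kill) (auto simp: bracket_add_left bracket_self)
    then show ?thesis
      by (simp add: e_def bracket_add_left M.minus_equality M.a_comm)
  qed
  \<comment> \<open>On \<open>e 3 2 1\<close>, \<open>x 2 1\<close> acts as the negative of
    \<open>x 3 1\<close>; in the presence of \<open>x 4 3\<close>, \<open>e 3 2 1\<close> may be
    traded for the negative of \<open>e 4 2 1\<close>, which \<open>x 3 1\<close> kills.\<close>
  have x21x43e321: "x 2 1 \<otimes> (x 4 3 \<otimes> e 3 2 1) = \<zero>"
  proof -
    have "x 2 1 \<otimes> (x 4 3 \<otimes> e 3 2 1) = \<ominus> (x 4 3 \<otimes> (x 3 1 \<otimes> e 3 2 1))"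
      using ad_commute[of "x 2 1" "x 4 3" "e 3 2 1"] x21e321 by (simp add: bracket_minus_right)
    also have "\<dots> = x 3 1 \<otimes> (x 4 3 \<otimes> e 4 2 1)"
      using ad_commute[of "x 4 3" "x 3 1" "e 3 2 1"] x43e321 by (simp add: bracket_minus_right)
    also have "\<dots> = x 4 3 \<otimes> (x 3 1 \<otimes> e 4 2 1)"
      by (rule ad_commute) simp_all
    finally show ?thesis
      by (simp add: x31e421)
  qed
  then have x21x43e421: "x 2 1 \<otimes> (x 4 3 \<otimes> e 4 2 1) = \<zero>"
    by (simp add: x43e321 bracket_minus_right)
  have Te: "T (e i j k) = \<zero>" if k: "1 \<le> k" "k < j" "j < i" "i \<le> n" for i j k
  proof -
    consider "3 \<le> k" | "3 \<le> j" "k = 1" | "3 \<le> j" "k = 2" "5 \<le> i" | "i = 4" "j = 3" "k = 2"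
      | "j = 2" "k = 1" "5 \<le> i" | "i = 4" "j = 2" "k = 1" | "i = 3" "j = 2" "k = 1"
      using k by linarith
    then show ?thesis
    proof cases
      case 1
      then have "x 2 1 \<otimes> e i j k = \<zero>"
        unfolding e_def using k disj[of 1 2 j i] disj[of 1 2 k j] by (intro kill) auto
      then show ?thesis
        by (simp add: T1)
    next
      case 2
      then show ?thesis
        using j3k1[of j i] k by (simp add: T1)
    next
      case 3
      \<comment> \<open>As \<open>i \<ge> 5\<close>, the indices of \<open>x 4 3\<close> are
        disjoint from those of both entries of \<open>e i 2 1\<close>.\<close>
      have "x 4 3 \<otimes> e i 2 1 = \<zero>"
        unfolding e_def using 3 k disj[of 3 4 2 i] disj[of 3 4 1 2] by (intro kill) auto
      then have "x 4 3 \<otimes> (x 2 1 \<otimes> e i j k) = \<zero>"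
        using j3k2[of j i] ad_commute[of "x 4 3" "x i j" "e i 2 1"] 3 k by simp
      then show ?thesis
        by (simp add: T14)
    next
      case 4
      \<comment> \<open>The only case that uses both factors \<open>x 2 1\<close>: one turns
        \<open>e 4 3 2\<close> into \<open>x 4 3 \<otimes> e 4 2 1\<close>, the other kills this.
        The same element later shows that the square of \<open>u\<close> cannot be replaced by
        \<open>u\<close>.\<close>
      have "T (e 4 3 2) = \<zero>"
        using j3k2[of 3 4] x21x43e421 n by (simp add: T11)
      then show ?thesis
        by (simp only: 4)
    next
      case 5
      have "x 4 3 \<otimes> e i 2 1 = \<zero>"
        unfolding e_def using 5(3) k disj[of 3 4 2 i] disj[of 3 4 1 2] by (intro kill) auto
      then have "T (e i 2 1) = \<zero>"
        by (simp add: T4)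
      then show ?thesis
        by (simp only: 5(1,2))
    next
      case 6
      have "T (e 4 2 1) = \<zero>"
        using x21x43e421 by (simp add: T_def)
      then show ?thesis
        by (simp only: 6)
    next
      case 7
      have "T (e 3 2 1) = \<zero>"
        using x21x43e321 by (simp add: T_def)
      then show ?thesis
        by (simp only: 7)
    qed
  qed
  have Tm: "T (\<ominus> e i j k) = \<zero>" if "1 \<le> k" "k < j" "j < i" "i \<le> n" for i j k
    using Te[OF that] by (simp add: T_def bracket_minus_right)
  have "T \<zero> = \<zero>"
    by (simp add: T_def)
  consider "i = k" "j = l" | "i = k" "l < j" | "i = k" "j < l" | "j = l" "k < i" | "j = l" "i < k"
    | "j = k" | "i = l" | "{i, j} \<inter> {k, l} = {}"
    by fastforce
  then have "T (x i j \<otimes> x k l) = \<zero>"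
  proof cases
    case 1
    then show ?thesis
      by (simp add: bracket_self \<open>T \<zero> = \<zero>\<close>)
  next
    case 2
    then show ?thesis
      using e_alt[of l j i] Tm[of l j i] ij kl by simp
  next
    case 3
    then have "x i j \<otimes> x k l = e i l j"
      using e_alt[of j l i] bracket_anti[of "x i j" "x i l"] ij kl by simp
    then show ?thesis
      using Te[of j l i] ij kl 3 by simp
  next
    case 4
    then show ?thesis
      using same[of l k i] ij kl \<open>T \<zero> = \<zero>\<close> by simp
  next
    case 5
    then show ?thesis
      using same'[of l i k] ij kl \<open>T \<zero> = \<zero>\<close> by simp
  next
    case 6
    then show ?thesis
      using Te[of l j i] ij kl by (simp add: e_def)
  next
    case 7
    then show ?thesis
      using Tm[of j i k] anti[of i j k] ij kl by simp
  next
    case 8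
    then show ?thesis
      using disj[of j i l k] ij kl \<open>T \<zero> = \<zero>\<close> by simp
  qed
  then show ?thesis
    by (simp add: T_def)
qed

end

section \<open>The symmetric algebra\<close>

lemma sym_class_eq_iff: "sym_class V s = sym_class V t \<longleftrightarrow> sym_eq V s t"
  unfolding sym_class_def using sym_eq.refl sym_eq.sym sym_eq.trans by blast

lemma in_sym_class_iff: "s \<in> sym_class V t \<longleftrightarrow> sym_eq V s t"
  by (simp add: sym_class_def)

lemma sym_class_nonempty [simp]: "sym_class V t \<noteq> {}"
  using in_sym_class_iff sym_eq.refl by blast

lemma carrier_sym_alg: "carrier (sym_alg V) = range (sym_class V)"
  by (simp add: sym_alg_def)

lemma sym_class_in [simp]: "sym_class V t \<in> carrier (sym_alg V)"
  by (simp add: sym_alg_def)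

lemma sym_alg_zero: "\<zero>\<^bsub>sym_alg V\<^esub> = sym_class V (SConst 0)"
  by (simp add: sym_alg_def)

lemma sym_alg_one: "\<one>\<^bsub>sym_alg V\<^esub> = sym_class V (SConst 1)"
  by (simp add: sym_alg_def)

lemma sym_alg_add: "sym_class V s \<oplus>\<^bsub>sym_alg V\<^esub> sym_class V t = sym_class V (SAdd s t)"
proof -
  have "(\<Union>x\<in>sym_class V s. \<Union>y\<in>sym_class V t. sym_class V (SAdd x y)) =
      (\<Union>x\<in>sym_class V s. \<Union>y\<in>sym_class V t. sym_class V (SAdd s t))"
    by (intro SUP_cong refl) (simp_all add: in_sym_class_iff sym_class_eq_iff sym_eq.cong_add)
  also have "\<dots> = sym_class V (SAdd s t)"
    by simp
  finally show ?thesis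
    by (simp add: sym_alg_def)
qed

lemma sym_alg_mult: "sym_class V s \<otimes>\<^bsub>sym_alg V\<^esub> sym_class V t = sym_class V (SMult s t)"
proof -
  have "(\<Union>x\<in>sym_class V s. \<Union>y\<in>sym_class V t. sym_class V (SMult x y)) =
      (\<Union>x\<in>sym_class V s. \<Union>y\<in>sym_class V t. sym_class V (SMult s t))"
    by (intro SUP_cong refl) (simp_all add: in_sym_class_iff sym_class_eq_iff sym_eq.cong_mult)
  also have "\<dots> = sym_class V (SMult s t)"
    by simp
  finally show ?thesis
    by (simp add: sym_alg_def)
qed

lemmas sym_alg_simps = sym_alg_zero sym_alg_one sym_alg_add sym_alg_mult

lemma sym_alg_cring: "cring (sym_alg V)"
proof (rule cringI)
  have flip: "sym_eq V (SAdd (SConst 0) s) s" "sym_eq V (SAdd (SMult (SConst (- 1)) s) s) (SConst 0)" for s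
    using sym_eq.add_commute sym_eq.add_zero sym_eq.add_neg sym_eq.trans by metis+
  have distrib: "sym_eq V (SMult (SAdd s t) u) (SAdd (SMult s u) (SMult t u))" for s t u
    by (meson sym_eq.cong_add sym_eq.distrib sym_eq.mult_commute sym_eq.trans)
  show "abelian_group (sym_alg V)"
  proof (rule abelian_groupI)
    show "\<exists>y\<in>carrier (sym_alg V). y \<oplus>\<^bsub>sym_alg V\<^esub> x = \<zero>\<^bsub>sym_alg V\<^esub>" if x: "x \<in> carrier (sym_alg V)" for x
    proof -
      obtain s where "x = sym_class V s"
        using x unfolding carrier_sym_alg by blast
      then show ?thesis
        using flip(2) by (intro bexI[of _ "sym_class V (SMult (SConst (- 1)) s)"])
          (simp_all add: sym_alg_simps sym_class_eq_iff)
    qed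
  qed (auto simp: carrier_sym_alg sym_alg_simps sym_class_eq_iff del: equalityI
      intro: sym_eq.intros flip rangeI)
  show "comm_monoid (sym_alg V)"
    by (rule comm_monoidI) (auto simp: carrier_sym_alg sym_alg_simps sym_class_eq_iff del: equalityI
      intro: sym_eq.intros rangeI)
  show "(x \<oplus>\<^bsub>sym_alg V\<^esub> y) \<otimes>\<^bsub>sym_alg V\<^esub> z = x \<otimes>\<^bsub>sym_alg V\<^esub> z \<oplus>\<^bsub>sym_alg V\<^esub> y \<otimes>\<^bsub>sym_alg V\<^esub> z"
    if "x \<in> carrier (sym_alg V)" "y \<in> carrier (sym_alg V)" "z \<in> carrier (sym_alg V)" for x y z
    using that distrib by (auto simp: carrier_sym_alg sym_alg_simps sym_class_eq_iff del: equalityI)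
qed

primrec sym_pow :: "'v sym_term \<Rightarrow> nat \<Rightarrow> 'v sym_term" where
  "sym_pow s 0 = SConst 1"
| "sym_pow s (Suc k) = SMult (sym_pow s k) s"

lemma sym_alg_pow: "sym_class V s [^]\<^bsub>sym_alg V\<^esub> (k::nat) = sym_class V (sym_pow s k)"
  by (induction k) (simp_all add: nat_pow_def sym_alg_simps)

lemma sym_class_gen_in_max_ideal:
  assumes "v \<in> carrier V"
  shows "sym_class V (SGen v) \<in> sym_max_ideal V"
  using assms by (auto simp: sym_max_ideal_def genideal_def)

text \<open>If \<open>u\<^sup>2 \<in> I\<close> then \<open>u\<close> lies in all reduced components of \<open>I\<close>, and a multiple of \<open>u\<close> by a
  high power of \<open>f \<in> \<mm>\<close> lies in all components with radical \<open>\<mm>\<close>.\<close>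

lemma not_weakly_reducedI:
  fixes R :: "('a, 'r) ring_scheme" (structure)
  assumes R: "cring R" and u: "u \<in> carrier R" "u [^] (2::nat) \<in> I"
    and f: "f \<in> carrier R" "f \<in> \<mm>" and uf: "\<And>N::nat. u \<otimes> f [^] N \<notin> I"
  shows "\<not> weakly_reduced R \<mm> I"
proof
  interpret cring R by fact
  assume "weakly_reduced R \<mm> I"
  then obtain \<Q> where \<Q>: "minimal_primary_decomposition R I \<Q>"
    "\<And>Q. Q \<in> \<Q> \<Longrightarrow> if isolated_component R \<Q> Q then ideal_radical R Q = Q
              else ideal_radical R Q = \<mm>"
    by (auto simp: weakly_reduced_def)
  then have fin: "finite \<Q>" and I: "I = carrier R \<inter> \<Inter>\<Q>"
    and id: "\<And>Q. Q \<in> \<Q> \<Longrightarrow> ideal Q R"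
    by (auto simp: minimal_primary_decomposition_def primary_ideal_def)
  have "\<exists>k::nat. \<forall>N\<ge>k. u \<otimes> f [^] N \<in> Q" if Q: "Q \<in> \<Q>" for Q
  proof (cases "isolated_component R \<Q> Q")
    case True
    then have "u \<in> Q"
      using \<Q>(2)[OF Q] u I Q by (auto simp: ideal_radical_def)
    then show ?thesis
      using ideal.I_r_closed[OF id[OF Q]] f by blast
  next
    case False
    then have "f \<in> ideal_radical R Q"
      using \<Q>(2)[OF Q] f by simp
    then obtain k :: nat where k: "f [^] k \<in> Q"
      by (auto simp: ideal_radical_def)
    have "u \<otimes> f [^] N \<in> Q" if "k \<le> N" for N
    proof -
      have "f [^] N = f [^] (N - k) \<otimes> f [^] k"
        using that f by (simp add: nat_pow_mult)
      then show ?thesis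
        using ideal.I_l_closed[OF id[OF Q]] k u f by (simp add: m_assoc)
    qed
    then show ?thesis
      by blast
  qed
  then obtain k :: "'a set \<Rightarrow> nat" where k: "\<And>Q N. Q \<in> \<Q> \<Longrightarrow> k Q \<le> N \<Longrightarrow> u \<otimes> f [^] N \<in> Q"
    by metis
  \<comment> \<open>The sum of the exponents is at least each \<open>k Q\<close>, so one power
    serves all of the finitely many components.\<close>
  have "u \<otimes> f [^] (\<Sum>Q\<in>\<Q>. k Q) \<in> I"
    using k fin u f by (auto simp: I member_le_sum)
  then show False
    using uf by blast
qed

subsection \<open>Free groups and Magnus coefficients\<close>

lemma inv_letter_inv_letter [simp]: "inv_letter (inv_letter a) = a"
  by (simp add: inv_letter_def)

lemma fst_inv_letter [simp]: "fst (inv_letter a) = fst a"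
  by (simp add: inv_letter_def)

lemma reduced_word_Nil [simp]: "reduced_word []"
  by (simp add: reduced_word_def)

lemma reduced_word_Cons:
  "reduced_word (a # w) \<longleftrightarrow> reduced_word w \<and> (w = [] \<or> hd w \<noteq> inv_letter a)"
  by (cases w) (auto simp: reduced_word_def)

lemma reduced_push_letter: "reduced_word w \<Longrightarrow> reduced_word (push_letter a w)"
  by (cases w) (auto simp: reduced_word_Cons)

lemma push_letter_reduced: "reduced_word (a # w) \<Longrightarrow> push_letter a w = a # w"
  by (cases w) (auto simp: reduced_word_Cons)

lemma push_letter_cancel:
  assumes "reduced_word w"
  shows "push_letter a (push_letter (inv_letter a) w) = w"
proof (cases w)
  case (Cons b v)
  then show ?thesis
    using assms push_letter_reduced[of a v] by auto
qed simp

lemma push_letter_cancel': "reduced_word w \<Longrightarrow> push_letter (inv_letter a) (push_letter a w) = w"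
  using push_letter_cancel[of w "inv_letter a"] by simp

lemma set_push_letter: "set (push_letter a w) \<subseteq> insert a (set w)"
  by (cases w) auto

abbreviation word_mult :: "letter list \<Rightarrow> letter list \<Rightarrow> letter list" where
  "word_mult u v \<equiv> foldr push_letter u v"

lemma reduced_word_mult: "reduced_word v \<Longrightarrow> reduced_word (word_mult u v)"
  by (induction u) (auto simp: reduced_push_letter)

lemma set_word_mult: "set (word_mult u v) \<subseteq> set u \<union> set v"
  using set_push_letter by (induction u) fastforce+

text \<open>Letters act on reduced words through \<open>push_letter\<close>, with \<open>a\<close>
  and \<open>inv_letter a\<close> acting as mutually inverse maps. A cancellation inside the left
  factor therefore does not change its action, which is the heart of associativity.\<close>

lemma word_mult_push_letter:
  assumes "reduced_word w"
  shows "word_mult (push_letter a v) w = push_letter a (word_mult v w)"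
proof (cases v)
  case (Cons b u)
  then show ?thesis
    using assms push_letter_cancel[of "word_mult u w" a] by (auto simp: reduced_word_mult)
qed simp

lemma word_mult_assoc:
  "reduced_word w \<Longrightarrow> word_mult (word_mult u v) w = word_mult u (word_mult v w)"
  by (induction u) (auto simp: word_mult_push_letter)

lemma word_mult_Nil: "reduced_word w \<Longrightarrow> word_mult w [] = w"
  by (induction w) (auto simp: push_letter_reduced reduced_word_Cons)

lemma word_mult_inverse:
  "reduced_word z \<Longrightarrow> word_mult (rev (map inv_letter w)) (word_mult w z) = z"
  by (induction w) (auto simp: push_letter_cancel' reduced_word_mult)

lemma carrier_free_group: "w \<in> carrier (free_group n) \<longleftrightarrow> reduced_word w \<and> fst ` set w \<subseteq> {1..n}"
  by (simp add: free_group_def)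

lemma mult_free_group: "u \<otimes>\<^bsub>free_group n\<^esub> v = word_mult u v"
  by (simp add: free_group_def)

lemma one_free_group: "\<one>\<^bsub>free_group n\<^esub> = []"
  by (simp add: free_group_def)

lemmas free_group_simps = carrier_free_group mult_free_group one_free_group

lemma free_group_group: "group (free_group n)"
proof (rule groupI)
  fix w assume w: "w \<in> carrier (free_group n)"
  let ?v = "word_mult (rev (map inv_letter w)) []"
  have "word_mult ?v w = word_mult (rev (map inv_letter w)) (word_mult w [])"
    using w by (simp add: word_mult_assoc word_mult_Nil carrier_free_group)
  then have "word_mult ?v w = []"
    using word_mult_inverse[of "[]" w] by simp
  moreover have "?v \<in> carrier (free_group n)"
  proof -
    have "fst ` set ?v \<subseteq> fst ` inv_letter ` set w"
      using set_word_mult[of "rev (map inv_letter w)" "[]"] by (intro image_mono) simp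
    then show ?thesis
      using w by (simp add: carrier_free_group reduced_word_mult image_image subset_trans)
  qed
  ultimately show "\<exists>v\<in>carrier (free_group n). v \<otimes>\<^bsub>free_group n\<^esub> w = \<one>\<^bsub>free_group n\<^esub>"
    by (auto simp: free_group_simps)
next
  fix u v assume "u \<in> carrier (free_group n)" "v \<in> carrier (free_group n)"
  then show "u \<otimes>\<^bsub>free_group n\<^esub> v \<in> carrier (free_group n)"
    using set_word_mult[of u v] by (fastforce simp: free_group_simps reduced_word_mult)
qed (auto simp: free_group_simps word_mult_assoc)

lemma free_gen_in: "k \<in> {1..n} \<Longrightarrow> free_gen k \<in> carrier (free_group n)"
  by (simp add: carrier_free_group free_gen_def reduced_word_Cons)

lemma letter_in: "fst a \<in> {1..n} \<Longrightarrow> [a] \<in> carrier (free_group n)"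
  by (simp add: carrier_free_group reduced_word_Cons)

lemma free_group_Cons:
  assumes "a # w \<in> carrier (free_group n)"
  shows "[a] \<in> carrier (free_group n)" "w \<in> carrier (free_group n)"
    "a # w = [a] \<otimes>\<^bsub>free_group n\<^esub> w"
  using assms by (auto simp: free_group_simps reduced_word_Cons push_letter_reduced)

lemma inv_letter_word:
  assumes "fst a \<in> {1..n}"
  shows "inv\<^bsub>free_group n\<^esub> [a] = [inv_letter a]"
proof (rule group.inv_equality[OF free_group_group])
  show "[inv_letter a] \<otimes>\<^bsub>free_group n\<^esub> [a] = \<one>\<^bsub>free_group n\<^esub>"
    by (simp add: free_group_simps)
qed (use assms in \<open>auto intro: letter_in\<close>)

lemma free_group_induct [consumes 1, case_names one mult gen inv]:
  assumes "w \<in> carrier (free_group n)"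
    and "P \<one>\<^bsub>free_group n\<^esub>"
    and "\<And>u v. u \<in> carrier (free_group n) \<Longrightarrow> v \<in> carrier (free_group n) \<Longrightarrow> P u \<Longrightarrow> P v \<Longrightarrow>
      P (u \<otimes>\<^bsub>free_group n\<^esub> v)"
    and "\<And>k. k \<in> {1..n} \<Longrightarrow> P (free_gen k)"
    and "\<And>k. k \<in> {1..n} \<Longrightarrow> P (inv\<^bsub>free_group n\<^esub> (free_gen k))"
  shows "P w"
  using assms(1)
proof (induction w)
  case Nil
  then show ?case
    using assms(2) by (simp add: one_free_group)
next
  case (Cons a w)
  note c = free_group_Cons[OF Cons.prems]
  have k: "fst a \<in> {1..n}"
    using c(1) by (simp add: carrier_free_group)
  have "P [a]"
    using assms(4)[OF k] assms(5)[OF k] inv_letter_word[of "(fst a, False)" n] k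
    by (cases a; cases "snd a") (auto simp: free_gen_def inv_letter_def)
  then have "P ([a] \<otimes>\<^bsub>free_group n\<^esub> w)"
    using assms(3) c Cons.IH by blast
  then show ?case
    using c(3) by simp
qed

section \<open>Substitution homomorphisms on free groups\<close>

definition letter_val :: "('a, 'm) monoid_scheme \<Rightarrow> (nat \<Rightarrow> 'a) \<Rightarrow> letter \<Rightarrow> 'a" where
  "letter_val G f a = (if snd a then inv\<^bsub>G\<^esub> (f (fst a)) else f (fst a))"

lemma free_subst_simps:
  "free_subst G f [] = \<one>\<^bsub>G\<^esub>"
  "free_subst G f (a # w) = letter_val G f a \<otimes>\<^bsub>G\<^esub> free_subst G f w"
  by (simp_all add: free_subst_def letter_val_def split_beta)

context group
begin

context
  fixes f :: "nat \<Rightarrow> 'a" and n :: nat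
  assumes f: "\<And>k. k \<in> {1..n} \<Longrightarrow> f k \<in> carrier G"
begin

lemma letter_val_closed: "fst a \<in> {1..n} \<Longrightarrow> letter_val G f a \<in> carrier G"
  using f by (auto simp: letter_val_def)

lemma free_subst_closed: "fst ` set w \<subseteq> {1..n} \<Longrightarrow> free_subst G f w \<in> carrier G"
  by (induction w) (auto simp: free_subst_simps letter_val_closed)

lemma free_subst_push_letter:
  assumes "fst a \<in> {1..n}" "fst ` set w \<subseteq> {1..n}"
  shows "free_subst G f (push_letter a w) = letter_val G f a \<otimes> free_subst G f w"
proof (cases w)
  case (Cons b v)
  have "letter_val G f a \<otimes> (letter_val G f (inv_letter a) \<otimes> free_subst G f v) = free_subst G f v"
    using assms Cons f[of "fst a"] free_subst_closed[of v]
    by (auto simp: letter_val_def inv_letter_def inv_solve_left m_assoc[symmetric])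
  then show ?thesis
    using Cons by (auto simp: free_subst_simps)
qed (simp add: free_subst_simps)

lemma free_subst_hom: "free_subst G f \<in> hom (free_group n) G"
proof (rule homI)
  fix u v assume u: "u \<in> carrier (free_group n)" and v: "v \<in> carrier (free_group n)"
  have "free_subst G f (word_mult u v) = free_subst G f u \<otimes> free_subst G f v"
    if "fst ` set u \<subseteq> {1..n}" for u
    using that
  proof (induction u)
    case Nil
    then show ?case
      using v by (simp add: free_subst_simps free_subst_closed carrier_free_group)
  next
    case (Cons a u)
    have "fst ` set (word_mult u v) \<subseteq> {1..n}"
      using Cons.prems v set_word_mult[of u v] by (fastforce simp: carrier_free_group)
    then show ?case
      using Cons v
      by (simp add: free_subst_push_letter free_subst_simps m_assoc letter_val_closed
          free_subst_closed carrier_free_group)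
  qed
  then show "free_subst G f (u \<otimes>\<^bsub>free_group n\<^esub> v) = free_subst G f u \<otimes> free_subst G f v"
    using u by (simp add: free_group_simps)
qed (simp add: free_subst_closed carrier_free_group)

lemma free_subst_gen: "k \<in> {1..n} \<Longrightarrow> free_subst G f (free_gen k) = f k"
  using f by (simp add: free_gen_def free_subst_simps letter_val_def)

end

lemma free_hom_eqI:
  assumes "g \<in> hom (free_group n) G" "h \<in> hom (free_group n) G"
    and "\<And>k. k \<in> {1..n} \<Longrightarrow> g (free_gen k) = h (free_gen k)"
    and "w \<in> carrier (free_group n)"
  shows "g w = h w"
proof -
  interpret g: group_hom "free_group n" G g
    using assms(1) free_group_group by (simp add: group_hom_def group_hom_axioms_def)
  interpret h: group_hom "free_group n" G h
    using assms(2) free_group_group by (simp add: group_hom_def group_hom_axioms_def)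
  show ?thesis
    using assms(4)
    by (induction w rule: free_group_induct)
      (use assms(3) in \<open>simp_all add: free_gen_in\<close>)
qed

end

section \<open>Magnus coefficients up to degree three\<close>

definition letter_coeff :: "nat \<Rightarrow> letter \<Rightarrow> complex" where
  "letter_coeff k a = (if fst a = k then if snd a then - 1 else 1 else 0)"

text \<open>The coefficients of \<open>X\<^sub>k\<close>, \<open>X\<^sub>k X\<^sub>j\<close> and \<open>X\<^sub>k X\<^sub>j X\<^sub>i\<close> in the Magnus expansion
  \<open>x\<^sub>k \<mapsto> 1 + X\<^sub>k\<close>, provided that \<open>k, j, i\<close> are distinct: only then the terms of degree at
  least 2 in the expansion \<open>1 - X\<^sub>k + X\<^sub>k\<^sup>2 - \<dots>\<close> of \<open>x\<^sub>k\<close> inverse do not contribute.\<close>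

primrec magnus1 :: "nat \<Rightarrow> letter list \<Rightarrow> complex" where
  "magnus1 k [] = 0"
| "magnus1 k (a # w) = letter_coeff k a + magnus1 k w"

primrec magnus2 :: "nat \<Rightarrow> nat \<Rightarrow> letter list \<Rightarrow> complex" where
  "magnus2 k j [] = 0"
| "magnus2 k j (a # w) = letter_coeff k a * magnus1 j w + magnus2 k j w"

primrec magnus3 :: "nat \<Rightarrow> nat \<Rightarrow> nat \<Rightarrow> letter list \<Rightarrow> complex" where
  "magnus3 k j i [] = 0"
| "magnus3 k j i (a # w) = letter_coeff k a * magnus2 j i w + magnus3 k j i w"

lemma letter_coeff_inv_letter: "letter_coeff k (inv_letter a) = - letter_coeff k a"
  by (simp add: letter_coeff_def inv_letter_def)

lemma letter_coeff_distinct: "k \<noteq> j \<Longrightarrow> letter_coeff k a * letter_coeff j a = 0"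
  by (simp add: letter_coeff_def)

text \<open>When \<open>a\<close> cancels against its inverse, the linear contributions of the two
  letters cancel. What could survive is a product of coefficients of \<open>a\<close> at two
  adjacent indices, and this is 0 because the indices differ.\<close>

lemma magnus_push_letter:
  shows magnus1_push: "magnus1 k (push_letter a w) = letter_coeff k a + magnus1 k w"
    and magnus2_push: "k \<noteq> j \<Longrightarrow>
      magnus2 k j (push_letter a w) = letter_coeff k a * magnus1 j w + magnus2 k j w"
    and magnus3_push: "k \<noteq> j \<Longrightarrow> j \<noteq> i \<Longrightarrow>
      magnus3 k j i (push_letter a w) = letter_coeff k a * magnus2 j i w + magnus3 k j i w"
  using letter_coeff_distinct[of k j a] letter_coeff_distinct[of j i a]
  by (cases w; auto simp: letter_coeff_inv_letter algebra_simps)+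

text \<open>Multiplicativity of the Magnus expansion, one coefficient at a time: the summands are
  the ways to split the monomial into an initial part from \<open>u\<close> and a final part from
  \<open>v\<close>.\<close>

lemma magnus_mult:
  shows magnus1_mult: "magnus1 k (word_mult u v) = magnus1 k u + magnus1 k v"
    and magnus2_mult: "k \<noteq> j \<Longrightarrow>
      magnus2 k j (word_mult u v) = magnus2 k j u + magnus1 k u * magnus1 j v + magnus2 k j v"
    and magnus3_mult: "k \<noteq> j \<Longrightarrow> j \<noteq> i \<Longrightarrow>
      magnus3 k j i (word_mult u v) =
        magnus3 k j i u + magnus2 k j u * magnus1 i v + magnus1 k u * magnus2 j i v + magnus3 k j i v"
proof -
  show 1: "magnus1 k (word_mult u v) = magnus1 k u + magnus1 k v" for k u
    by (induction u) (simp_all add: magnus1_push)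
  show 2: "magnus2 k j (word_mult u v) = magnus2 k j u + magnus1 k u * magnus1 j v + magnus2 k j v"
    if "k \<noteq> j" for k j u
    by (induction u) (simp_all add: magnus2_push that 1 algebra_simps)
  show "magnus3 k j i (word_mult u v) =
        magnus3 k j i u + magnus2 k j u * magnus1 i v + magnus1 k u * magnus2 j i v + magnus3 k j i v"
    if "k \<noteq> j" "j \<noteq> i"
    by (induction u) (simp_all add: magnus3_push that 1 2 algebra_simps)
qed

lemma magnus_free_gen [simp]:
  "magnus1 k (free_gen m) = (if k = m then 1 else 0)"
  "magnus2 k j (free_gen m) = 0"
  "magnus3 k j i (free_gen m) = 0"
  by (simp_all add: free_gen_def letter_coeff_def)

subsection \<open>The upper McCool groups\<close>

lemma (in group) inv_cancel [simp]:
  assumes "x \<in> carrier G" "y \<in> carrier G"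
  shows "x \<otimes> (inv x \<otimes> y) = y" "inv x \<otimes> (x \<otimes> y) = y"
  using assms by (simp_all flip: m_assoc)

lemma hom_endo_inv:
  assumes "group F" "a \<in> hom F F" "x \<in> carrier F"
  shows "a (inv\<^bsub>F\<^esub> x) = inv\<^bsub>F\<^esub> (a x)"
  using group_hom.hom_inv[of F F a x] assms by (simp add: group_hom_def group_hom_axioms_def)

text \<open>The conjugator is an arbitrary word, so that the inverse of
  \<open>mccool_gen n i j\<close>, which conjugates by the inverse of \<open>free_gen j\<close>, has
  the same shape.\<close>

definition partial_conj :: "nat \<Rightarrow> nat \<Rightarrow> letter list \<Rightarrow> letter list \<Rightarrow> letter list" where
  "partial_conj n i c =
    restrict (free_subst (free_group n) (\<lambda>k. if k = i
         then c \<otimes>\<^bsub>free_group n\<^esub> free_gen i \<otimes>\<^bsub>free_group n\<^esub> inv\<^bsub>free_group n\<^esub> c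
         else free_gen k)) (carrier (free_group n))"

lemma mccool_gen_eq: "mccool_gen n i j = partial_conj n i (free_gen j)"
  by (simp add: mccool_gen_def partial_conj_def Let_def)

lemma restrict_hom: "group G \<Longrightarrow> h \<in> hom G H \<Longrightarrow> restrict h (carrier G) \<in> hom G H"
  by (auto simp: hom_def group.is_monoid monoid.m_closed)

locale mccool =
  fixes n :: nat
begin

abbreviation "F \<equiv> free_group n"

sublocale F: group F
  by (rule free_group_group)

lemma partial_conj_hom:
  assumes "c \<in> carrier F" "i \<in> {1..n}"
  shows "partial_conj n i c \<in> hom F F"
  unfolding partial_conj_def
  by (intro restrict_hom free_group_group F.free_subst_hom) (use assms free_gen_in in auto)

lemma partial_conj_gen:
  assumes "c \<in> carrier F" "i \<in> {1..n}" "k \<in> {1..n}"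
  shows "partial_conj n i c (free_gen k) =
    (if k = i then c \<otimes>\<^bsub>F\<^esub> (free_gen i \<otimes>\<^bsub>F\<^esub> inv\<^bsub>F\<^esub> c) else free_gen k)"
proof -
  define f where "f = (\<lambda>k. if k = i
    then c \<otimes>\<^bsub>F\<^esub> free_gen i \<otimes>\<^bsub>F\<^esub> inv\<^bsub>F\<^esub> c else free_gen k)"
  have "f k \<in> carrier F" if "k \<in> {1..n}" for k
    using that assms free_gen_in by (auto simp: f_def)
  then have "partial_conj n i c (free_gen k) = f k"
    using F.free_subst_gen[of n f k] free_gen_in[OF assms(3)] assms(3)
    unfolding partial_conj_def f_def[symmetric] by auto
  then show ?thesis
    using assms free_gen_in[OF assms(2)] by (simp add: f_def F.m_assoc)
qed

lemma partial_conj_extensional: "partial_conj n i c \<in> extensional (carrier F)"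
  by (simp add: partial_conj_def)

lemma automorphismI:
  assumes "a \<in> hom F F" "b \<in> hom F F" "a \<in> extensional (carrier F)"
    and "\<And>k. k \<in> {1..n} \<Longrightarrow> b (a (free_gen k)) = free_gen k"
    and "\<And>k. k \<in> {1..n} \<Longrightarrow> a (b (free_gen k)) = free_gen k"
  shows "a \<in> auto F"
proof -
  have id: "(\<lambda>x. x) \<in> hom F F"
    by (simp add: hom_def)
  have comp: "(\<lambda>x. g (h x)) \<in> hom F F" if "g \<in> hom F F" "h \<in> hom F F" for g h
    using that by (auto simp: hom_def)
  have "bij_betw a (carrier F) (carrier F)"
  proof (rule bij_betw_byWitness)
    show "\<forall>w\<in>carrier F. b (a w) = w" "\<forall>w\<in>carrier F. a (b w) = w"
      using F.free_hom_eqI[OF comp[OF assms(2,1)] id assms(4)]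
        F.free_hom_eqI[OF comp[OF assms(1,2)] id assms(5)] by auto
  qed (use assms(1,2) in \<open>auto simp: hom_def\<close>)
  then show ?thesis
    using assms by (simp add: auto_def Bij_def)
qed

lemma mccool_gen_hom: "i \<in> {1..n} \<Longrightarrow> j \<in> {1..n} \<Longrightarrow> mccool_gen n i j \<in> hom F F"
  by (simp add: mccool_gen_eq partial_conj_hom free_gen_in)

lemma mccool_gen_gen:
  assumes "i \<in> {1..n}" "j \<in> {1..n}" "k \<in> {1..n}"
  shows "mccool_gen n i j (free_gen k) =
    (if k = i then free_gen j \<otimes>\<^bsub>F\<^esub> (free_gen i \<otimes>\<^bsub>F\<^esub> inv\<^bsub>F\<^esub> (free_gen j)) else free_gen k)"
  using assms by (simp add: mccool_gen_eq partial_conj_gen free_gen_in)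

lemma mccool_gen_auto:
  assumes "i \<in> {1..n}" "j \<in> {1..n}" "i \<noteq> j"
  shows "mccool_gen n i j \<in> auto F"
proof (rule automorphismI)
  let ?x = "free_gen :: nat \<Rightarrow> letter list"
  let ?a = "mccool_gen n i j" and ?b = "partial_conj n i (inv\<^bsub>F\<^esub> (?x j))"
  have x: "?x k \<in> carrier F" if "k \<in> {1..n}" for k
    using that by (rule free_gen_in)
  show a: "?a \<in> hom F F" and b: "?b \<in> hom F F"
    using assms x by (auto intro: mccool_gen_hom partial_conj_hom)
  show "?a \<in> extensional (carrier F)"
    by (simp add: mccool_gen_eq partial_conj_extensional)
  note [simp] = mccool_gen_gen partial_conj_gen x hom_mult[OF a] hom_mult[OF b]
    hom_endo_inv[OF free_group_group a] hom_endo_inv[OF free_group_group b] F.m_assoc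
  show "?b (?a (?x k)) = ?x k" "?a (?b (?x k)) = ?x k" if "k \<in> {1..n}" for k
    using assms that by auto
qed

lemma hom_comp_eqI:
  assumes "a \<in> hom F F" "b \<in> hom F F" "c \<in> hom F F" "d \<in> hom F F"
    and "\<And>k. k \<in> {1..n} \<Longrightarrow> a (b (free_gen k)) = c (d (free_gen k))"
  shows "compose (carrier F) a b = compose (carrier F) c d"
proof -
  have comp: "(\<lambda>x. g (h x)) \<in> hom F F" if "g \<in> hom F F" "h \<in> hom F F" for g h
    using that by (auto simp: hom_def)
  show ?thesis
    using F.free_hom_eqI[OF comp[OF assms(1,2)] comp[OF assms(3,4)] assms(5)]
    by (auto simp: compose_def)
qed

lemma mccool_commute_disjoint:
  assumes "i \<in> {1..n}" "j \<in> {1..n}" "k \<in> {1..n}" "l \<in> {1..n}" "{i, j} \<inter> {k, l} = {}"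
  shows "compose (carrier F) (mccool_gen n i j) (mccool_gen n k l) =
    compose (carrier F) (mccool_gen n k l) (mccool_gen n i j)"
proof -
  note h = mccool_gen_hom[OF assms(1,2)] mccool_gen_hom[OF assms(3,4)]
  note [simp] = mccool_gen_gen free_gen_in hom_mult[OF h(1)] hom_mult[OF h(2)]
    hom_endo_inv[OF free_group_group h(1)] hom_endo_inv[OF free_group_group h(2)]
  show ?thesis
    by (rule hom_comp_eqI) (use assms h in auto)
qed

lemma mccool_commute_same:
  assumes "i \<in> {1..n}" "j \<in> {1..n}" "k \<in> {1..n}" "i \<noteq> j" "i \<noteq> k" "j \<noteq> k"
  shows "compose (carrier F) (mccool_gen n i k) (mccool_gen n j k) =
    compose (carrier F) (mccool_gen n j k) (mccool_gen n i k)"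
proof -
  note h = mccool_gen_hom[OF assms(1,3)] mccool_gen_hom[OF assms(2,3)]
  note [simp] = mccool_gen_gen free_gen_in hom_mult[OF h(1)] hom_mult[OF h(2)]
    hom_endo_inv[OF free_group_group h(1)] hom_endo_inv[OF free_group_group h(2)]
  show ?thesis
    by (rule hom_comp_eqI) (use assms h in auto)
qed

lemma mccool_commute_sum:
  assumes "i \<in> {1..n}" "j \<in> {1..n}" "k \<in> {1..n}" "i \<noteq> j" "i \<noteq> k" "j \<noteq> k"
  defines "p \<equiv> compose (carrier F) (mccool_gen n i k) (mccool_gen n j k)"
  shows "compose (carrier F) (mccool_gen n i j) p = compose (carrier F) p (mccool_gen n i j)"
proof -
  note h = mccool_gen_hom[OF assms(1,3)] mccool_gen_hom[OF assms(2,3)] mccool_gen_hom[OF assms(1,2)]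
  have hp: "p \<in> hom F F"
    unfolding p_def using F.hom_compose[OF h(2,1)] by simp
  note [simp] = mccool_gen_gen free_gen_in hom_mult[OF h(1)] hom_mult[OF h(2)] hom_mult[OF h(3)]
    hom_endo_inv[OF free_group_group h(1)] hom_endo_inv[OF free_group_group h(2)]
    hom_endo_inv[OF free_group_group h(3)] hom_mult[OF hp] hom_endo_inv[OF free_group_group hp]
  \<comment> \<open>\<open>p\<close> conjugates the generators with indices \<open>i\<close> and
    \<open>j\<close> simultaneously by the one with index \<open>k\<close>. It then conjugates every
    word in these two in the same way, and \<open>mccool_gen n i j\<close> fixes the conjugator, so
    the two maps commute.\<close>
  have p: "p (free_gen m) = (if m = i \<or> m = j
      then free_gen k \<otimes>\<^bsub>F\<^esub> (free_gen m \<otimes>\<^bsub>F\<^esub> inv\<^bsub>F\<^esub> (free_gen k)) else free_gen m)"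
    if "m \<in> {1..n}" for m
    using that assms(1-6) by (simp add: p_def compose_def)
  show ?thesis
    by (rule hom_comp_eqI) (use assms(1-6) h hp in \<open>auto simp: p F.m_assoc F.inv_mult_group\<close>)
qed

text \<open>The action on the Magnus expansion modulo degree 4, with \<open>X\<^sub>j\<close> sent to
  \<open>X\<^sub>j + \<Sum>\<^sub>k c\<^sub>k X\<^sub>k X\<^sub>j + \<dots>\<close>, as far as the terms \<open>X\<^sub>k X\<^sub>j X\<^sub>i\<close> with \<open>k < j < i\<close> are
  concerned.\<close>

definition magnus_law_at :: "(letter list \<Rightarrow> letter list) \<Rightarrow> letter list \<Rightarrow> bool" where
  "magnus_law_at a w \<longleftrightarrow>
    (\<forall>k. magnus1 k (a w) = magnus1 k w) \<and>
    (\<forall>k j. 1 \<le> k \<longrightarrow> k < j \<longrightarrow> j \<le> n \<longrightarrow>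
      magnus2 k j (a w) = magnus2 k j w + magnus2 k j (a (free_gen j)) * magnus1 j w) \<and>
    (\<forall>k j i. 1 \<le> k \<longrightarrow> k < j \<longrightarrow> j < i \<longrightarrow> i \<le> n \<longrightarrow>
      magnus3 k j i (a w) = magnus3 k j i w
        + magnus2 k j (a (free_gen j)) * magnus2 j i w
        + magnus2 j i (a (free_gen i)) * magnus2 k i w
        + magnus3 k j i (a (free_gen i)) * magnus1 i w)"

definition magnus_law :: "(letter list \<Rightarrow> letter list) \<Rightarrow> bool" where
  "magnus_law a \<longleftrightarrow> (\<forall>w\<in>carrier F. magnus_law_at a w)"

lemma magnus_lawD:
  assumes "magnus_law a" "w \<in> carrier F"
  shows magnus_law1: "magnus1 k (a w) = magnus1 k w"
    and magnus_law2: "1 \<le> k \<Longrightarrow> k < j \<Longrightarrow> j \<le> n \<Longrightarrow>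
      magnus2 k j (a w) = magnus2 k j w + magnus2 k j (a (free_gen j)) * magnus1 j w"
    and magnus_law3: "1 \<le> k \<Longrightarrow> k < j \<Longrightarrow> j < i \<Longrightarrow> i \<le> n \<Longrightarrow>
      magnus3 k j i (a w) = magnus3 k j i w
        + magnus2 k j (a (free_gen j)) * magnus2 j i w
        + magnus2 j i (a (free_gen i)) * magnus2 k i w
        + magnus3 k j i (a (free_gen i)) * magnus1 i w"
  using assms by (auto simp: magnus_law_def magnus_law_at_def)

text \<open>The right-hand sides of the law are coefficients after a substitution of power series,
  which is multiplicative; they therefore expand as \<open>magnus_mult\<close> prescribes.\<close>

lemma magnus_law_at_mult:
  assumes "a \<in> hom F F" "u \<in> carrier F" "v \<in> carrier F" "magnus_law_at a u" "magnus_law_at a v"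
  shows "magnus_law_at a (u \<otimes>\<^bsub>F\<^esub> v)"
proof -
  have "a (u \<otimes>\<^bsub>F\<^esub> v) = word_mult (a u) (a v)"
    using hom_mult[OF assms(1-3)] by (simp add: mult_free_group)
  then show ?thesis
    using assms(4,5) unfolding magnus_law_at_def
    by (simp add: mult_free_group magnus_mult algebra_simps)
qed

text \<open>Substitutions compose. The coefficients of degree two at the generators add up, whereas
  those of degree three also pick up the products of degree two coefficients in
  \<open>u3\<close>.\<close>

lemma magnus_law_comp:
  assumes "magnus_law a" "magnus_law b" "b \<in> hom F F" "\<And>w. w \<in> carrier F \<Longrightarrow> c w = a (b w)"
  shows "magnus_law c"
proof -
  have b: "b w \<in> carrier F" if "w \<in> carrier F" for w
    using hom_in_carrier[OF assms(3)] that .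
  have x: "free_gen j \<in> carrier F" if "1 \<le> k" "k < j" "j \<le> n" for k j
    using that by (intro free_gen_in) auto
  have 1: "magnus1 k (c w) = magnus1 k w" if w: "w \<in> carrier F" for k w
    using magnus_law1[OF assms(1) b, OF w] magnus_law1[OF assms(2) w] assms(4)[OF w] by simp
  have 2: "magnus2 k j (c w) = magnus2 k j w
      + (magnus2 k j (a (free_gen j)) + magnus2 k j (b (free_gen j))) * magnus1 j w"
    if w: "w \<in> carrier F" and kj: "1 \<le> k" "k < j" "j \<le> n" for k j w
    using magnus_law2[OF assms(1) b, OF w kj] magnus_law2[OF assms(2) w kj]
      magnus_law1[OF assms(2) w] assms(4)[OF w] by (simp add: algebra_simps)
  have u2: "magnus2 k j (c (free_gen j)) = magnus2 k j (a (free_gen j)) + magnus2 k j (b (free_gen j))"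
    if kj: "1 \<le> k" "k < j" "j \<le> n" for k j
    using 2[OF x[OF kj] kj] by simp
  have 3: "magnus3 k j i (c w) = magnus3 k j i w
        + (magnus2 k j (a (free_gen j)) + magnus2 k j (b (free_gen j))) * magnus2 j i w
        + (magnus2 j i (a (free_gen i)) + magnus2 j i (b (free_gen i))) * magnus2 k i w
        + (magnus3 k j i (a (free_gen i)) + magnus3 k j i (b (free_gen i))
           + magnus2 k j (a (free_gen j)) * magnus2 j i (b (free_gen i))
           + magnus2 j i (a (free_gen i)) * magnus2 k i (b (free_gen i))) * magnus1 i w"
    if w: "w \<in> carrier F" and kji: "1 \<le> k" "k < j" "j < i" "i \<le> n" for k j i w
  proof -
    have "1 \<le> j" "k < i"
      using kji by auto
    then show ?thesis
      using magnus_law3[OF assms(1) b, OF w kji] magnus_law3[OF assms(2) w kji]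
        magnus_law2[OF assms(2) w \<open>1 \<le> j\<close> kji(3,4)] magnus_law2[OF assms(2) w kji(1) \<open>k < i\<close> kji(4)]
        magnus_law1[OF assms(2) w] assms(4)[OF w]
      by (simp add: algebra_simps)
  qed
  have u3: "magnus3 k j i (c (free_gen i)) = magnus3 k j i (a (free_gen i)) + magnus3 k j i (b (free_gen i))
           + magnus2 k j (a (free_gen j)) * magnus2 j i (b (free_gen i))
           + magnus2 j i (a (free_gen i)) * magnus2 k i (b (free_gen i))"
    if kji: "1 \<le> k" "k < j" "j < i" "i \<le> n" for k j i
    using 3[OF x[of j i] kji] kji by simp
  show ?thesis
    unfolding magnus_law_def magnus_law_at_def
    using 1 2 u2 3 u3 by auto
qed

text \<open>The law of \<open>a\<close> at the word \<open>b w\<close> is a triangular system for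
  the coefficients of \<open>b w\<close>, whose left-hand sides are the coefficients of
  \<open>w\<close>. It is solved degree by degree.\<close>

lemma magnus_law_inverse:
  assumes "magnus_law a" "\<And>w. w \<in> carrier F \<Longrightarrow> b w \<in> carrier F" "\<And>w. w \<in> carrier F \<Longrightarrow> a (b w) = w"
  shows "magnus_law b"
proof -
  note b = assms(2,3)
  have 1: "magnus1 k (b w) = magnus1 k w" if "w \<in> carrier F" for k w
    using magnus_law1[OF assms(1) b(1), OF that, of k] b that by simp
  have 2: "magnus2 k j (b w) = magnus2 k j w - magnus2 k j (a (free_gen j)) * magnus1 j w"
    if "w \<in> carrier F" "1 \<le> k" "k < j" "j \<le> n" for k j w
    using magnus_law2[OF assms(1) b(1), OF that] b that by (simp add: 1)
  have 3: "magnus3 k j i (b w) = magnus3 k j i w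
        - magnus2 k j (a (free_gen j)) * magnus2 j i (b w)
        - magnus2 j i (a (free_gen i)) * magnus2 k i (b w)
        - magnus3 k j i (a (free_gen i)) * magnus1 i w"
    if "w \<in> carrier F" "1 \<le> k" "k < j" "j < i" "i \<le> n" for k j i w
    using magnus_law3[OF assms(1) b(1), OF that] b that by (simp add: 1)
  have x: "free_gen j \<in> carrier F" if "1 \<le> k" "k < j" "j \<le> n" for k j
    using that by (intro free_gen_in) auto
  have u2: "magnus2 k j (b (free_gen j)) = - magnus2 k j (a (free_gen j))"
    if kj: "1 \<le> k" "k < j" "j \<le> n" for k j
    using 2[OF x[OF kj] kj] by simp
  have u3: "magnus3 k j i (b w) = magnus3 k j i w
        - magnus2 k j (a (free_gen j)) * magnus2 j i w
        - magnus2 j i (a (free_gen i)) * magnus2 k i w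
        + (magnus2 k j (a (free_gen j)) * magnus2 j i (a (free_gen i))
        + magnus2 j i (a (free_gen i)) * magnus2 k i (a (free_gen i))
        - magnus3 k j i (a (free_gen i))) * magnus1 i w"
    if w: "w \<in> carrier F" and kji: "1 \<le> k" "k < j" "j < i" "i \<le> n" for k j i w
  proof -
    have "1 \<le> j" "k < i"
      using kji by auto
    then show ?thesis
      using 3[OF w kji] 2[OF w \<open>1 \<le> j\<close> kji(3,4)] 2[OF w kji(1) \<open>k < i\<close> kji(4)]
      by (simp add: algebra_simps)
  qed
  have v3: "magnus3 k j i (b (free_gen i)) = magnus2 k j (a (free_gen j)) * magnus2 j i (a (free_gen i))
        + magnus2 j i (a (free_gen i)) * magnus2 k i (a (free_gen i))
        - magnus3 k j i (a (free_gen i))"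
    if kji: "1 \<le> k" "k < j" "j < i" "i \<le> n" for k j i
    using u3[OF x[of j i] kji] kji by simp
  show ?thesis
    unfolding magnus_law_def magnus_law_at_def
    using 1 2 u2 u3 v3 by auto
qed

lemma magnus_law_id: "magnus_law (\<lambda>w\<in>carrier F. w)"
  using free_gen_in by (simp add: magnus_law_def magnus_law_at_def)

lemma letter_word:
  assumes "k \<in> {1..n}"
  shows "inv\<^bsub>F\<^esub> (free_gen k) = [(k, True)]"
  using inv_letter_word[of "(k, False)" n] assms by (simp add: free_gen_def inv_letter_def)

lemma mccool_gen_word:
  assumes "i \<in> {1..n}" "j \<in> {1..n}" "i \<noteq> j" "k \<in> {1..n}"
  shows "mccool_gen n i j (free_gen k) =
      (if k = i then [(j, False), (i, False), (j, True)] else [(k, False)])"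
    and "mccool_gen n i j (inv\<^bsub>F\<^esub> (free_gen k)) =
      (if k = i then [(j, False), (i, True), (j, True)] else [(k, True)])"
proof -
  show gen: "mccool_gen n i j (free_gen k) =
      (if k = i then [(j, False), (i, False), (j, True)] else [(k, False)])"
    using assms letter_word[of j]
    by (simp add: mccool_gen_gen mult_free_group) (simp add: free_gen_def inv_letter_def)
  have "mccool_gen n i j (inv\<^bsub>F\<^esub> (free_gen k)) = inv\<^bsub>F\<^esub> (mccool_gen n i j (free_gen k))"
    by (rule hom_endo_inv[OF free_group_group mccool_gen_hom free_gen_in]) (use assms in auto)
  moreover have "inv\<^bsub>F\<^esub> (free_gen j \<otimes>\<^bsub>F\<^esub> (free_gen i \<otimes>\<^bsub>F\<^esub> inv\<^bsub>F\<^esub> (free_gen j)))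
    = free_gen j \<otimes>\<^bsub>F\<^esub> (inv\<^bsub>F\<^esub> (free_gen i) \<otimes>\<^bsub>F\<^esub> inv\<^bsub>F\<^esub> (free_gen j))"
    using assms free_gen_in by (simp add: F.inv_mult_group F.m_assoc)
  ultimately show "mccool_gen n i j (inv\<^bsub>F\<^esub> (free_gen k)) =
      (if k = i then [(j, False), (i, True), (j, True)] else [(k, True)])"
    using assms letter_word[of j] letter_word[of i] letter_word[of k]
    by (simp add: mccool_gen_gen mult_free_group) (simp add: free_gen_def inv_letter_def)
qed

text \<open>Here \<open>j < i\<close> matters. Conjugating by the generator with index
  \<open>j\<close> also produces monomials in which index \<open>i\<close> precedes index
  \<open>j\<close>, but these decrease somewhere and do not meet the monomials with increasing
  indices that the law records.\<close>

lemma mccool_gen_law: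
  assumes "i \<in> {1..n}" "j \<in> {1..n}" "j < i"
  shows "magnus_law (mccool_gen n i j)"
proof -
  have ij: "i \<in> {1..n}" "j \<in> {1..n}" "i \<noteq> j"
    using assms by auto
  note h = mccool_gen_hom[OF ij(1,2)]
  have "magnus_law_at (mccool_gen n i j) w" if "w \<in> carrier F" for w
    using that
  proof (induction w rule: free_group_induct)
    case one
    then show ?case
      using group_hom.hom_one[of F F "mccool_gen n i j"] h free_group_group
      by (simp add: magnus_law_at_def one_free_group group_hom_def group_hom_axioms_def)
  next
    case (mult u v)
    then show ?case
      using h by (intro magnus_law_at_mult)
  next
    case (gen k)
    then show ?case
      using assms by (simp add: magnus_law_at_def mccool_gen_word[OF ij] letter_coeff_def)
  next
    case (inv k)
    then have "mccool_gen n i j [(k, True)] = (if k = i then [(j, False), (i, True), (j, True)] else [(k, True)])"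
      using mccool_gen_word(2)[OF ij inv] letter_word[OF inv] by simp
    then show ?case
      using assms inv
      by (simp add: magnus_law_at_def mccool_gen_word[OF ij] letter_word letter_coeff_def)
  qed
  then show ?thesis
    by (simp add: magnus_law_def)
qed

end

section \<open>Elements of the upper McCool group and their Magnus coefficients\<close>

lemma (in group) generate_induct_inv [consumes 1, case_names one gen inv mult]:
  assumes "x \<in> generate G S" "P \<one>" "\<And>s. s \<in> S \<Longrightarrow> P s" "\<And>s. s \<in> S \<Longrightarrow> P (inv s)"
    and "\<And>x y. x \<in> generate G S \<Longrightarrow> y \<in> generate G S \<Longrightarrow> P x \<Longrightarrow> P y \<Longrightarrow> P (x \<otimes> y)"
  shows "P x"
  using assms by (induction rule: generate.induct) auto

context mccool
begin

abbreviation "G \<equiv> upper_mccool_group n"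

sublocale A: group "AutoGroup F"
  by (rule F.AutoGroup)

lemma upper_mccool_group: "group G"
  unfolding upper_mccool_group_def by (rule A.group_subgroup_generated)

sublocale G: group G
  by (rule upper_mccool_group)

lemma carrier_upper_mccool: "carrier G =
  generate (AutoGroup F) {mccool_gen n i j | i j. 1 \<le> j \<and> j < i \<and> i \<le> n}"
proof -
  have "{mccool_gen n i j | i j. 1 \<le> j \<and> j < i \<and> i \<le> n} \<subseteq> carrier (AutoGroup F)"
    using mccool_gen_auto by (fastforce simp: AutoGroup_def)
  then show ?thesis
    unfolding upper_mccool_group_def carrier_subgroup_generated by (simp add: Int_absorb1)
qed

lemma mccool_gen_in: "1 \<le> j \<Longrightarrow> j < i \<Longrightarrow> i \<le> n \<Longrightarrow> mccool_gen n i j \<in> carrier G"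
  unfolding carrier_upper_mccool by (rule generate.incl) auto

lemma upper_mccool_auto: "a \<in> carrier G \<Longrightarrow> a \<in> auto F"
  using A.generate_in_carrier[of "{mccool_gen n i j | i j. 1 \<le> j \<and> j < i \<and> i \<le> n}" a]
    mccool_gen_auto unfolding carrier_upper_mccool by (fastforce simp: AutoGroup_def)

lemma upper_mccool_hom: "a \<in> carrier G \<Longrightarrow> a \<in> hom F F"
  using upper_mccool_auto by (auto simp: auto_def)

lemma mult_upper_mccool:
  assumes "a \<in> carrier G" "b \<in> carrier G"
  shows "a \<otimes>\<^bsub>G\<^esub> b = compose (carrier F) a b"
  using upper_mccool_auto[OF assms(1)] upper_mccool_auto[OF assms(2)]
  by (simp add: upper_mccool_group_def subgroup_generated_def AutoGroup_def BijGroup_def auto_def)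

lemma one_upper_mccool: "\<one>\<^bsub>G\<^esub> = (\<lambda>w\<in>carrier F. w)"
  by (simp add: upper_mccool_group_def subgroup_generated_def AutoGroup_def BijGroup_def)

lemma upper_mccool_induct [consumes 1, case_names one gen inv mult]:
  assumes "a \<in> carrier G" "P \<one>\<^bsub>G\<^esub>"
    and "\<And>i j. 1 \<le> j \<Longrightarrow> j < i \<Longrightarrow> i \<le> n \<Longrightarrow> P (mccool_gen n i j)"
    and inv: "\<And>a. a \<in> carrier G \<Longrightarrow> P a \<Longrightarrow> P (inv\<^bsub>G\<^esub> a)"
    and "\<And>a b. a \<in> carrier G \<Longrightarrow> b \<in> carrier G \<Longrightarrow> P a \<Longrightarrow> P b \<Longrightarrow> P (a \<otimes>\<^bsub>G\<^esub> b)"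
  shows "P a"
proof -
  have inv_eq: "inv\<^bsub>AutoGroup F\<^esub> a = inv\<^bsub>G\<^esub> a" if "a \<in> carrier G" for a
    using A.inv_subgroup_generated[of a] that unfolding upper_mccool_group_def by simp
  have eqs: "\<one>\<^bsub>AutoGroup F\<^esub> = \<one>\<^bsub>G\<^esub>" "\<And>a b. a \<otimes>\<^bsub>AutoGroup F\<^esub> b = a \<otimes>\<^bsub>G\<^esub> b"
    by (simp_all add: upper_mccool_group_def subgroup_generated_def)
  show ?thesis
    using assms(1) unfolding carrier_upper_mccool
  proof (induction rule: A.generate_induct_inv)
    case (inv s)
    then obtain i j where "s = mccool_gen n i j" "1 \<le> j" "j < i" "i \<le> n"
      by blast
    then show ?case
      using assms(3,4) mccool_gen_in inv_eq by metis
  qed (use assms(2,3,5) eqs in \<open>auto simp: carrier_upper_mccool\<close>)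
qed

lemma upper_mccool_law:
  assumes "a \<in> carrier G"
  shows "magnus_law a"
  using assms
proof (induction rule: upper_mccool_induct)
  case one
  show ?case
    unfolding one_upper_mccool by (rule magnus_law_id)
next
  case (gen i j)
  then show ?case
    by (intro mccool_gen_law) auto
next
  case (inv a)
  have cancel: "a ((inv\<^bsub>G\<^esub> a) w) = w" if "w \<in> carrier F" for w
  proof -
    have "compose (carrier F) a (inv\<^bsub>G\<^esub> a) w = (\<lambda>w\<in>carrier F. w) w"
      using inv G.r_inv[of a] mult_upper_mccool[of a "inv\<^bsub>G\<^esub> a"] by (simp add: one_upper_mccool)
    then show ?thesis
      using that by (simp add: compose_def)
  qed
  have closed: "(inv\<^bsub>G\<^esub> a) w \<in> carrier F" if "w \<in> carrier F" for w
    by (rule hom_in_carrier[OF upper_mccool_hom that]) (use inv in simp)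
  show ?case
    by (rule magnus_law_inverse[OF inv.IH closed cancel])
next
  case (mult a b)
  show ?case
  proof (rule magnus_law_comp[OF mult.IH upper_mccool_hom[OF mult.hyps(2)]])
    show "(a \<otimes>\<^bsub>G\<^esub> b) w = a (b w)" if "w \<in> carrier F" for w
      using that by (simp add: mult_upper_mccool[OF mult.hyps] compose_def)
  qed
qed

text \<open>The class dual to the generator with indices \<open>i\<close>, \<open>j\<close>: this
  degree two coefficient is the exponent sum of that generator in \<open>a\<close>. The value 0
  outside the group is the convention of \<open>H1_cohom\<close>.\<close>

definition mccool_dual :: "nat \<Rightarrow> nat \<Rightarrow> (letter list \<Rightarrow> letter list) \<Rightarrow> complex" where
  "mccool_dual i j a = (if a \<in> carrier G then magnus2 j i (a (free_gen i)) else 0)"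

text \<open>The sign compensates for the term \<open>- c (g \<otimes> h)\<close> in the
  coboundary.\<close>

definition mccool_cochain :: "nat \<Rightarrow> nat \<Rightarrow> nat \<Rightarrow> (letter list \<Rightarrow> letter list) \<Rightarrow> complex" where
  "mccool_cochain i j k a = - magnus3 k j i (a (free_gen i))"

lemma mccool_dual_mult:
  assumes "a \<in> carrier G" "b \<in> carrier G" and ij: "1 \<le> j" "j < i" "i \<le> n"
  shows "mccool_dual i j (a \<otimes>\<^bsub>G\<^esub> b) = mccool_dual i j a + mccool_dual i j b"
proof -
  have x: "free_gen i \<in> carrier F"
    using ij by (intro free_gen_in) auto
  then have bx: "b (free_gen i) \<in> carrier F"
    using hom_in_carrier[OF upper_mccool_hom[OF assms(2)]] by blast
  show ?thesis
    using x assms magnus_law2[OF upper_mccool_law[OF assms(1)] bx ij]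
      magnus_law1[OF upper_mccool_law[OF assms(2)] x, of i]
    by (simp add: mccool_dual_def) (simp add: mult_upper_mccool compose_def)
qed

lemma mccool_dual_cocycle:
  assumes "1 \<le> j" "j < i" "i \<le> n"
  shows "mccool_dual i j \<in> H1_cohom G"
  using mccool_dual_mult assms by (auto simp: H1_cohom_def mccool_dual_def)

lemma mccool_dual_gen:
  assumes "1 \<le> j" "j < i" "i \<le> n" "1 \<le> l" "l < k" "k \<le> n"
  shows "mccool_dual k l (mccool_gen n i j) = (if k = i \<and> l = j then 1 else 0)"
  using assms mccool_gen_in[of j i]
  by (auto simp: mccool_dual_def mccool_gen_word letter_coeff_def)

text \<open>In the degree three law of \<open>a\<close> at the word \<open>b (free_gen i)\<close>,
  the two mixed terms are products of a degree two coefficient of \<open>a\<close> and one of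
  \<open>b\<close>, that is, cup products of dual classes. The remaining terms form a coboundary, so
  the sum of these cup products is 0 in cohomology.\<close>

lemma mccool_cochain_coboundary:
  assumes ijk: "1 \<le> k" "k < j" "j < i" "i \<le> n"
  shows "coboundary1 G (mccool_cochain i j k) = (\<lambda>(a, b).
    mccool_dual j k a * mccool_dual i j b + mccool_dual i j a * mccool_dual i k b)"
proof -
  have "magnus3 k j i ((a \<otimes>\<^bsub>G\<^esub> b) (free_gen i)) = magnus3 k j i (b (free_gen i))
      + mccool_dual j k a * mccool_dual i j b + mccool_dual i j a * mccool_dual i k b
      + magnus3 k j i (a (free_gen i))"
    if ab: "a \<in> carrier G" "b \<in> carrier G" for a b
  proof -
    have x: "free_gen i \<in> carrier F"
      using ijk by (intro free_gen_in) auto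
    then have bx: "b (free_gen i) \<in> carrier F"
      using hom_in_carrier[OF upper_mccool_hom[OF ab(2)]] by blast
    show ?thesis
      using x ab magnus_law3[OF upper_mccool_law[OF ab(1)] bx ijk]
        magnus_law1[OF upper_mccool_law[OF ab(2)] x, of i]
      by (simp add: mccool_dual_def) (simp add: mult_upper_mccool compose_def)
  qed
  then show ?thesis
    by (auto simp: coboundary1_def mccool_cochain_def mccool_dual_def fun_eq_iff)
qed

lemma upper_mccool_commute_disjoint:
  assumes "1 \<le> j" "j < i" "i \<le> n" "1 \<le> l" "l < k" "k \<le> n" "{i, j} \<inter> {k, l} = {}"
  shows "mccool_gen n i j \<otimes>\<^bsub>G\<^esub> mccool_gen n k l = mccool_gen n k l \<otimes>\<^bsub>G\<^esub> mccool_gen n i j"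
  using assms mccool_commute_disjoint[of i j k l] by (simp add: mult_upper_mccool mccool_gen_in)

lemma upper_mccool_commute_same:
  assumes "1 \<le> k" "k < j" "j < i" "i \<le> n"
  shows "mccool_gen n i k \<otimes>\<^bsub>G\<^esub> mccool_gen n j k = mccool_gen n j k \<otimes>\<^bsub>G\<^esub> mccool_gen n i k"
  using assms mccool_commute_same[of i j k] by (simp add: mult_upper_mccool mccool_gen_in)

lemma upper_mccool_commute_sum:
  assumes "1 \<le> k" "k < j" "j < i" "i \<le> n"
  defines "p \<equiv> mccool_gen n i k \<otimes>\<^bsub>G\<^esub> mccool_gen n j k"
  shows "mccool_gen n i j \<otimes>\<^bsub>G\<^esub> p = p \<otimes>\<^bsub>G\<^esub> mccool_gen n i j"
proof -
  have c: "mccool_gen n i k \<in> carrier G" "mccool_gen n j k \<in> carrier G" "mccool_gen n i j \<in> carrier G"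
    using assms by (auto intro: mccool_gen_in)
  then have "p \<in> carrier G" "p = compose (carrier F) (mccool_gen n i k) (mccool_gen n j k)"
    unfolding p_def by (auto simp: mult_upper_mccool[symmetric])
  then show ?thesis
    using assms(1-4) mccool_commute_sum[of i j k] c by (simp add: mult_upper_mccool)
qed

end

subsection \<open>The bar complex\<close>

lemma lookup_map_times:
  "Poly_Mapping.lookup (Poly_Mapping.map ((*) z) c) k = z * Poly_Mapping.lookup c k"
  for z :: complex
  by (simp add: Poly_Mapping.map.rep_eq when_def)

locale bar_complex = group
begin

lemma chains1_simps:
  "carrier (chains1 G) = {c. Poly_Mapping.keys c \<subseteq> carrier G}"
  "c \<oplus>\<^bsub>chains1 G\<^esub> d = c + d"
  "\<zero>\<^bsub>chains1 G\<^esub> = 0"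
  "z \<odot>\<^bsub>chains1 G\<^esub> c = Poly_Mapping.map ((*) z) c"
  by (simp_all add: chains1_def)

lemma keys_map_times: "Poly_Mapping.keys (Poly_Mapping.map ((*) z) c) \<subseteq> Poly_Mapping.keys c"
  for z :: complex
  by (auto simp: in_keys_iff lookup_map_times)

lemma chains1_module: "module complex_ring (chains1 G)"
proof (rule complex_moduleI)
  fix x y :: "'a \<Rightarrow>\<^sub>0 complex"
  assume "x \<in> carrier (chains1 G)" "y \<in> carrier (chains1 G)"
  then show "x \<oplus>\<^bsub>chains1 G\<^esub> y \<in> carrier (chains1 G)"
    using keys_add[of x y] by (auto simp: chains1_simps)
next
  fix x :: "'a \<Rightarrow>\<^sub>0 complex" and c
  assume "x \<in> carrier (chains1 G)"
  then show "c \<odot>\<^bsub>chains1 G\<^esub> x \<in> carrier (chains1 G)"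
    using keys_map_times[of c x] by (auto simp: chains1_simps)
qed (auto simp: chains1_simps lookup_map_times lookup_add algebra_simps intro!: poly_mapping_eqI)

abbreviation "chain g \<equiv> Poly_Mapping.single g (1::complex)"

lemma chain_in [simp]: "g \<in> carrier G \<Longrightarrow> chain g \<in> carrier (chains1 G)"
  by (simp add: chains1_simps)

abbreviation "boundary g h \<equiv> chain h - chain (g \<otimes> h) + chain g"

sublocale chains: complex_space "chains1 G"
  by (rule complex_space.intro) (rule chains1_module)

lemma boundary_in:
  assumes "g \<in> carrier G" "h \<in> carrier G"
  shows "boundary g h \<in> carrier (chains1 G)"
proof -
  have "Poly_Mapping.keys (boundary g h) \<subseteq> {g, h, g \<otimes> h}"
    by (auto simp: in_keys_iff lookup_add lookup_minus lookup_single when_def split: if_splits)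
  then show ?thesis
    using assms by (auto simp: chains1_simps)
qed

lemma boundaries1_submodule: "submodule (boundaries1 G) complex_ring (chains1 G)"
  unfolding boundaries1_def using boundary_in by (intro chains.lin_span_submodule) blast

sublocale H1: complex_subspace "chains1 G" "boundaries1 G"
  by (intro complex_subspace.intro complex_subspace_axioms.intro boundaries1_submodule
      chains.complex_space_axioms)

lemma boundary_in_boundaries: "g \<in> carrier G \<Longrightarrow> h \<in> carrier G \<Longrightarrow> boundary g h \<in> boundaries1 G"
  unfolding boundaries1_def by (rule subsetD[OF chains.lin_span_incl]) blast

lemma H1_hom_eq: "H1_hom G = H1.Q"
  by (simp add: H1_hom_def)

sublocale H1_space: complex_space "H1_hom G"
  unfolding H1_hom_eq by (rule complex_space.intro) (rule H1.quot_module)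

definition hclass :: "'a \<Rightarrow> ('a \<Rightarrow>\<^sub>0 complex) set" where
  "hclass g = H1.coset (chain g)"

lemma hclass_in [simp]: "g \<in> carrier G \<Longrightarrow> hclass g \<in> carrier (H1_hom G)"
  by (simp add: H1_hom_eq H1.quot_carrier hclass_def)

lemma hclass_mult:
  assumes "g \<in> carrier G" "h \<in> carrier G"
  shows "hclass (g \<otimes> h) = hclass g \<oplus>\<^bsub>H1_hom G\<^esub> hclass h"
proof -
  have "H1.coset (chain g + chain h) = H1.coset (chain (g \<otimes> h))"
  proof (subst H1.coset_eq_iff)
    have "chain g + chain h \<oplus>\<^bsub>chains1 G\<^esub> (- 1) \<odot>\<^bsub>chains1 G\<^esub> chain (g \<otimes> h) = boundary g h"
      by (rule poly_mapping_eqI) (simp add: chains1_simps lookup_map_times lookup_add lookup_minus lookup_single when_def)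
    then show "chain g + chain h \<oplus>\<^bsub>chains1 G\<^esub> (- 1) \<odot>\<^bsub>chains1 G\<^esub> chain (g \<otimes> h) \<in> boundaries1 G"
      using boundary_in_boundaries[OF assms] by simp
  qed (use assms chains.add.m_closed[of "chain g" "chain h"] in \<open>simp_all add: chains1_simps(2)\<close>)
  then show ?thesis
    using assms H1.quot_add[of "chain g" "chain h"] by (simp add: hclass_def H1_hom_eq chains1_simps(2))
qed

lemma hclass_one: "hclass \<one> = \<zero>\<^bsub>H1_hom G\<^esub>"
  using hclass_mult[of \<one> \<one>] H1_space.add.l_cancel_one'[of "hclass \<one>" "hclass \<one>"] by simp

lemma hclass_inv:
  assumes "g \<in> carrier G"
  shows "hclass (inv g) = (- 1) \<odot>\<^bsub>H1_hom G\<^esub> hclass g"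
proof -
  have "hclass (inv g) \<oplus>\<^bsub>H1_hom G\<^esub> hclass g = \<zero>\<^bsub>H1_hom G\<^esub>"
    using hclass_mult[of "inv g" g] hclass_one assms by simp
  then have "hclass (inv g) = \<ominus>\<^bsub>H1_hom G\<^esub> hclass g"
    using assms H1_space.M.minus_equality by simp
  then show ?thesis
    using assms H1_space.minus_eq_smult by simp
qed

text \<open>A chain is built up by giving one new group element its coefficient at a time, which
  adds a multiple of a class \<open>hclass g\<close>.\<close>

lemma H1_hom_spanned:
  assumes "submodule N complex_ring (H1_hom G)" "\<And>g. g \<in> carrier G \<Longrightarrow> hclass g \<in> N"
  shows "carrier (H1_hom G) \<subseteq> N"
proof -
  have "H1.coset c \<in> N" if "c \<in> carrier (chains1 G)" for c
    using that
  proof (induction c rule: update_induct)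
    case const
    then show ?case
      using H1_space.submodule_zero[OF assms(1)] H1.quot_zero' by (simp add: H1_hom_eq chains1_simps)
  next
    case (update c g z)
    have g: "g \<in> carrier G" and c: "c \<in> carrier (chains1 G)"
      using update.prems update.hyps by (auto simp: chains1_simps keys_update)
    have eq: "Poly_Mapping.update g z c = z \<odot>\<^bsub>chains1 G\<^esub> chain g \<oplus>\<^bsub>chains1 G\<^esub> c"
      using update.hyps(1)
      by (intro poly_mapping_eqI)
        (auto simp: chains1_simps lookup_update lookup_add lookup_map_times lookup_single when_def
          in_keys_iff)
    have "H1.coset (Poly_Mapping.update g z c) =
        z \<odot>\<^bsub>H1_hom G\<^esub> hclass g \<oplus>\<^bsub>H1_hom G\<^esub> H1.coset c"
      unfolding eq H1_hom_eq hclass_def using g c by (simp add: H1.quot_add H1.quot_smult)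
    then show ?case
      using update.IH[OF c] assms(2)[OF g] H1_space.submodule_add[OF assms(1)]
        H1_space.submodule_smult[OF assms(1)] by simp
  qed
  then show ?thesis
    by (auto simp: H1_hom_eq H1.quot_carrier)
qed

section \<open>The Kronecker pairing\<close>

definition chain_pairing :: "('a \<Rightarrow> complex) \<Rightarrow> ('a \<Rightarrow>\<^sub>0 complex) \<Rightarrow> complex" where
  "chain_pairing a c = (\<Sum>g\<in>Poly_Mapping.keys c. Poly_Mapping.lookup c g * a g)"

lemma chain_pairing_superset:
  assumes "finite A" "Poly_Mapping.keys c \<subseteq> A"
  shows "chain_pairing a c = (\<Sum>g\<in>A. Poly_Mapping.lookup c g * a g)"
  unfolding chain_pairing_def
  by (rule sum.mono_neutral_left) (use assms in \<open>auto simp: in_keys_iff\<close>)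

lemma chain_pairing_add: "chain_pairing a (c + d) = chain_pairing a c + chain_pairing a d"
  using chain_pairing_superset[of "Poly_Mapping.keys c \<union> Poly_Mapping.keys d" _ a] keys_add[of c d]
  by (simp add: lookup_add algebra_simps sum.distrib)

lemma chain_pairing_smult: "chain_pairing a (Poly_Mapping.map ((*) z) c) = z * chain_pairing a c"
  using chain_pairing_superset[of "Poly_Mapping.keys c" _ a] keys_map_times[of z c]
  by (simp add: lookup_map_times algebra_simps sum_distrib_left)

lemma chain_pairing_minus: "chain_pairing a (c - d) = chain_pairing a c - chain_pairing a d"
  using chain_pairing_add[of a "c - d" d] by simp

lemma chain_pairing_chain: "chain_pairing a (chain g) = a g"
  by (simp add: chain_pairing_def)

lemma chain_pairing_boundaries:
  assumes "a \<in> H1_cohom G" "c \<in> boundaries1 G"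
  shows "chain_pairing a c = 0"
proof -
  have "boundaries1 G \<subseteq> {c \<in> carrier (chains1 G). chain_pairing a c = 0}"
    unfolding boundaries1_def
  proof (rule chains.lin_span_minimal)
    show "submodule {c \<in> carrier (chains1 G). chain_pairing a c = 0} complex_ring (chains1 G)"
    proof (rule chains.submoduleI')
      show "\<zero>\<^bsub>chains1 G\<^esub> \<in> {c \<in> carrier (chains1 G). chain_pairing a c = 0}"
        using chain_pairing_minus[of a 0 0] by (simp add: chains1_simps)
    next
      fix x y
      assume "x \<in> {c \<in> carrier (chains1 G). chain_pairing a c = 0}"
        "y \<in> {c \<in> carrier (chains1 G). chain_pairing a c = 0}"
      then show "x \<oplus>\<^bsub>chains1 G\<^esub> y \<in> {c \<in> carrier (chains1 G). chain_pairing a c = 0}"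
        using chains.add.m_closed[of x y] by (simp add: chain_pairing_add chains1_simps(2))
    next
      fix z x
      assume "x \<in> {c \<in> carrier (chains1 G). chain_pairing a c = 0}"
      then show "z \<odot>\<^bsub>chains1 G\<^esub> x \<in> {c \<in> carrier (chains1 G). chain_pairing a c = 0}"
        using chains.smult_in[of x z] by (simp add: chain_pairing_smult chains1_simps(4))
    qed auto
    show "{boundary g h | g h. g \<in> carrier G \<and> h \<in> carrier G} \<subseteq>
        {c \<in> carrier (chains1 G). chain_pairing a c = 0}"
      using assms(1) boundary_in
      by (auto simp: chain_pairing_add chain_pairing_minus chain_pairing_chain H1_cohom_def)
  qed
  then show ?thesis
    using assms(2) by blast
qed

text \<open>Cocycles vanish on boundaries, so the representative that \<open>SOME\<close> picks in
  \<open>pairing1\<close> does not affect the value.\<close>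

lemma pairing1_coset:
  assumes "a \<in> H1_cohom G" "c \<in> carrier (chains1 G)"
  shows "pairing1 a (H1.coset c) = chain_pairing a c"
proof -
  let ?d = "SOME d. d \<in> H1.coset c"
  have "?d \<in> H1.coset c"
    by (rule someI[of _ c]) (use assms(2) H1.A.a_rcos_self in blast)
  then obtain b where "b \<in> boundaries1 G" "?d = b + c"
    by (auto simp: a_r_coset_def' chains1_simps)
  then show ?thesis
    using chain_pairing_boundaries[OF assms(1)]
    by (simp add: pairing1_def chain_pairing_add flip: chain_pairing_def)
qed

lemma pairing1_hclass: "a \<in> H1_cohom G \<Longrightarrow> g \<in> carrier G \<Longrightarrow> pairing1 a (hclass g) = a g"
  by (simp add: hclass_def pairing1_coset chain_pairing_chain)

lemma pairing1_add:
  assumes "a \<in> H1_cohom G" "v \<in> carrier (H1_hom G)" "w \<in> carrier (H1_hom G)"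
  shows "pairing1 a (v \<oplus>\<^bsub>H1_hom G\<^esub> w) = pairing1 a v + pairing1 a w"
proof -
  obtain c d where cd: "c \<in> carrier (chains1 G)" "v = H1.coset c" "d \<in> carrier (chains1 G)" "w = H1.coset d"
    using assms(2,3) unfolding H1_hom_eq H1.quot_carrier by blast
  then have "v \<oplus>\<^bsub>H1_hom G\<^esub> w = H1.coset (c \<oplus>\<^bsub>chains1 G\<^esub> d)"
    unfolding H1_hom_eq by (simp add: H1.quot_add)
  then show ?thesis
    using cd assms(1) chains.add.m_closed[of c d]
    by (simp add: pairing1_coset) (simp add: chains1_simps chain_pairing_add)
qed

lemma pairing1_smult:
  assumes "a \<in> H1_cohom G" "v \<in> carrier (H1_hom G)"
  shows "pairing1 a (z \<odot>\<^bsub>H1_hom G\<^esub> v) = z * pairing1 a v"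
proof -
  obtain c where c: "c \<in> carrier (chains1 G)" "v = H1.coset c"
    using assms(2) unfolding H1_hom_eq H1.quot_carrier by blast
  then have "z \<odot>\<^bsub>H1_hom G\<^esub> v = H1.coset (z \<odot>\<^bsub>chains1 G\<^esub> c)"
    unfolding H1_hom_eq by (simp add: H1.quot_smult)
  then show ?thesis
    using c assms(1) chains.smult_in[of c z]
    by (simp add: pairing1_coset) (simp add: chains1_simps chain_pairing_smult)
qed

section \<open>Second cohomology and cup products\<close>

lemma cocycles2_simps:
  "f \<in> carrier (cocycles2 G) \<longleftrightarrow> (\<forall>g\<in>carrier G. \<forall>h\<in>carrier G. \<forall>k\<in>carrier G.
      f (h, k) - f (g \<otimes> h, k) + f (g, h \<otimes> k) - f (g, h) = 0) \<and>
    (\<forall>p. p \<notin> carrier G \<times> carrier G \<longrightarrow> f p = 0)"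
  "f \<oplus>\<^bsub>cocycles2 G\<^esub> f' = (\<lambda>p. f p + f' p)"
  "\<zero>\<^bsub>cocycles2 G\<^esub> = (\<lambda>_. 0)"
  "z \<odot>\<^bsub>cocycles2 G\<^esub> f = (\<lambda>p. z * f p)"
  by (simp_all add: cocycles2_def)

lemma cocycles2_module: "module complex_ring (cocycles2 G)"
proof (rule complex_moduleI)
  fix f f' assume f: "f \<in> carrier (cocycles2 G)" "f' \<in> carrier (cocycles2 G)"
  have "f (h, k) + f' (h, k) - (f (g \<otimes> h, k) + f' (g \<otimes> h, k)) + (f (g, h \<otimes> k) + f' (g, h \<otimes> k))
      - (f (g, h) + f' (g, h)) = 0"
    if "g \<in> carrier G" "h \<in> carrier G" "k \<in> carrier G" for g h k
  proof -
    have "f (h, k) - f (g \<otimes> h, k) + f (g, h \<otimes> k) - f (g, h) = 0"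
      "f' (h, k) - f' (g \<otimes> h, k) + f' (g, h \<otimes> k) - f' (g, h) = 0"
      using f that by (auto simp: cocycles2_simps)
    then show ?thesis
      by (simp add: algebra_simps add_eq_0_iff)
  qed
  then show "f \<oplus>\<^bsub>cocycles2 G\<^esub> f' \<in> carrier (cocycles2 G)"
    using f by (simp add: cocycles2_simps)
next
  fix f z assume f: "f \<in> carrier (cocycles2 G)"
  have "z * f (h, k) - z * f (g \<otimes> h, k) + z * f (g, h \<otimes> k) - z * f (g, h) = 0"
    if "g \<in> carrier G" "h \<in> carrier G" "k \<in> carrier G" for g h k
  proof -
    have "z * (f (h, k) - f (g \<otimes> h, k) + f (g, h \<otimes> k) - f (g, h)) = 0"
      using f that by (simp add: cocycles2_simps)
    then show ?thesis
      by (simp add: algebra_simps)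
  qed
  then show "z \<odot>\<^bsub>cocycles2 G\<^esub> f \<in> carrier (cocycles2 G)"
    using f by (simp add: cocycles2_simps)
qed (auto simp: cocycles2_simps fun_eq_iff algebra_simps)

sublocale cocycles: complex_space "cocycles2 G"
  by (rule complex_space.intro) (rule cocycles2_module)

lemma coboundary1_apply:
  "g \<in> carrier G \<Longrightarrow> h \<in> carrier G \<Longrightarrow> coboundary1 G c (g, h) = c h - c (g \<otimes> h) + c g"
  "p \<notin> carrier G \<times> carrier G \<Longrightarrow> coboundary1 G c p = 0"
  by (cases p; auto simp: coboundary1_def)+

lemma coboundary1_in: "coboundary1 G c \<in> carrier (cocycles2 G)"
  by (simp add: cocycles2_simps coboundary1_apply m_assoc)

lemma coboundaries_submodule: "submodule (range (coboundary1 G)) complex_ring (cocycles2 G)"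
proof (rule cocycles.submoduleI')
  show "range (coboundary1 G) \<subseteq> carrier (cocycles2 G)"
    using coboundary1_in by blast
  have "coboundary1 G (\<lambda>_. 0) = \<zero>\<^bsub>cocycles2 G\<^esub>"
    by (auto simp: coboundary1_def cocycles2_simps)
  then show "\<zero>\<^bsub>cocycles2 G\<^esub> \<in> range (coboundary1 G)"
    by (metis rangeI)
next
  fix x y assume "x \<in> range (coboundary1 G)" "y \<in> range (coboundary1 G)"
  then obtain c d where "x = coboundary1 G c" "y = coboundary1 G d"
    by blast
  then have "x \<oplus>\<^bsub>cocycles2 G\<^esub> y = coboundary1 G (\<lambda>g. c g + d g)"
    by (auto simp: coboundary1_def cocycles2_simps fun_eq_iff)
  then show "x \<oplus>\<^bsub>cocycles2 G\<^esub> y \<in> range (coboundary1 G)"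
    by blast
next
  fix z x assume "x \<in> range (coboundary1 G)"
  then obtain c where "x = coboundary1 G c"
    by blast
  then have "z \<odot>\<^bsub>cocycles2 G\<^esub> x = coboundary1 G (\<lambda>g. z * c g)"
    by (auto simp: coboundary1_def cocycles2_simps fun_eq_iff algebra_simps)
  then show "z \<odot>\<^bsub>cocycles2 G\<^esub> x \<in> range (coboundary1 G)"
    by blast
qed

sublocale H2: complex_subspace "cocycles2 G" "range (coboundary1 G)"
  by (intro complex_subspace.intro complex_subspace_axioms.intro coboundaries_submodule
      cocycles.complex_space_axioms)

lemma H2_cohom_eq: "H2_cohom G = H2.Q"
  by (simp add: H2_cohom_def)

abbreviation "cup_cocycle a b \<equiv> (\<lambda>(g, h). a g * b h)"

lemma cup_cocycle_in:
  assumes "a \<in> H1_cohom G" "b \<in> H1_cohom G"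
  shows "cup_cocycle a b \<in> carrier (cocycles2 G)"
  using assms by (auto simp: cocycles2_simps H1_cohom_def algebra_simps)

lemma cup_product_eq: "cup_product G a b = H2.coset (cup_cocycle a b)"
  by (simp add: cup_product_def)

text \<open>For commuting \<open>g\<close> and \<open>h\<close>, the chain
  \<open>(g, h) - (h, g)\<close> is a cycle, the image of the fundamental class of a torus.
  Evaluation at it is a linear form on the second cohomology, and on a cup product it gives the
  determinant in \<open>wedge_pairing\<close>.\<close>

lemma commuting_holonomy_relation:
  assumes g: "g \<in> carrier G" and h: "h \<in> carrier G" and gh: "g \<otimes> h = h \<otimes> g"
  shows "wedge_bracket (H1_hom G) [(hclass g, hclass h)] \<in> holonomy_relations G"
proof -
  \<comment> \<open>The choice of a cocycle in the class is harmless: a coboundary takes equal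
    values at \<open>(g, h)\<close> and \<open>(h, g)\<close> because the two products
    agree.\<close>
  define \<phi> where "\<phi> A = (let f = (SOME f. f \<in> A) in f (g, h) - f (h, g))" for A :: "('a \<times> 'a \<Rightarrow> complex) set"
  have \<phi>: "\<phi> (H2.coset f) = f (g, h) - f (h, g)" if f: "f \<in> carrier (cocycles2 G)" for f
  proof -
    let ?f = "SOME f'. f' \<in> H2.coset f"
    have "?f \<in> H2.coset f"
      by (rule someI[of _ f]) (use f H2.A.a_rcos_self in blast)
    then obtain c where "?f = (\<lambda>p. coboundary1 G c p + f p)"
      by (auto simp: a_r_coset_def' cocycles2_simps)
    then show ?thesis
      using g h gh by (simp add: \<phi>_def Let_def coboundary1_apply)
  qed
  have "\<phi> \<in> linear_forms (H2_cohom G)"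
    unfolding linear_forms_def H2_cohom_eq H2.quot_carrier
    using cocycles.add.m_closed cocycles.smult_in
    by (auto simp: H2.quot_add H2.quot_smult \<phi> algebra_simps) (auto simp: cocycles2_simps algebra_simps)
  moreover have "wedge_pairing a b [(hclass g, hclass h)] = \<phi> (cup_product G a b)"
    if "a \<in> H1_cohom G" "b \<in> H1_cohom G" for a b
    using that g h by (simp add: cup_product_eq \<phi> cup_cocycle_in wedge_pairing_def pairing1_hclass mult.commute)
  ultimately show ?thesis
    using g h unfolding holonomy_relations_def by fastforce
qed

text \<open>The upper bound on the holonomy relations: whatever comes from a linear form on the
  second cohomology pairs to 0 with a combination of wedges whose cup product is exact.\<close>

lemma exact_wedge_pairing:
  assumes \<phi>: "\<phi> \<in> linear_forms (H2_cohom G)"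
    and ps: "\<forall>a\<in>H1_cohom G. \<forall>b\<in>H1_cohom G. wedge_pairing a b ps = \<phi> (cup_product G a b)"
    and a: "a \<in> H1_cohom G" "b \<in> H1_cohom G" and a': "a' \<in> H1_cohom G" "b' \<in> H1_cohom G"
    and exact: "coboundary1 G c = (\<lambda>(g, h). a g * b h + a' g * b' h)"
  shows "wedge_pairing a b ps + wedge_pairing a' b' ps = 0"
proof -
  note cup = cup_cocycle_in[OF a] cup_cocycle_in[OF a']
  have "cup_product G a b \<oplus>\<^bsub>H2_cohom G\<^esub> cup_product G a' b' =
      H2.coset (cup_cocycle a b \<oplus>\<^bsub>cocycles2 G\<^esub> cup_cocycle a' b')"
    using cup by (simp add: cup_product_eq H2_cohom_eq H2.quot_add)
  also have "cup_cocycle a b \<oplus>\<^bsub>cocycles2 G\<^esub> cup_cocycle a' b' = coboundary1 G c"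
    by (auto simp: exact cocycles2_simps)
  also have "H2.coset (coboundary1 G c) = \<zero>\<^bsub>H2_cohom G\<^esub>"
    using H2.coset_eq_N_iff[OF coboundary1_in] by (simp add: H2_cohom_eq H2.quot_zero)
  finally have "\<phi> (cup_product G a b) + \<phi> (cup_product G a' b') = \<phi> \<zero>\<^bsub>H2_cohom G\<^esub>"
    using \<phi> cup unfolding linear_forms_def H2_cohom_eq H2.quot_carrier cup_product_eq by force
  moreover have "\<phi> \<zero>\<^bsub>H2_cohom G\<^esub> = 0"
  proof -
    have z: "\<zero>\<^bsub>H2_cohom G\<^esub> \<in> carrier (H2_cohom G)" "0 \<odot>\<^bsub>H2_cohom G\<^esub> \<zero>\<^bsub>H2_cohom G\<^esub> = \<zero>\<^bsub>H2_cohom G\<^esub>"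
      unfolding H2_cohom_eq H2.quot_zero' by (auto simp: H2.quot_carrier H2.quot_smult)
    then have "\<phi> \<zero>\<^bsub>H2_cohom G\<^esub> = 0 * \<phi> \<zero>\<^bsub>H2_cohom G\<^esub>"
      using \<phi> unfolding linear_forms_def by (metis (mono_tags, lifting) mem_Collect_eq)
    then show ?thesis
      by simp
  qed
  ultimately show ?thesis
    using ps a a' by simp
qed

lemma wedge_pairing_swap: "wedge_pairing a b ps = - wedge_pairing b a ps"
  by (induction ps) (auto simp: wedge_pairing_def algebra_simps)

end

subsection \<open>The metabelian quotient of the holonomy Lie algebra\<close>

lemma wedge_bracket_simps:
  "wedge_bracket V [] = \<zero>\<^bsub>free_lie V\<^esub>"
  "wedge_bracket V ((v, w) # ps) =
    (lie_class V (LGen v) \<otimes>\<^bsub>free_lie V\<^esub> lie_class V (LGen w)) \<oplus>\<^bsub>free_lie V\<^esub> wedge_bracket V ps"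
  by (simp_all add: wedge_bracket_def)

lemma wedge_bracket_in: "wedge_bracket V ps \<in> carrier (free_lie V)"
proof (induction ps)
  case (Cons p ps)
  then obtain t where "wedge_bracket V ps = lie_class V t"
    unfolding carrier_free_lie by blast
  then show ?case
    by (cases p) (simp add: wedge_bracket_simps free_lie_bracket free_lie_add)
qed (simp add: wedge_bracket_simps free_lie_zero)

context bar_complex
begin

sublocale hol: lie_ideal_quotient "free_lie (H1_hom G)" "holonomy_ideal G"
proof (intro lie_ideal_quotient.intro free_lie_algebra lie_ideal_quotient_axioms.intro)
  show "lie_ideal (free_lie (H1_hom G)) (holonomy_ideal G)"
    unfolding holonomy_ideal_def
    by (rule lie_algebra.lie_ideal_gen_ideal[OF free_lie_algebra])
      (auto simp: holonomy_relations_def wedge_bracket_in)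
qed

lemma holonomy_lie_eq: "holonomy_lie G = hol.Q"
  by (simp add: holonomy_lie_def)

lemma holonomy_lie_algebra: "lie_algebra (holonomy_lie G)"
  unfolding holonomy_lie_eq by (rule hol.quot_lie_algebra)

sublocale met: lie_ideal_quotient "holonomy_lie G" "holonomy_derived2 G"
  by (intro lie_ideal_quotient.intro holonomy_lie_algebra lie_ideal_quotient_axioms.intro)
    (unfold holonomy_derived2_def holonomy_derived_def,
      rule lie_algebra.lie_derived2_ideal[OF holonomy_lie_algebra])

abbreviation "metabelian_holonomy \<equiv> met.Q"

sublocale L: metabelian_lie_algebra metabelian_holonomy
proof (intro metabelian_lie_algebra.intro metabelian_lie_algebra_axioms.intro met.quot_lie_algebra)
  fix w x y z
  assume "w \<in> carrier met.Q" "x \<in> carrier met.Q" "y \<in> carrier met.Q" "z \<in> carrier met.Q"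
  then obtain a b c d where abcd: "a \<in> carrier (holonomy_lie G)" "b \<in> carrier (holonomy_lie G)"
      "c \<in> carrier (holonomy_lie G)" "d \<in> carrier (holonomy_lie G)"
    and eq: "w = met.coset a" "x = met.coset b" "y = met.coset c" "z = met.coset d"
    unfolding met.quot_carrier by blast
  have "(a \<otimes>\<^bsub>holonomy_lie G\<^esub> b) \<otimes>\<^bsub>holonomy_lie G\<^esub> (c \<otimes>\<^bsub>holonomy_lie G\<^esub> d) \<in> holonomy_derived2 G"
    unfolding holonomy_derived2_def holonomy_derived_def
    by (intro met.bracket_in_lie_derived abcd)
  then show "(w \<otimes>\<^bsub>met.Q\<^esub> x) \<otimes>\<^bsub>met.Q\<^esub> (y \<otimes>\<^bsub>met.Q\<^esub> z) = \<zero>\<^bsub>met.Q\<^esub>"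
    using abcd by (simp add: eq met.quot_bracket met.quot_zero met.coset_eq_N_iff)
qed

definition hol_gen :: "('a \<Rightarrow>\<^sub>0 complex) set \<Rightarrow> ('a \<Rightarrow>\<^sub>0 complex) set lie_term set set set" where
  "hol_gen v = met.coset (holonomy_gen G v)"

lemma holonomy_gen_eq: "holonomy_gen G v = hol.coset (lie_class (H1_hom G) (LGen v))"
  by (simp add: holonomy_gen_def)

lemma hol_coset_in: "x \<in> carrier (free_lie (H1_hom G)) \<Longrightarrow> hol.coset x \<in> carrier (holonomy_lie G)"
  by (simp add: holonomy_lie_eq hol.quot_carrier)

lemma holonomy_gen_in: "holonomy_gen G v \<in> carrier (holonomy_lie G)"
  by (simp add: holonomy_gen_eq hol_coset_in)

lemma hol_gen_in: "hol_gen v \<in> carrier metabelian_holonomy"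
  using holonomy_gen_in by (simp add: hol_gen_def met.quot_carrier)

lemma hol_gen_linear: "linear_from (H1_hom G) metabelian_holonomy hol_gen"
proof -
  have 1: "holonomy_gen G (v \<oplus>\<^bsub>H1_hom G\<^esub> w) = holonomy_gen G v \<oplus>\<^bsub>holonomy_lie G\<^esub> holonomy_gen G w"
    if "v \<in> carrier (H1_hom G)" "w \<in> carrier (H1_hom G)" for v w
  proof -
    have "lie_class (H1_hom G) (LGen (v \<oplus>\<^bsub>H1_hom G\<^esub> w)) =
        lie_class (H1_hom G) (LAdd (LGen v) (LGen w))"
      using lie_eq.gen_add[OF that] lie_class_eq_iff by blast
    then show ?thesis
      by (simp add: holonomy_gen_eq holonomy_lie_eq hol.quot_add free_lie_add)
  qed
  have 2: "holonomy_gen G (c \<odot>\<^bsub>H1_hom G\<^esub> v) = c \<odot>\<^bsub>holonomy_lie G\<^esub> holonomy_gen G v"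
    if "v \<in> carrier (H1_hom G)" for v c
  proof -
    have "lie_class (H1_hom G) (LGen (c \<odot>\<^bsub>H1_hom G\<^esub> v)) = lie_class (H1_hom G) (LScale c (LGen v))"
      using lie_eq.gen_scale[OF that] lie_class_eq_iff by blast
    then show ?thesis
      by (simp add: holonomy_gen_eq holonomy_lie_eq hol.quot_smult free_lie_smult)
  qed
  have 3: "holonomy_gen G v = \<zero>\<^bsub>holonomy_lie G\<^esub>" if "v \<notin> carrier (H1_hom G)" for v
  proof -
    have "lie_class (H1_hom G) (LGen v) = \<zero>\<^bsub>free_lie (H1_hom G)\<^esub>"
      unfolding free_lie_zero using lie_eq.gen_outside[OF that] lie_class_eq_iff by blast
    then show ?thesis
      by (simp add: holonomy_gen_eq holonomy_lie_eq hol.quot_zero')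
  qed
  show ?thesis
    using hol_gen_in 1 2 3 holonomy_gen_in
    by (simp add: linear_from_def hol_gen_def met.quot_add met.quot_smult met.quot_zero')
qed

lemma hol_gen_generates: "lie_generated_by metabelian_holonomy (range hol_gen)"
proof -
  have "lie_generated_by (holonomy_lie G) (range (holonomy_gen G))"
    using hol.quot_generated_by[OF free_lie_generated]
    by (simp add: holonomy_lie_eq holonomy_gen_eq image_image image_subset_iff)
  then have "lie_generated_by metabelian_holonomy (met.coset ` range (holonomy_gen G))"
    by (rule met.quot_generated_by) (use holonomy_gen_in in auto)
  then show ?thesis
    by (simp add: image_image hol_gen_def)
qed

text \<open>The homology classes that \<open>hol_gen\<close> sends into a subalgebra form a
  subspace, so a subset spanning the first homology is enough to generate.\<close>

lemma hol_gen_generates_subset: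
  assumes S: "S \<subseteq> carrier G"
    and span: "\<And>N. submodule N complex_ring (H1_hom G) \<Longrightarrow> hclass ` S \<subseteq> N \<Longrightarrow> hclass ` carrier G \<subseteq> N"
  shows "lie_generated_by metabelian_holonomy (hol_gen ` hclass ` S)"
  unfolding lie_generated_by_def
proof (intro allI impI)
  fix I assume I: "lie_subalgebra metabelian_holonomy I" "hol_gen ` hclass ` S \<subseteq> I"
  then have sub: "submodule I complex_ring metabelian_holonomy"
    by (simp add: lie_subalgebra_def)
  note closed = L.submodule_zero[OF sub] L.submodule_add[OF sub] L.submodule_smult[OF sub]
  let ?N = "{v \<in> carrier (H1_hom G). hol_gen v \<in> I}"
  have N: "submodule ?N complex_ring (H1_hom G)"
  proof (rule H1_space.submoduleI')
    have "hol_gen \<zero>\<^bsub>H1_hom G\<^esub> = 0 \<odot>\<^bsub>metabelian_holonomy\<^esub> hol_gen \<zero>\<^bsub>H1_hom G\<^esub>"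
      using hol_gen_linear H1_space.smult_zero_right[of 0] unfolding linear_from_def
      by (metis H1_space.M.zero_closed)
    then have "hol_gen \<zero>\<^bsub>H1_hom G\<^esub> = \<zero>\<^bsub>metabelian_holonomy\<^esub>"
      using L.smult_zero_left hol_gen_in by simp
    then show "\<zero>\<^bsub>H1_hom G\<^esub> \<in> ?N"
      using closed(1) by simp
  qed (use closed hol_gen_linear in \<open>auto simp: linear_from_def\<close>)
  have "hclass ` S \<subseteq> ?N"
    using S I(2) hclass_in by blast
  then have "hclass ` carrier G \<subseteq> ?N"
    by (rule span[OF N])
  then have "carrier (H1_hom G) \<subseteq> ?N"
    by (intro H1_hom_spanned[OF N]) auto
  moreover have "hol_gen v = \<zero>\<^bsub>metabelian_holonomy\<^esub>" if "v \<notin> carrier (H1_hom G)" for v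
    using hol_gen_linear that by (simp add: linear_from_def)
  ultimately have "range hol_gen \<subseteq> I"
    using closed(1) by (metis (mono_tags, lifting) image_subsetI mem_Collect_eq subsetD)
  then show "carrier metabelian_holonomy \<subseteq> I"
    using hol_gen_generates I(1) by (simp add: lie_generated_by_def)
qed

lemma commuting_hol_gen:
  assumes "g \<in> carrier G" "h \<in> carrier G" "g \<otimes> h = h \<otimes> g"
  shows "hol_gen (hclass g) \<otimes>\<^bsub>metabelian_holonomy\<^esub> hol_gen (hclass h) = \<zero>\<^bsub>metabelian_holonomy\<^esub>"
proof -
  let ?x = "\<lambda>g. lie_class (H1_hom G) (LGen (hclass g))"
  have "?x g \<otimes>\<^bsub>free_lie (H1_hom G)\<^esub> ?x h \<in> holonomy_ideal G"
    using commuting_holonomy_relation[OF assms] hol.lie_ideal_gen_incl[of "holonomy_relations G"]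
    by (auto simp: holonomy_ideal_def wedge_bracket_simps)
  then have "holonomy_gen G (hclass g) \<otimes>\<^bsub>holonomy_lie G\<^esub> holonomy_gen G (hclass h) = \<zero>\<^bsub>holonomy_lie G\<^esub>"
    by (simp add: holonomy_gen_eq holonomy_lie_eq hol.quot_bracket hol.quot_zero hol.coset_eq_N_iff)
  then show ?thesis
    using holonomy_gen_in by (simp add: hol_gen_def met.quot_bracket met.quot_zero')
qed

section \<open>The infinitesimal Alexander invariant as a module\<close>

lemma alexander_simps:
  "carrier (inf_alexander_invariant G) = met.coset ` holonomy_derived G"
  "\<zero>\<^bsub>inf_alexander_invariant G\<^esub> = \<zero>\<^bsub>metabelian_holonomy\<^esub>"
  "P \<odot>\<^bsub>inf_alexander_invariant G\<^esub> x = sym_act metabelian_holonomy hol_gen (SOME t. t \<in> P) x"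
  by (simp_all add: inf_alexander_invariant_def Let_def hol_gen_def[abs_def])

lemma alexander_in_D:
  assumes "x \<in> carrier (inf_alexander_invariant G)"
  shows "x \<in> L.D"
proof -
  obtain y where "y \<in> holonomy_derived G" "x = met.coset y"
    using assms unfolding alexander_simps by blast
  then show ?thesis
    using lie_hom_derived[OF holonomy_lie_algebra met.quot_lie_algebra met.coset_lie_hom, of
        "carrier (holonomy_lie G)" "carrier metabelian_holonomy" y]
    by (simp add: holonomy_derived_def met.quot_carrier)
qed

lemma bracket_in_alexander:
  "hol_gen v \<otimes>\<^bsub>metabelian_holonomy\<^esub> hol_gen w \<in> carrier (inf_alexander_invariant G)"
  using holonomy_gen_in
  by (auto simp: alexander_simps hol_gen_def met.quot_bracket holonomy_derived_def
      intro!: met.bracket_in_lie_derived)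

text \<open>The module structure acts by an expression that \<open>SOME\<close> picks from the
  class. By \<open>sym_act_cong\<close> the given \<open>t\<close> acts in the same way, so the
  action can be computed with explicit expressions.\<close>

lemma alexander_smult:
  assumes "x \<in> carrier (inf_alexander_invariant G)"
  shows "sym_class (H1_hom G) t \<odot>\<^bsub>inf_alexander_invariant G\<^esub> x = sym_act metabelian_holonomy hol_gen t x"
proof -
  have "(SOME s. s \<in> sym_class (H1_hom G) t) \<in> sym_class (H1_hom G) t"
    by (rule someI[of _ t]) (simp add: in_sym_class_iff sym_eq.refl)
  then show ?thesis
    using L.sym_act_cong[OF hol_gen_in hol_gen_linear _ alexander_in_D[OF assms]]
    by (simp add: in_sym_class_iff alexander_simps(3))
qed

lemma annihilator_iff:
  "sym_class (H1_hom G) t \<in> annihilator (sym_alg (H1_hom G)) (inf_alexander_invariant G) \<longleftrightarrow>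
    (\<forall>x\<in>carrier (inf_alexander_invariant G).
      sym_act metabelian_holonomy hol_gen t x = \<zero>\<^bsub>metabelian_holonomy\<^esub>)"
  by (simp add: annihilator_def alexander_smult alexander_simps(2))

text \<open>A linear map into a metabelian algebra extends to the free Lie algebra, factors through
  the holonomy Lie algebra once it kills the relations, and kills the second derived algebra because
  that of \<open>M\<close> is 0.\<close>

lemma lie_hom_from_holonomy:
  assumes M: "lie_algebra M" "linear_from (H1_hom G) M \<rho>"
    and metabelian: "\<And>w x y z. w \<in> carrier M \<Longrightarrow> x \<in> carrier M \<Longrightarrow> y \<in> carrier M \<Longrightarrow> z \<in> carrier M \<Longrightarrow>
      (w \<otimes>\<^bsub>M\<^esub> x) \<otimes>\<^bsub>M\<^esub> (y \<otimes>\<^bsub>M\<^esub> z) = \<zero>\<^bsub>M\<^esub>"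
    and rel: "\<And>ps \<phi>. set ps \<subseteq> carrier (H1_hom G) \<times> carrier (H1_hom G) \<Longrightarrow>
      \<phi> \<in> linear_forms (H2_cohom G) \<Longrightarrow>
      (\<forall>a\<in>H1_cohom G. \<forall>b\<in>H1_cohom G. wedge_pairing a b ps = \<phi> (cup_product G a b)) \<Longrightarrow>
      foldr (\<lambda>(v, w) y. (\<rho> v \<otimes>\<^bsub>M\<^esub> \<rho> w) \<oplus>\<^bsub>M\<^esub> y) ps \<zero>\<^bsub>M\<^esub> = \<zero>\<^bsub>M\<^esub>"
  obtains f where "lie_hom metabelian_holonomy M f" "\<And>v. f (hol_gen v) = \<rho> v"
proof -
  interpret M: metabelian_lie_algebra M
    using M(1) metabelian by (intro metabelian_lie_algebra.intro metabelian_lie_algebra_axioms.intro) auto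
  obtain f where f: "lie_hom (free_lie (H1_hom G)) M f" "\<And>t. f (lie_class (H1_hom G) t) = lie_eval M \<rho> t"
    using M.free_lie_hom[OF M(2)] by blast
  note hom_zero = lie_hom_zero[OF free_lie_algebra M(1) f(1)]
  have wedge: "f (wedge_bracket (H1_hom G) ps) = foldr (\<lambda>(v, w) y. (\<rho> v \<otimes>\<^bsub>M\<^esub> \<rho> w) \<oplus>\<^bsub>M\<^esub> y) ps \<zero>\<^bsub>M\<^esub>" for ps
  proof (induction ps)
    case (Cons p ps)
    then show ?case
      by (cases p) (simp add: wedge_bracket_simps lie_homD[OF f(1)] wedge_bracket_in f(2))
  qed (simp add: wedge_bracket_simps hom_zero)
  have "holonomy_ideal G \<subseteq> {x \<in> carrier (free_lie (H1_hom G)). f x = \<zero>\<^bsub>M\<^esub>}"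
    unfolding holonomy_ideal_def
    by (rule hol.lie_ideal_gen_minimal[OF lie_hom_kernel[OF free_lie_algebra M(1) f(1)]])
      (use rel wedge in \<open>auto simp: holonomy_relations_def wedge_bracket_in\<close>)
  then obtain g where g: "lie_hom (holonomy_lie G) M g"
    "\<And>x. x \<in> carrier (free_lie (H1_hom G)) \<Longrightarrow> g (hol.coset x) = f x"
    using hol.lie_hom_lift[OF M(1) f(1)] unfolding holonomy_lie_eq by blast
  have "g x \<in> lie_derived M M.D" if "x \<in> holonomy_derived2 G" for x
    using that unfolding holonomy_derived2_def
  proof (rule lie_hom_derived[OF holonomy_lie_algebra M(1) g(1), rotated 2])
    show "holonomy_derived G \<subseteq> carrier (holonomy_lie G)"
      unfolding holonomy_derived_def by (rule met.submodule_subset[OF met.lie_derived_submodule]) simp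
    show "M.D \<subseteq> carrier M"
      by auto
    show "g a \<in> M.D" if "a \<in> holonomy_derived G" for a
      using lie_hom_derived[OF holonomy_lie_algebra M(1) g(1), of "carrier (holonomy_lie G)" "carrier M" a]
        that lie_hom_closed[OF g(1)] by (simp add: holonomy_derived_def)
  qed
  \<comment> \<open>The hypothesis speaks of brackets of brackets; it is extended linearly in one
    argument by \<open>bracket_D\<close> and in the other one here.\<close>
  moreover have "lie_derived M M.D \<subseteq> {\<zero>\<^bsub>M\<^esub>}"
  proof (rule M.lie_derived_induct[OF M.submodule_trivial])
    fix x y assume x: "x \<in> M.D" and y: "y \<in> M.D"
    have "M.D \<subseteq> {x \<in> carrier M. y \<otimes>\<^bsub>M\<^esub> x \<in> {\<zero>\<^bsub>M\<^esub>}}"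
    proof (rule M.lie_derived_induct[OF M.submodule_bracket_vimage[OF M.submodule_trivial]])
      show "u \<otimes>\<^bsub>M\<^esub> v \<in> {x \<in> carrier M. y \<otimes>\<^bsub>M\<^esub> x \<in> {\<zero>\<^bsub>M\<^esub>}}"
        if "u \<in> carrier M" "v \<in> carrier M" for u v
        using that M.bracket_D[OF that y] M.bracket_anti[of y "u \<otimes>\<^bsub>M\<^esub> v"] y by simp
    qed (use y in simp)
    then show "x \<otimes>\<^bsub>M\<^esub> y \<in> {\<zero>\<^bsub>M\<^esub>}"
      using x M.bracket_anti[of x y] y by auto
  qed
  ultimately have "g x = \<zero>\<^bsub>M\<^esub>" if "x \<in> holonomy_derived2 G" for x
    using that by blast
  then obtain h where h: "lie_hom metabelian_holonomy M h"
    "\<And>x. x \<in> carrier (holonomy_lie G) \<Longrightarrow> h (met.coset x) = g x"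
    using met.lie_hom_lift[OF M(1) g(1)] by blast
  have "h (hol_gen v) = \<rho> v" for v
    using h(2)[OF holonomy_gen_in[of v]] g(2)[OF lie_class_in] f(2)
    by (simp add: hol_gen_def holonomy_gen_eq)
  then show ?thesis
    using that h(1) by blast
qed

end

lemma sym_act_lie_hom:
  assumes "lie_algebra L" "lie_hom L M f" "\<And>v. \<iota> v \<in> carrier L" "x \<in> carrier L"
  shows "f (sym_act L \<iota> t x) = sym_act M (\<lambda>v. f (\<iota> v)) t (f x)"
proof -
  interpret lie_algebra L by fact
  have closed: "sym_act L \<iota> t x \<in> carrier L" if "x \<in> carrier L" for t x
    using that by (induction t arbitrary: x) (simp_all add: assms(3))
  show "f (sym_act L \<iota> t x) = sym_act M (\<lambda>v. f (\<iota> v)) t (f x)"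
    using assms(4) by (induction t arbitrary: x) (simp_all add: lie_homD[OF assms(2)] assms(3) closed)
qed

subsection \<open>The annihilator of the infinitesimal Alexander invariant\<close>

context mccool
begin

sublocale bar: bar_complex G
  by (rule bar_complex.intro) (rule upper_mccool_group)

abbreviation "M \<equiv> bar.metabelian_holonomy"

definition mccool_class :: "nat \<Rightarrow> nat \<Rightarrow> ((letter list \<Rightarrow> letter list) \<Rightarrow>\<^sub>0 complex) set" where
  "mccool_class i j = bar.hclass (mccool_gen n i j)"

abbreviation "x i j \<equiv> bar.hol_gen (mccool_class i j)"

lemma mccool_class_in:
  "1 \<le> j \<Longrightarrow> j < i \<Longrightarrow> i \<le> n \<Longrightarrow> mccool_class i j \<in> carrier (H1_hom G)"
  by (simp add: mccool_class_def mccool_gen_in)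

lemma mccool_classes_generate:
  "lie_generated_by M {x i j | i j. 1 \<le> j \<and> j < i \<and> i \<le> n}"
proof -
  let ?S = "{mccool_gen n i j | i j. 1 \<le> j \<and> j < i \<and> i \<le> n}"
  have "lie_generated_by M (bar.hol_gen ` bar.hclass ` ?S)"
  proof (rule bar.hol_gen_generates_subset)
    show "?S \<subseteq> carrier G"
      using mccool_gen_in by auto
    fix N assume N: "submodule N complex_ring (H1_hom G)" "bar.hclass ` ?S \<subseteq> N"
    have "bar.hclass a \<in> N" if "a \<in> carrier G" for a
      using that
    proof (induction a rule: upper_mccool_induct)
      case one
      then show ?case
        using bar.H1_space.submodule_zero[OF N(1)] bar.hclass_one by simp
    next
      case (gen i j)
      then show ?case
        using N(2) by blast
    next
      case (inv a)
      then show ?case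
        using bar.H1_space.submodule_smult[OF N(1)] bar.hclass_inv by simp
    next
      case (mult a b)
      then show ?case
        using bar.H1_space.submodule_add[OF N(1)] bar.hclass_mult by simp
    qed
    then show "bar.hclass ` carrier G \<subseteq> N"
      by blast
  qed
  moreover have "bar.hol_gen ` bar.hclass ` ?S = {x i j | i j. 1 \<le> j \<and> j < i \<and> i \<le> n}"
    unfolding mccool_class_def by blast
  ultimately show ?thesis
    by simp
qed

lemma square_kills_brackets:
  assumes "4 \<le> n" "1 \<le> j" "j < i" "i \<le> n" "1 \<le> l" "l < k" "k \<le> n"
  shows "x 2 1 \<otimes>\<^bsub>M\<^esub> (x 4 3 \<otimes>\<^bsub>M\<^esub> (x 2 1 \<otimes>\<^bsub>M\<^esub> (x 4 3 \<otimes>\<^bsub>M\<^esub> (x i j \<otimes>\<^bsub>M\<^esub> x k l)))) = \<zero>\<^bsub>M\<^esub>"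
proof (rule bar.L.mccool_relations_kill[where x = x and n = n])
  show "x i j \<in> carrier M" for i j
    by (rule bar.hol_gen_in)
  show "x i j \<otimes>\<^bsub>M\<^esub> x k l = \<zero>\<^bsub>M\<^esub>"
    if "1 \<le> j" "j < i" "i \<le> n" "1 \<le> l" "l < k" "k \<le> n" "{i, j} \<inter> {k, l} = {}" for i j k l
    unfolding mccool_class_def
    using that by (intro bar.commuting_hol_gen mccool_gen_in upper_mccool_commute_disjoint)
  show "x i k \<otimes>\<^bsub>M\<^esub> x j k = \<zero>\<^bsub>M\<^esub>" if "1 \<le> k" "k < j" "j < i" "i \<le> n" for i j k
    unfolding mccool_class_def
    using that by (intro bar.commuting_hol_gen mccool_gen_in upper_mccool_commute_same) auto
  show "x i j \<otimes>\<^bsub>M\<^esub> (x i k \<oplus>\<^bsub>M\<^esub> x j k) = \<zero>\<^bsub>M\<^esub>" if k: "1 \<le> k" "k < j" "j < i" "i \<le> n" for i j k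
  proof -
    \<comment> \<open>Homology turns the product \<open>?p\<close> into a sum, so commutation of
      \<open>?p\<close> with a generator becomes a linear relation between brackets.\<close>
    let ?p = "mccool_gen n i k \<otimes>\<^bsub>G\<^esub> mccool_gen n j k"
    have in_G: "mccool_gen n i k \<in> carrier G" "mccool_gen n j k \<in> carrier G" "mccool_gen n i j \<in> carrier G"
      using k by (auto intro: mccool_gen_in)
    have "x i k \<oplus>\<^bsub>M\<^esub> x j k = bar.hol_gen (bar.hclass ?p)"
      using bar.hol_gen_linear in_G by (simp add: linear_from_def mccool_class_def bar.hclass_mult)
    then show ?thesis
      unfolding mccool_class_def
      using bar.commuting_hol_gen[OF in_G(3) _ upper_mccool_commute_sum[OF k]] in_G by simp
  qed
qed (use assms in auto)

abbreviation "gen_term i j \<equiv> SGen (mccool_class i j)"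

text \<open>The operator commutes with all brackets, so its kernel \<open>?W\<close> on the derived
  algebra is an ideal. Then \<open>brackets_in_ideal\<close> reduces the claim to the brackets of
  two generators treated in \<open>square_kills_brackets\<close>.\<close>

lemma square_in_annihilator:
  assumes "4 \<le> n"
  shows "sym_class (H1_hom G) (sym_pow (SMult (gen_term 2 1) (gen_term 4 3)) 2)
    \<in> annihilator (sym_alg (H1_hom G)) (inf_alexander_invariant G)"
proof -
  let ?t = "sym_pow (SMult (gen_term 2 1) (gen_term 4 3)) 2"
  let ?act = "sym_act M bar.hol_gen ?t"
  let ?W = "{z \<in> bar.L.D. ?act z = \<zero>\<^bsub>M\<^esub>}"
  have W: "submodule ?W complex_ring M"
  proof (rule bar.L.submoduleI')
    show "\<zero>\<^bsub>M\<^esub> \<in> ?W"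
      using bar.L.submodule_zero[OF bar.L.D_submodule] by (simp add: numeral_2_eq_2 bar.hol_gen_in)
  qed (use bar.L.submodule_add[OF bar.L.D_submodule] bar.L.submodule_smult[OF bar.L.D_submodule] in
      \<open>auto simp: bar.L.sym_act_add[OF bar.hol_gen_in] bar.L.sym_act_smult[OF bar.hol_gen_in]\<close>)
  have brackets: "y \<otimes>\<^bsub>M\<^esub> z \<in> ?W" if "y \<in> carrier M" "z \<in> carrier M" for y z
  proof (rule bar.L.brackets_in_ideal[OF W _ mccool_classes_generate _ _ that])
    show "y \<otimes>\<^bsub>M\<^esub> w \<in> ?W" if "y \<in> carrier M" "w \<in> ?W" for y w
      using that by (simp add: bar.L.sym_act_bracket[OF bar.hol_gen_in] bar.L.bracket_in_D)
    show "{x i j | i j. 1 \<le> j \<and> j < i \<and> i \<le> n} \<subseteq> carrier M"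
      using bar.hol_gen_in by blast
    show "p \<otimes>\<^bsub>M\<^esub> q \<in> ?W" if pq: "p \<in> {x i j | i j. 1 \<le> j \<and> j < i \<and> i \<le> n}"
      "q \<in> {x i j | i j. 1 \<le> j \<and> j < i \<and> i \<le> n}" for p q
    proof -
      obtain i j k l where "p = x i j" "q = x k l" "1 \<le> j" "j < i" "i \<le> n" "1 \<le> l" "l < k" "k \<le> n"
        using pq by blast
      then show ?thesis
        using square_kills_brackets[OF assms, of j i l k]
        by (simp add: numeral_2_eq_2 bar.hol_gen_in bar.L.bracket_in_D del: One_nat_def)
    qed
  qed
  have "bar.L.D \<subseteq> ?W"
    using brackets by (intro bar.L.lie_derived_induct[OF W])
  then show ?thesis
    using bar.alexander_in_D by (auto simp: bar.annihilator_iff)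
qed

end

text \<open>The vector \<open>(f, a, b, c, s, e)\<close> stands for the linear combination with these coefficients
  in the extension of a five-dimensional Heisenberg algebra, with \<open>[a, c] = e = - [b, s]\<close>, by a
  derivation \<open>f\<close> that is the identity on \<open>b, c, e\<close> and zero on \<open>a, s\<close>.\<close>

type_synonym heis = "complex \<times> complex \<times> complex \<times> complex \<times> complex \<times> complex"

definition heis_lie :: "heis cspace" where
  "heis_lie =
    \<lparr>carrier = UNIV,
     monoid.mult = (\<lambda>(f, a, b, c, s, e) (f', a', b', c', s', e').
       (0, 0, f * b' - b * f', f * c' - c * f', 0,
        f * e' - e * f' + (a * c' - c * a') - (b * s' - s * b'))),
     one = undefined,
     ring.zero = (0, 0, 0, 0, 0, 0),
     ring.add = (\<lambda>(f, a, b, c, s, e) (f', a', b', c', s', e').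
       (f + f', a + a', b + b', c + c', s + s', e + e')),
     module.smult = (\<lambda>z (f, a, b, c, s, e). (z * f, z * a, z * b, z * c, z * s, z * e))\<rparr>"

lemma heis_simps:
  "carrier heis_lie = UNIV"
  "(f, a, b, c, s, e) \<otimes>\<^bsub>heis_lie\<^esub> (f', a', b', c', s', e') =
    (0, 0, f * b' - b * f', f * c' - c * f', 0,
     f * e' - e * f' + (a * c' - c * a') - (b * s' - s * b'))"
  "(f, a, b, c, s, e) \<oplus>\<^bsub>heis_lie\<^esub> (f', a', b', c', s', e') =
    (f + f', a + a', b + b', c + c', s + s', e + e')"
  "z \<odot>\<^bsub>heis_lie\<^esub> (f, a, b, c, s, e) = (z * f, z * a, z * b, z * c, z * s, z * e)"
  "\<zero>\<^bsub>heis_lie\<^esub> = (0, 0, 0, 0, 0, 0)"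
  by (simp_all add: heis_lie_def)

lemma heis_lie_algebra: "lie_algebra heis_lie"
  by (intro lie_algebra.intro complex_space.intro complex_moduleI lie_algebra_axioms.intro)
    (auto simp: heis_simps algebra_simps)

lemma heis_metabelian:
  "(w \<otimes>\<^bsub>heis_lie\<^esub> x) \<otimes>\<^bsub>heis_lie\<^esub> (y \<otimes>\<^bsub>heis_lie\<^esub> z) = \<zero>\<^bsub>heis_lie\<^esub>"
  by (cases w; cases x; cases y; cases z) (simp add: heis_simps)

section \<open>A representation that detects the nilpotent operator\<close>

context mccool
begin

text \<open>The classes \<open>x 4 3\<close>, \<open>x 2 1\<close>, \<open>x 3 2\<close> go to
  \<open>f\<close>, \<open>a\<close>, \<open>c\<close>; \<open>x 3 1\<close>, \<open>x 4 1\<close>,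
  \<open>x 4 2\<close> go to \<open>b - a\<close>, \<open>- b\<close>, \<open>s - c\<close>; all
  other generators go to 0. The combinations reflect that \<open>x 3 1 + x 4 1\<close> and
  \<open>x 3 2 + x 4 2\<close> commute with \<open>x 4 3\<close>: their images \<open>- a\<close>
  and \<open>s\<close> lie where \<open>f\<close> acts as 0. The value outside the carrier is the
  one that \<open>linear_from\<close> demands.\<close>

definition heis_rep :: "((letter list \<Rightarrow> letter list) \<Rightarrow>\<^sub>0 complex) set \<Rightarrow> heis" where
  "heis_rep v = (if v \<in> carrier (H1_hom G) then
      let p = \<lambda>i j. pairing1 (mccool_dual i j) v
      in (p 4 3, p 2 1 - p 3 1, p 3 1 - p 4 1, p 3 2 - p 4 2, p 4 2, 0)
    else \<zero>\<^bsub>heis_lie\<^esub>)"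

lemma heis_rep_linear:
  assumes "4 \<le> n"
  shows "linear_from (H1_hom G) heis_lie heis_rep"
proof -
  have d: "mccool_dual i j \<in> H1_cohom G" if "1 \<le> j" "j < i" "i \<le> 4" for i j
    using that assms by (intro mccool_dual_cocycle) auto
  show ?thesis
    by (simp add: linear_from_def heis_rep_def Let_def heis_simps bar.pairing1_add bar.pairing1_smult d
        bar.H1_space.M.add.m_closed algebra_simps)
qed

lemma heis_rep_gen:
  assumes "4 \<le> n" "1 \<le> j" "j < i" "i \<le> n"
  shows "heis_rep (mccool_class i j) =
    (if (i, j) = (4, 3) then 1 else 0,
     (if (i, j) = (2, 1) then 1 else 0) - (if (i, j) = (3, 1) then 1 else 0),
     (if (i, j) = (3, 1) then 1 else 0) - (if (i, j) = (4, 1) then 1 else 0),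
     (if (i, j) = (3, 2) then 1 else 0) - (if (i, j) = (4, 2) then 1 else 0),
     if (i, j) = (4, 2) then 1 else 0, 0)"
proof -
  have "pairing1 (mccool_dual k l) (mccool_class i j) = (if (i, j) = (k, l) then 1 else 0)"
    if "1 \<le> l" "l < k" "k \<le> 4" for k l
    using assms that mccool_dual_gen[of j i l k] mccool_gen_in[of j i] mccool_dual_cocycle[of l k]
    by (simp add: mccool_class_def bar.pairing1_hclass)
  then show ?thesis
    using mccool_class_in[OF assms(2-4)] by (simp add: heis_rep_def)
qed

text \<open>In the last coordinate, \<open>P 3 1 4 2\<close> arises from \<open>[a, c]\<close> and
  from \<open>- [b, s]\<close> and cancels. It has to: the generators with indices 3, 1 and 4, 2
  commute, so there are relations with \<open>P 3 1 4 2\<close> equal to 1. This is why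
  \<open>b\<close> and \<open>s\<close> accompany \<open>a\<close> and \<open>c\<close>.\<close>

lemma heis_rep_wedge:
  assumes "set ps \<subseteq> carrier (H1_hom G) \<times> carrier (H1_hom G)"
  defines "P \<equiv> \<lambda>i j k l. wedge_pairing (mccool_dual i j) (mccool_dual k l) ps"
  shows "foldr (\<lambda>(v, w) y. (heis_rep v \<otimes>\<^bsub>heis_lie\<^esub> heis_rep w) \<oplus>\<^bsub>heis_lie\<^esub> y) ps \<zero>\<^bsub>heis_lie\<^esub> =
    (0, 0, P 4 3 3 1 - P 4 3 4 1, P 4 3 3 2 - P 4 3 4 2, 0,
     P 2 1 3 2 - P 2 1 4 2 - P 3 1 3 2 + P 4 1 4 2)"
  unfolding P_def using assms(1)
  by (induction ps) (auto simp: heis_simps wedge_pairing_def heis_rep_def Let_def algebra_simps)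

text \<open>By the bounding cochain, the two pairings would be opposite if the factors of the second
  were exchanged; antisymmetry of the wedge then makes them equal.\<close>

lemma dual_wedge_pairing:
  assumes \<phi>: "\<phi> \<in> linear_forms (H2_cohom G)"
    and ps: "\<forall>a\<in>H1_cohom G. \<forall>b\<in>H1_cohom G. wedge_pairing a b ps = \<phi> (cup_product G a b)"
    and ijk: "1 \<le> k" "k < j" "j < i" "i \<le> n"
  shows "wedge_pairing (mccool_dual i j) (mccool_dual i k) ps =
    wedge_pairing (mccool_dual i j) (mccool_dual j k) ps"
proof -
  have d: "mccool_dual i j \<in> H1_cohom G" "mccool_dual i k \<in> H1_cohom G" "mccool_dual j k \<in> H1_cohom G"
    using ijk by (auto intro!: mccool_dual_cocycle)
  show ?thesis
    using bar.exact_wedge_pairing[OF \<phi> ps d(3,1) d(1,2) mccool_cochain_coboundary[OF ijk]]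
      bar.wedge_pairing_swap[of "mccool_dual j k" "mccool_dual i j" ps]
    by (simp add: add_eq_0_iff)
qed

text \<open>In the quotient, \<open>x 4 3\<close> fixes \<open>c\<close> and \<open>e\<close>, while
  \<open>x 2 1\<close> sends \<open>c\<close> to \<open>e\<close>, so the operator sends
  \<open>c\<close> to \<open>e\<close> for every \<open>N\<close>.\<close>

lemma product_not_in_annihilator:
  assumes n: "4 \<le> n"
  shows "sym_class (H1_hom G) (SMult (SMult (gen_term 2 1) (gen_term 4 3)) (sym_pow (gen_term 4 3) N))
    \<notin> annihilator (sym_alg (H1_hom G)) (inf_alexander_invariant G)"
proof
  let ?t = "SMult (SMult (gen_term 2 1) (gen_term 4 3)) (sym_pow (gen_term 4 3) N)"
  assume ann: "sym_class (H1_hom G) ?t \<in> annihilator (sym_alg (H1_hom G)) (inf_alexander_invariant G)"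
  obtain h where h: "lie_hom M heis_lie h" "\<And>v. h (bar.hol_gen v) = heis_rep v"
  proof (rule bar.lie_hom_from_holonomy[OF heis_lie_algebra heis_rep_linear[OF n] heis_metabelian])
    fix ps \<phi>
    assume ps: "set ps \<subseteq> carrier (H1_hom G) \<times> carrier (H1_hom G)"
      and \<phi>: "\<phi> \<in> linear_forms (H2_cohom G)"
        "\<forall>a\<in>H1_cohom G. \<forall>b\<in>H1_cohom G. wedge_pairing a b ps = \<phi> (cup_product G a b)"
    \<comment> \<open>The triples 4, 3, 1 and 4, 3, 2 clear the coordinates of \<open>b\<close> and
      \<open>c\<close>; the triples 3, 2, 1 and 4, 2, 1 clear that of \<open>e\<close>. The swaps
      bring the latter pairings into the order used in \<open>heis_rep_wedge\<close>.\<close>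
    note P = dual_wedge_pairing[OF \<phi>]
    show "foldr (\<lambda>(v, w) y. (heis_rep v \<otimes>\<^bsub>heis_lie\<^esub> heis_rep w) \<oplus>\<^bsub>heis_lie\<^esub> y) ps \<zero>\<^bsub>heis_lie\<^esub> = \<zero>\<^bsub>heis_lie\<^esub>"
      unfolding heis_rep_wedge[OF ps] using P[of 1 3 4] P[of 2 3 4] P[of 1 2 3] P[of 1 2 4] n
        bar.wedge_pairing_swap[of "mccool_dual 2 1" "mccool_dual 3 2" ps]
        bar.wedge_pairing_swap[of "mccool_dual 2 1" "mccool_dual 4 2" ps]
        bar.wedge_pairing_swap[of "mccool_dual 3 1" "mccool_dual 3 2" ps]
        bar.wedge_pairing_swap[of "mccool_dual 4 1" "mccool_dual 4 2" ps]
      by (simp add: heis_simps)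
  qed blast
  \<comment> \<open>Its image is \<open>[f, c] = c\<close>, the vector on which \<open>a\<close>
    acts nontrivially.\<close>
  let ?z = "x 4 3 \<otimes>\<^bsub>M\<^esub> x 3 2"
  have z: "?z \<in> carrier M"
    using bar.hol_gen_in by blast
  have "sym_act M bar.hol_gen ?t ?z = \<zero>\<^bsub>M\<^esub>"
    using ann bar.bracket_in_alexander by (simp add: bar.annihilator_iff)
  then have "sym_act heis_lie heis_rep ?t (h ?z) = \<zero>\<^bsub>heis_lie\<^esub>"
    using sym_act_lie_hom[where \<iota> = bar.hol_gen and t = ?t, OF bar.L.lie_algebra_axioms h(1) bar.hol_gen_in z]
      lie_hom_zero[OF bar.L.lie_algebra_axioms heis_lie_algebra h(1)] by (simp add: h(2) del: sym_act.simps)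
  moreover have rep: "heis_rep (mccool_class 4 3) = (1, 0, 0, 0, 0, 0)"
    "heis_rep (mccool_class 2 1) = (0, 1, 0, 0, 0, 0)" "heis_rep (mccool_class 3 2) = (0, 0, 0, 1, 0, 0)"
    using n by (simp_all add: heis_rep_gen)
  moreover have "h ?z = (0, 0, 0, 1, 0, 0)"
    using lie_homD(4)[OF h(1)] bar.hol_gen_in h(2) rep by (simp add: heis_simps)
  moreover have "sym_act heis_lie heis_rep (sym_pow (gen_term 4 3) N) (0, 0, 0, 1, 0, 0) = (0, 0, 0, 1, 0, 0)"
    by (induction N) (simp_all add: rep heis_simps)
  ultimately show False
    by (simp add: heis_simps)
qed

end

theorem corollary8p7:
  fixes n :: nat
  assumes "n \<ge> 4"
  shows "\<not> weakly_reduced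
    (sym_alg (H1_hom (upper_mccool_group n)))
    (sym_max_ideal (H1_hom (upper_mccool_group n)))
    (annihilator (sym_alg (H1_hom (upper_mccool_group n)))
      (inf_alexander_invariant (upper_mccool_group n)))"
proof -
  interpret mccool n .
  let ?V = "H1_hom (upper_mccool_group n)"
  let ?u = "SMult (gen_term 2 1) (gen_term 4 3)" and ?f = "gen_term 4 3"
  show ?thesis
  proof (rule not_weakly_reducedI[OF sym_alg_cring])
    show "sym_class ?V ?f \<in> sym_max_ideal ?V"
      using assms by (intro sym_class_gen_in_max_ideal mccool_class_in) auto
  next
    show "sym_class ?V ?u [^]\<^bsub>sym_alg ?V\<^esub> (2::nat)
        \<in> annihilator (sym_alg ?V) (inf_alexander_invariant (upper_mccool_group n))"
      unfolding sym_alg_pow using assms by (rule square_in_annihilator)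
  next
    fix N :: nat
    show "sym_class ?V ?u \<otimes>\<^bsub>sym_alg ?V\<^esub> sym_class ?V ?f [^]\<^bsub>sym_alg ?V\<^esub> N
        \<notin> annihilator (sym_alg ?V) (inf_alexander_invariant (upper_mccool_group n))"
      unfolding sym_alg_pow sym_alg_mult using assms by (rule product_not_in_annihilator)
  qed simp_all
qed

end
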